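(* In the setting described in the context, let $u,v\in C_0^\infty(U^\delta)$. Then (i) $$\mathcal{E}(u,v)=\mathcal{E}^{c,\delta}(u,v)+\int_{U\times U\setminus d}2\Big(u(y)-u(x)-\sum_{i=1}^n(y_i-x_i)\frac{\partial u}{\partial y_i}(y)I_{\{|x-y|\le\delta\}}(x,y)\Big)v(y)J(dxdy)+\int_U u(x)v(x)K(dx).$$ (ii) If $\chi\in C_0^\infty(U)$ equals $1$ on a neighbourhood of $\mathrm{supp}[u]\cup\mathrm{supp}[v]$, then $$\mathcal{E}(u,v)=\mathcal{E}^{c,\delta}(u,v)+\int_{U\times U\setminus d}2\Big((u(y)-u(x))\chi(x)-\sum_{i=1}^n(y_i-x_i)\frac{\partial u}{\partial y_i}(y)I_{\{|x-y|\le\delta\}}(x,y)\Big)v(y)J(dxdy)+\mathcal{E}(\chi,uv)$$ and $$\hat{\mathcal{E}}(u,v)=\hat{\mathcal{E}}^{c,\delta}(u,v)+\int_{U\times U\setminus d}2\Big((u(y)-u(x))\chi(x)-\sum_{i=1}^n(y_i-x_i)\frac{\partial u}{\partial y_i}(y)I_{\{|x-y|\le\delta\}}(x,y)\Big)v(y)\hat J(dxdy)+\hat{\mathcal{E}}(\chi,uv).$$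
   Context: Let $U\subset\mathbb{R}^n$ be open, $m$ a positive Radon measure on $U$ with $\mathrm{supp}[m]=U$, $(\cdot,\cdot)$ the inner product of $L^2(U;m)$, $d$ the diagonal of $U\times U$. One of the following holds. Case 1: $(A,D(A))$ is the generator of a strongly continuous contraction sub-Markovian semigroup on $L^2(U;m)$, its co-generator (adjoint) $(\hat A,D(\hat A))$ satisfies $C_0^\infty(U)\subset D(A)\cap D(\hat A)$, and $\mathcal{E}(u,v):=(-Au,v)$ for $u,v\in C_0^\infty(U)$. Case 2: $(\mathcal{E},D(\mathcal{E}))$ is a semi-Dirichlet form on $L^2(U;m)$ with $C_0^\infty(U)\subset D(\mathcal{E})$ such that for every relatively compact open $O\subset U$, whenever $f_n,f\in C_0^\infty(O)$ with $f_n$ and all partial derivatives converging uniformly to $f$ and its partial derivatives, $\mathcal{E}(f,g)=\lim_n\mathcal{E}(f_n,g)$ and $\mathcal{E}(g,f)=\lim_n\mathcal{E}(g,f_n)$ for all $g\in C_0^\infty(U)$. Put $\hat{\mathcal{E}}(u,v):=\mathcal{E}(v,u)$. Let $(G_\beta)_{\beta>0}$, $(\hat G_\beta)_{\beta>0}$ be the resolvent and co-resolvent, and $\sigma_\beta,\hat\sigma_\beta$ the positive Radon measures on $U\times U$ with $(\beta G_\beta u,v)=\int u(x)v(y)\sigma_\beta(dxdy)$ and $(\beta\hat G_\beta u,v)=\int u(x)v(y)\hat\sigma_\beta(dxdy)$ for $u,v\in L^2(U;m)$. $J$ (positive Radon on $U\times U\setminus d$) and $K$ (positive Radon on $U$)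 are the unique measures with $\mathcal{E}(u,v)=\int_{U\times U\setminus d}2(u(y)-u(x))v(y)J(dxdy)+\int_U uv\,dK$ for $v\in C_0^\infty(U)$ and $u\in C_0^\infty(U)$ constant near $\mathrm{supp}[v]$; $(\beta/2)\sigma_\beta\to J$ and $(\beta/2)\hat\sigma_\beta\to\hat J$ vaguely on $U\times U\setminus d$, where $\hat J(dxdy)=J(dydx)$. $U^\delta:=\{x\in U:\inf_{y\in\partial U}|x-y|>\delta\}$, and $\delta>0$ is fixed with $U^\delta\neq\emptyset$. Fix relatively compact open sets $\Omega_l\uparrow U$ and numbers $\varsigma_l\downarrow0$ such that $\Gamma_l:=\{(x,y)\in\Omega_l\times\Omega_l:|x-y|\ge\varsigma_l\}$ is a $J$-continuity set for each $l$, and let $\Lambda_l:=\{(x,y)\in\Omega_l\times\Omega_l:|x-y|<\varsigma_l\}$. Let $\delta_k\ge\delta$, $\delta_k\to\delta$, with $J(\{(x,y):|x-y|=\delta_k\})=0$ for all $k$. For $u,v\in C_0^\infty(U^\delta)$, $$\mathcal{E}^{c,\delta}(u,v):=\lim_{k\to\infty}\lim_{l\to\infty}\lim_{\beta\to\infty}\beta\Big\{\int_{\Lambda_l}(u(y)-u(x))v(y)\sigma_\beta(dxdy)+\int_{\Gamma_l}\sum_{i=1}^n(y_i-x_i)\frac{\partial u}{\partial y_i}(y)I_{\{|x-y|\le\delta_k\}}(x,y)v(y)\sigma_\beta(dxdy)\Big\},$$ and $\hat{\mathcal{E}}^{c,\delta}(u,v)$ is defined by the same formula with $\sigma_\beta$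 replaced by $\hat\sigma_\beta$; these limits exist and are independent of the choices of $\{\Omega_l\},\{\varsigma_l\},\{\delta_k\}$. *)

theory Defs
  imports "HOL-Analysis.Analysis"
begin

type_synonym 'n fn = "real^'n \<Rightarrow> real"

definition pd :: "'n::finite \<Rightarrow> 'n fn \<Rightarrow> 'n fn" where
  "pd i f = (\<lambda>x. frechet_derivative f (at x) (axis i 1))"

fun pds :: "'n::finite list \<Rightarrow> 'n fn \<Rightarrow> 'n fn" where
  "pds [] f = f"
| "pds (i # is) f = pd i (pds is f)"

definition smooth_fun :: "'n::finite fn \<Rightarrow> bool" where
  "smooth_fun f \<longleftrightarrow> (\<forall>is x. pds is f differentiable (at x))"

definition tsupp :: "'n::finite fn \<Rightarrow> (real^'n) set" where
  "tsupp f = closure {x. f x \<noteq> 0}"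

definition C0inf :: "(real^'n::finite) set \<Rightarrow> 'n fn set" where
  "C0inf U = {f. smooth_fun f \<and> compact (tsupp f) \<and> tsupp f \<subseteq> U}"

text \<open>U^delta = {x in U. inf_{y in boundary U} |x-y| > delta}, with inf of the empty set = +infinity.\<close>
definition Udelta :: "(real^'n::finite) set \<Rightarrow> real \<Rightarrow> (real^'n) set" where
  "Udelta U \<delta> = {x \<in> U. \<exists>\<epsilon>>\<delta>. \<forall>y\<in>frontier U. dist x y \<ge> \<epsilon>}"

definition offdiag :: "'a set \<Rightarrow> ('a \<times> 'a) set" where
  "offdiag U = {(x, y). x \<in> U \<and> y \<in> U \<and> x \<noteq> y}"

text \<open>A positive Radon measure on an open set S (realised as a Borel measure on the
  ambient space which vanishes outside S and is finite on compact subsets of S).\<close>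
definition radon_on :: "'a::topological_space measure \<Rightarrow> 'a set \<Rightarrow> bool" where
  "radon_on M S \<longleftrightarrow> sets M = sets borel \<and> emeasure M (- S) = 0 \<and>
     (\<forall>C. compact C \<longrightarrow> C \<subseteq> S \<longrightarrow> emeasure M C < \<infinity>)"

definition full_support :: "'a::topological_space measure \<Rightarrow> 'a set \<Rightarrow> bool" where
  "full_support M S \<longleftrightarrow> (\<forall>W. open W \<longrightarrow> W \<inter> S \<noteq> {} \<longrightarrow> emeasure M W > 0)"

definition L2 :: "'a measure \<Rightarrow> ('a \<Rightarrow> real) \<Rightarrow> bool" where
  "L2 m f \<longleftrightarrow> f \<in> borel_measurable m \<and> integrable m (\<lambda>x. (f x)\<^sup>2)"

definition ip :: "'a measure \<Rightarrow> ('a \<Rightarrow> real) \<Rightarrow> ('a \<Rightarrow> real) \<Rightarrow> real" where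
  "ip m f g = (\<integral>x. f x * g x \<partial>m)"

definition nrm :: "'a measure \<Rightarrow> ('a \<Rightarrow> real) \<Rightarrow> real" where
  "nrm m f = sqrt (ip m f f)"

definition aeeq :: "'a measure \<Rightarrow> ('a \<Rightarrow> real) \<Rightarrow> ('a \<Rightarrow> real) \<Rightarrow> bool" where
  "aeeq m f g \<longleftrightarrow> (AE x in m. f x = g x)"

text \<open>Operators on L^2 are given on representatives; they must map L^2 into L^2,
  respect m-a.e. equality and be linear up to m-a.e. equality.\<close>
definition L2_linop :: "'a measure \<Rightarrow> (('a \<Rightarrow> real) \<Rightarrow> ('a \<Rightarrow> real)) \<Rightarrow> bool" where
  "L2_linop m T \<longleftrightarrow>
     (\<forall>f. L2 m f \<longrightarrow> L2 m (T f)) \<and>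
     (\<forall>f g. L2 m f \<longrightarrow> L2 m g \<longrightarrow> aeeq m f g \<longrightarrow> aeeq m (T f) (T g)) \<and>
     (\<forall>f g a. L2 m f \<longrightarrow> L2 m g \<longrightarrow>
        aeeq m (T (\<lambda>x. a * f x + g x)) (\<lambda>x. a * T f x + T g x))"

definition contraction_subMarkov_sg ::
  "'a measure \<Rightarrow> (real \<Rightarrow> ('a \<Rightarrow> real) \<Rightarrow> ('a \<Rightarrow> real)) \<Rightarrow> bool" where
  "contraction_subMarkov_sg m T \<longleftrightarrow>
     (\<forall>t\<ge>0. L2_linop m (T t)) \<and>
     (\<forall>f. L2 m f \<longrightarrow> aeeq m (T 0 f) f) \<and>
     (\<forall>s t f. s \<ge> 0 \<longrightarrow> t \<ge> 0 \<longrightarrow> L2 m f \<longrightarrow> aeeq m (T (s + t) f) (T s (T t f))) \<and>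
     (\<forall>t f. t \<ge> 0 \<longrightarrow> L2 m f \<longrightarrow> nrm m (T t f) \<le> nrm m f) \<and>
     (\<forall>f. L2 m f \<longrightarrow> ((\<lambda>t. nrm m (\<lambda>x. T t f x - f x)) \<longlongrightarrow> 0) (at_right 0)) \<and>
     (\<forall>t f. t \<ge> 0 \<longrightarrow> L2 m f \<longrightarrow> (AE x in m. 0 \<le> f x \<and> f x \<le> 1) \<longrightarrow>
        (AE x in m. 0 \<le> T t f x \<and> T t f x \<le> 1))"

definition generator ::
  "'a measure \<Rightarrow> (real \<Rightarrow> ('a \<Rightarrow> real) \<Rightarrow> ('a \<Rightarrow> real)) \<Rightarrow> ('a \<Rightarrow> real) set
     \<Rightarrow> (('a \<Rightarrow> real) \<Rightarrow> ('a \<Rightarrow> real)) \<Rightarrow> bool" where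
  "generator m T DA A \<longleftrightarrow>
     DA = {f. L2 m f \<and> (\<exists>g. L2 m g \<and>
             ((\<lambda>t. nrm m (\<lambda>x. (T t f x - f x) / t - g x)) \<longlongrightarrow> 0) (at_right 0))} \<and>
     (\<forall>f\<in>DA. L2 m (A f) \<and>
             ((\<lambda>t. nrm m (\<lambda>x. (T t f x - f x) / t - A f x)) \<longlongrightarrow> 0) (at_right 0))"

definition in_adjoint_domain ::
  "'a measure \<Rightarrow> ('a \<Rightarrow> real) set \<Rightarrow> (('a \<Rightarrow> real) \<Rightarrow> ('a \<Rightarrow> real)) \<Rightarrow> ('a \<Rightarrow> real) \<Rightarrow> bool" where
  "in_adjoint_domain m DA A v \<longleftrightarrow>
     L2 m v \<and> (\<exists>w. L2 m w \<and> (\<forall>u\<in>DA. ip m (A u) v = ip m u w))"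

definition resolvent_of_gen ::
  "'a measure \<Rightarrow> ('a \<Rightarrow> real) set \<Rightarrow> (('a \<Rightarrow> real) \<Rightarrow> ('a \<Rightarrow> real))
     \<Rightarrow> (real \<Rightarrow> ('a \<Rightarrow> real) \<Rightarrow> ('a \<Rightarrow> real)) \<Rightarrow> bool" where
  "resolvent_of_gen m DA A G \<longleftrightarrow>
     (\<forall>\<beta>>0. \<forall>f. L2 m f \<longrightarrow> G \<beta> f \<in> DA \<and> aeeq m (\<lambda>x. \<beta> * G \<beta> f x - A (G \<beta> f) x) f)"

definition coresolvent_adj ::
  "'a measure \<Rightarrow> (real \<Rightarrow> ('a \<Rightarrow> real) \<Rightarrow> ('a \<Rightarrow> real))
     \<Rightarrow> (real \<Rightarrow> ('a \<Rightarrow> real) \<Rightarrow> ('a \<Rightarrow> real)) \<Rightarrow> bool" where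
  "coresolvent_adj m G Gh \<longleftrightarrow>
     (\<forall>\<beta>>0. \<forall>f. L2 m f \<longrightarrow> L2 m (Gh \<beta> f) \<and>
        (\<forall>g. L2 m g \<longrightarrow> ip m (Gh \<beta> f) g = ip m f (G \<beta> g)))"

definition case1 ::
  "(real^'n::finite) measure \<Rightarrow> (real^'n) set \<Rightarrow> ('n fn \<Rightarrow> 'n fn \<Rightarrow> real)
     \<Rightarrow> (real \<Rightarrow> 'n fn \<Rightarrow> 'n fn) \<Rightarrow> (real \<Rightarrow> 'n fn \<Rightarrow> 'n fn) \<Rightarrow> bool" where
  "case1 m U E G Gh \<longleftrightarrow>
     (\<exists>T DA A. contraction_subMarkov_sg m T \<and> generator m T DA A \<and>
        C0inf U \<subseteq> DA \<and> (\<forall>v\<in>C0inf U. in_adjoint_domain m DA A v) \<and>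
        (\<forall>u\<in>C0inf U. \<forall>v\<in>C0inf U. E u v = - ip m (A u) v) \<and>
        resolvent_of_gen m DA A G \<and> coresolvent_adj m G Gh)"

definition semi_dirichlet ::
  "'a measure \<Rightarrow> ('a \<Rightarrow> real) set \<Rightarrow> (('a \<Rightarrow> real) \<Rightarrow> ('a \<Rightarrow> real) \<Rightarrow> real) \<Rightarrow> bool" where
  "semi_dirichlet m D E \<longleftrightarrow>
     (\<forall>f\<in>D. L2 m f) \<and>
     (\<forall>f g. f \<in> D \<longrightarrow> L2 m g \<longrightarrow> aeeq m f g \<longrightarrow> g \<in> D) \<and>
     (\<lambda>x. 0) \<in> D \<and>
     (\<forall>f g a. f \<in> D \<longrightarrow> g \<in> D \<longrightarrow> (\<lambda>x. a * f x + g x) \<in> D) \<and>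
     (\<forall>f \<epsilon>. L2 m f \<longrightarrow> \<epsilon> > 0 \<longrightarrow> (\<exists>g\<in>D. nrm m (\<lambda>x. f x - g x) < \<epsilon>)) \<and>
     (\<forall>f g h a. f \<in> D \<longrightarrow> g \<in> D \<longrightarrow> h \<in> D \<longrightarrow>
        E (\<lambda>x. a * f x + g x) h = a * E f h + E g h \<and>
        E h (\<lambda>x. a * f x + g x) = a * E h f + E h g) \<and>
     (\<forall>f f' g. f \<in> D \<longrightarrow> f' \<in> D \<longrightarrow> g \<in> D \<longrightarrow> aeeq m f f' \<longrightarrow>
        E f g = E f' g \<and> E g f = E g f') \<and>
     (\<forall>u\<in>D. E u u \<ge> 0) \<and>
     (\<exists>Kc. \<forall>u\<in>D. \<forall>v\<in>D. \<bar>E u v + ip m u v\<bar>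
          \<le> Kc * sqrt (E u u + ip m u u) * sqrt (E v v + ip m v v)) \<and>
     (\<forall>s. (\<forall>n. s n \<in> D) \<longrightarrow>
        (\<forall>\<epsilon>>0. \<exists>N. \<forall>p\<ge>N. \<forall>q\<ge>N.
           E (\<lambda>x. s p x - s q x) (\<lambda>x. s p x - s q x) + ip m (\<lambda>x. s p x - s q x) (\<lambda>x. s p x - s q x) < \<epsilon>) \<longrightarrow>
        (\<exists>u\<in>D. (\<lambda>n. E (\<lambda>x. s n x - u x) (\<lambda>x. s n x - u x)
                    + ip m (\<lambda>x. s n x - u x) (\<lambda>x. s n x - u x)) \<longlonglongrightarrow> 0)) \<and>
     (\<forall>u\<in>D. (\<lambda>x. min (max (u x) 0) 1) \<in> D \<and>
        E (\<lambda>x. u x + min (max (u x) 0) 1) (\<lambda>x. u x - min (max (u x) 0) 1) \<ge> 0)"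

definition resolvent_form ::
  "'a measure \<Rightarrow> ('a \<Rightarrow> real) set \<Rightarrow> (('a \<Rightarrow> real) \<Rightarrow> ('a \<Rightarrow> real) \<Rightarrow> real)
     \<Rightarrow> (real \<Rightarrow> ('a \<Rightarrow> real) \<Rightarrow> ('a \<Rightarrow> real)) \<Rightarrow> bool" where
  "resolvent_form m D E G \<longleftrightarrow>
     (\<forall>\<beta>>0. \<forall>f. L2 m f \<longrightarrow> G \<beta> f \<in> D \<and>
        (\<forall>v\<in>D. E (G \<beta> f) v + \<beta> * ip m (G \<beta> f) v = ip m f v))"

definition coresolvent_form ::
  "'a measure \<Rightarrow> ('a \<Rightarrow> real) set \<Rightarrow> (('a \<Rightarrow> real) \<Rightarrow> ('a \<Rightarrow> real) \<Rightarrow> real)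
     \<Rightarrow> (real \<Rightarrow> ('a \<Rightarrow> real) \<Rightarrow> ('a \<Rightarrow> real)) \<Rightarrow> bool" where
  "coresolvent_form m D E Gh \<longleftrightarrow>
     (\<forall>\<beta>>0. \<forall>f. L2 m f \<longrightarrow> Gh \<beta> f \<in> D \<and>
        (\<forall>v\<in>D. E v (Gh \<beta> f) + \<beta> * ip m v (Gh \<beta> f) = ip m f v))"

definition form_continuity :: "(real^'n::finite) set \<Rightarrow> ('n fn \<Rightarrow> 'n fn \<Rightarrow> real) \<Rightarrow> bool" where
  "form_continuity U E \<longleftrightarrow>
     (\<forall>W. open W \<and> compact (closure W) \<and> closure W \<subseteq> U \<longrightarrow>
       (\<forall>fs f. (\<forall>k. fs k \<in> C0inf W) \<longrightarrow> f \<in> C0inf W \<longrightarrow>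
          (\<forall>is. uniform_limit UNIV (\<lambda>k. pds is (fs k)) (pds is f) sequentially) \<longrightarrow>
          (\<forall>g\<in>C0inf U. (\<lambda>k. E (fs k) g) \<longlonglongrightarrow> E f g \<and> (\<lambda>k. E g (fs k)) \<longlonglongrightarrow> E g f)))"

definition case2 ::
  "(real^'n::finite) measure \<Rightarrow> (real^'n) set \<Rightarrow> ('n fn \<Rightarrow> 'n fn \<Rightarrow> real)
     \<Rightarrow> (real \<Rightarrow> 'n fn \<Rightarrow> 'n fn) \<Rightarrow> (real \<Rightarrow> 'n fn \<Rightarrow> 'n fn) \<Rightarrow> bool" where
  "case2 m U E G Gh \<longleftrightarrow>
     (\<exists>D. semi_dirichlet m D E \<and> C0inf U \<subseteq> D \<and> form_continuity U E \<and>
        resolvent_form m D E G \<and> coresolvent_form m D E Gh)"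

text \<open>(beta G_beta u, v) = int u(x) v(y) sigma_beta(dx dy); stated for nonnegative
  u, v in L^2, which determines sigma_beta and is equivalent to the statement for all u, v.\<close>
definition kernel_measures ::
  "(real^'n::finite) measure \<Rightarrow> (real^'n) set \<Rightarrow> (real \<Rightarrow> 'n fn \<Rightarrow> 'n fn)
     \<Rightarrow> (real \<Rightarrow> ((real^'n) \<times> (real^'n)) measure) \<Rightarrow> bool" where
  "kernel_measures m U G \<sigma> \<longleftrightarrow>
     (\<forall>\<beta>>0. radon_on (\<sigma> \<beta>) (U \<times> U) \<and>
        (\<forall>u v. L2 m u \<longrightarrow> L2 m v \<longrightarrow> (\<forall>x. u x \<ge> 0) \<longrightarrow> (\<forall>x. v x \<ge> 0) \<longrightarrow>
           (\<integral>\<^sup>+ z. ennreal (u (fst z) * v (snd z)) \<partial>(\<sigma> \<beta>)) = ennreal (\<beta> * ip m (G \<beta> u) v)))"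

definition jump_killing ::
  "(real^'n::finite) set \<Rightarrow> ('n fn \<Rightarrow> 'n fn \<Rightarrow> real)
     \<Rightarrow> ((real^'n) \<times> (real^'n)) measure \<Rightarrow> (real^'n) measure \<Rightarrow> bool" where
  "jump_killing U E J K \<longleftrightarrow>
     radon_on J (offdiag U) \<and> radon_on K U \<and>
     (\<forall>u v. u \<in> C0inf U \<longrightarrow> v \<in> C0inf U \<longrightarrow>
        (\<exists>W c. open W \<and> tsupp v \<subseteq> W \<and> (\<forall>x\<in>W. u x = c)) \<longrightarrow>
        E u v = set_lebesgue_integral J (offdiag U) (\<lambda>z. 2 * (u (snd z) - u (fst z)) * v (snd z))
                + (\<integral>x. u x * v x \<partial>K))"

definition Jhat :: "('a::topological_space \<times> 'a) measure \<Rightarrow> ('a \<times> 'a) measure" where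
  "Jhat J = distr J borel (\<lambda>z. (snd z, fst z))"

definition Lam :: "(nat \<Rightarrow> (real^'n::finite) set) \<Rightarrow> (nat \<Rightarrow> real) \<Rightarrow> nat \<Rightarrow> ((real^'n) \<times> (real^'n)) set" where
  "Lam \<Omega> \<rho> l = {(x, y). x \<in> \<Omega> l \<and> y \<in> \<Omega> l \<and> dist x y < \<rho> l}"

definition Gam :: "(nat \<Rightarrow> (real^'n::finite) set) \<Rightarrow> (nat \<Rightarrow> real) \<Rightarrow> nat \<Rightarrow> ((real^'n) \<times> (real^'n)) set" where
  "Gam \<Omega> \<rho> l = {(x, y). x \<in> \<Omega> l \<and> y \<in> \<Omega> l \<and> dist x y \<ge> \<rho> l}"

definition drift :: "'n::finite fn \<Rightarrow> real \<Rightarrow> (real^'n) \<times> (real^'n) \<Rightarrow> real" where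
  "drift u r z = (\<Sum>i\<in>UNIV. (snd z $ i - fst z $ i) * pd i u (snd z))
                 * indicator {w. dist (fst w) (snd w) \<le> r} z"

definition admissible ::
  "(real^'n::finite) set \<Rightarrow> ((real^'n) \<times> (real^'n)) measure \<Rightarrow> real
     \<Rightarrow> (nat \<Rightarrow> (real^'n) set) \<Rightarrow> (nat \<Rightarrow> real) \<Rightarrow> (nat \<Rightarrow> real) \<Rightarrow> bool" where
  "admissible U J \<delta> \<Omega> \<rho> \<delta>s \<longleftrightarrow>
     (\<forall>l. open (\<Omega> l) \<and> compact (closure (\<Omega> l)) \<and> closure (\<Omega> l) \<subseteq> U) \<and>
     incseq \<Omega> \<and> (\<Union>l. \<Omega> l) = U \<and>
     (\<forall>l. \<rho> l > 0) \<and> decseq \<rho> \<and> \<rho> \<longlonglongrightarrow> 0 \<and>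
     (\<forall>l. emeasure J (frontier (Gam \<Omega> \<rho> l)) = 0) \<and>
     (\<forall>k. \<delta>s k \<ge> \<delta>) \<and> \<delta>s \<longlonglongrightarrow> \<delta> \<and>
     (\<forall>k. emeasure J {z. dist (fst z) (snd z) = \<delta>s k} = 0)"

definition Ecd ::
  "(real \<Rightarrow> ((real^'n::finite) \<times> (real^'n)) measure) \<Rightarrow> (nat \<Rightarrow> (real^'n) set) \<Rightarrow> (nat \<Rightarrow> real)
     \<Rightarrow> (nat \<Rightarrow> real) \<Rightarrow> 'n fn \<Rightarrow> 'n fn \<Rightarrow> real" where
  "Ecd \<sigma> \<Omega> \<rho> \<delta>s u v =
     lim (\<lambda>k. lim (\<lambda>l. Lim at_top (\<lambda>\<beta>. \<beta> *
        (set_lebesgue_integral (\<sigma> \<beta>) (Lam \<Omega> \<rho> l) (\<lambda>z. (u (snd z) - u (fst z)) * v (snd z))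
       + set_lebesgue_integral (\<sigma> \<beta>) (Gam \<Omega> \<rho> l) (\<lambda>z. drift u (\<delta>s k) z * v (snd z))))))"

end

theory Submission
  imports Defs
begin

text \<open>
  In both cases \<open>\<beta> ((u, v) - \<integral> u(x) v(y) \<sigma>\<^sub>\<beta>(dxdy))\<close> tends to \<open>E(u, v)\<close>: for generators by the
  resolvent equation and the adjoint domain, for semi-Dirichlet forms by weak convergence of
  \<open>\<beta> G\<^sub>\<beta> u\<close>. For disjoint supports this identifies the vague limit of \<open>\<beta> \<sigma>\<^sub>\<beta>\<close> off the diagonal with
  \<open>2 J\<close>. Applied to \<open>u v\<close> and a cutoff \<open>\<psi>\<close> it gives
  \<open>E(u, v) - E(\<psi>, uv) = lim \<beta> \<integral> (u(y) - u(x)) \<psi>(x) v(y) \<sigma>\<^sub>\<beta>(dxdy)\<close>. Splitting this integral over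
  \<open>\<Lambda>\<^sub>l\<close> and \<open>\<Gamma>\<^sub>l\<close> and adding the drift term on \<open>\<Gamma>\<^sub>l\<close>, the part on \<open>\<Gamma>\<^sub>l\<close> converges to the compensated jump
  integral, which stays integrable up to the diagonal because \<open>|x - y|\<^sup>2\<close> is locally \<open>J\<close>-integrable.
  This is (ii) for \<open>E\<close>; the dual form is the same argument with the coordinates of \<open>J\<close> exchanged.
  For (i), \<open>E(\<psi>, uv)\<close> is expressed by \<open>J\<close> and \<open>K\<close>, and \<open>(1 - \<psi>(x)) (uv)(y)\<close> is \<open>J\<close>-integrable by the
  sub-Markov property.
\<close>

section \<open>Smooth functions and cutoff functions\<close>

text \<open>Neither a sub-Markov property nor a killing measure is given for the dual form, which is
  why only (ii) has a dual half. What both halves share is isolated in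
  \<open>approximated_form\<close>, whose hypotheses survive transposing the form and exchanging the
  coordinates of J. The difficulty in the triple limit is domination. The radii
  \<open>\<delta>s k\<close> approach \<delta> from above, so the drift terms reach beyond distance
  \<delta>. Compactness of the support of v inside \<open>Udelta U \<delta>\<close> leaves a margin
  \<delta>' > \<delta> up to which all points around the support still lie in U. One multiple of the
  squared distance times \<theta>(x) \<theta>(y), for a cutoff \<theta>, then dominates the
  compensated integrands of all radii between \<delta> and \<delta>'. That weight is J-integrable
  because the squared distance expands into products of coordinate functions, so that its scaled
  integrals against \<open>\<sigma> \<beta>\<close> converge to values of E and stay bounded;
  Fatou's lemma carries the bound over to J.\<close>

lemma pds_append: "pds (is @ js) f = pds is (pds js f)"
  by (induction "is") auto

text \<open>An invariant set of differentiable functions stable under every \<open>pd i\<close>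
  contains all iterated partial derivatives of its members. This replaces explicit formulas for
  higher derivatives.\<close>

lemma smooth_fun_coinduct:
  assumes "f \<in> S"
    and "\<And>g x. g \<in> S \<Longrightarrow> g differentiable (at x)"
    and "\<And>g i. g \<in> S \<Longrightarrow> pd i g \<in> S"
  shows "smooth_fun f"
proof -
  have "pds is f \<in> S" for "is"
    by (induction "is") (auto simp: assms)
  then show ?thesis
    unfolding smooth_fun_def using assms(2) by blast
qed

lemma smooth_fun_pd: "smooth_fun f \<Longrightarrow> smooth_fun (pd i f)"
  unfolding smooth_fun_def using pds_append[of _ "[i]" f] by (metis pds.simps)

lemma smooth_fun_differentiable: "smooth_fun f \<Longrightarrow> f differentiable (at x)"
  unfolding smooth_fun_def by (metis pds.simps(1))

lemma smooth_fun_continuous: "smooth_fun f \<Longrightarrow> continuous_on S f"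
  by (meson continuous_at_imp_continuous_on differentiable_imp_continuous_within smooth_fun_differentiable)

lemma pd_has_derivative: "(f has_derivative f') (at x) \<Longrightarrow> pd i f x = f' (axis i 1)"
  unfolding pd_def using frechet_derivative_at by metis

lemma has_derivative_pd:
  assumes "f differentiable (at x)"
  shows "(f has_derivative (\<lambda>h. \<Sum>i\<in>UNIV. h $ i * pd i f x)) (at x)"
proof -
  let ?D = "frechet_derivative f (at x)"
  have D: "(f has_derivative ?D) (at x)"
    using assms frechet_derivative_works by blast
  interpret D: bounded_linear ?D
    using D has_derivative_bounded_linear by blast
  have "?D h = (\<Sum>i\<in>UNIV. h $ i * pd i f x)" for h
  proof -
    have "?D h = ?D (\<Sum>i\<in>UNIV. h $ i *\<^sub>R axis i 1)"
      using basis_expansion[of h] by (simp add: scalar_mult_eq_scaleR)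
    also have "\<dots> = (\<Sum>i\<in>UNIV. h $ i * ?D (axis i 1))"
      by (simp add: D.sum D.scale)
    finally show ?thesis by (simp add: pd_def)
  qed
  then show ?thesis using D by presburger
qed

lemma smooth_fun_const: "smooth_fun (\<lambda>x :: real^'n::finite. c)"
proof (rule smooth_fun_coinduct[where S="range (\<lambda>c x. c)"])
  fix g :: "'n fn" and i :: 'n
  assume "g \<in> range (\<lambda>c x. c)"
  then have "pd i g = (\<lambda>x. 0)"
    by (auto simp: fun_eq_iff intro!: pd_has_derivative[THEN trans] has_derivative_const)
  then show "pd i g \<in> range (\<lambda>c x. c)" by auto
qed auto

text \<open>The partial derivatives of a linear function are constants, so adjoining the function to
  the set of smooth functions gives a set stable under \<open>pd\<close>.\<close>

lemma smooth_fun_linear: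
  fixes f :: "'n::finite fn"
  assumes "bounded_linear f"
  shows "smooth_fun f"
proof (rule smooth_fun_coinduct[where S="insert f {g. smooth_fun g}"])
  fix g :: "'n fn" and i :: 'n
  assume g: "g \<in> insert f {g. smooth_fun g}"
  have "pd i f = (\<lambda>x. f (axis i 1))"
    using bounded_linear_imp_has_derivative[OF assms] by (auto simp: fun_eq_iff pd_has_derivative)
  then show "pd i g \<in> insert f {g. smooth_fun g}"
    using g smooth_fun_pd by (auto simp: smooth_fun_const)
qed (use assms bounded_linear_imp_differentiable smooth_fun_differentiable in auto)

text \<open>The factor \<open>t ^ k\<close> makes the family stable under differentiation: the
  derivative of a member is a combination of the members with indices k + 1 and k + 2. For k = 0
  this is the usual profile of a bump function.\<close>

definition flat_exp :: "nat \<Rightarrow> real \<Rightarrow> real" where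
  "flat_exp k t = (if t \<le> 0 then 0 else exp (- (1 / t)) / t ^ k)"

text \<open>In the variable s = 1/t the right-hand limit is that of \<open>s ^ k / exp s\<close> at
  infinity; on the left the function is 0.\<close>

lemma flat_exp_tendsto_0: "((flat_exp k) \<longlongrightarrow> 0) (at 0)"
proof -
  have "((\<lambda>s::real. s ^ k / exp s) \<longlongrightarrow> 0) at_top"
    by (rule tendsto_power_div_exp_0)
  then have "((\<lambda>t::real. (inverse t) ^ k / exp (inverse t)) \<longlongrightarrow> 0) (at_right 0)"
    by (rule filterlim_compose) (rule filterlim_inverse_at_top_right)
  then have "(flat_exp k \<longlongrightarrow> 0) (at_right 0)"
    by (rule Lim_transform_eventually)
      (auto intro!: eventually_at_rightI[of 0 1] simp: flat_exp_def exp_minus field_simps)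
  moreover have "(flat_exp k \<longlongrightarrow> 0) (at_left 0)"
    by (rule Lim_transform_eventually[OF tendsto_const])
      (auto intro!: eventually_at_leftI[of "-1"] simp: flat_exp_def)
  ultimately show ?thesis
    by (simp add: filterlim_split_at)
qed

text \<open>Away from 0 this is ordinary calculus. At 0 the difference quotient of
  \<open>flat_exp k\<close> is \<open>flat_exp (k + 1)\<close>, which tends to 0, and the claimed
  value is 0 as well.\<close>

lemma flat_exp_has_real_derivative:
  "(flat_exp k has_real_derivative (flat_exp (k + 2) t - real k * flat_exp (k + 1) t)) (at t)"
proof (cases t "0::real" rule: linorder_cases)
  case less
  have "((\<lambda>_. 0) has_real_derivative 0) (at t)" by simp
  then show ?thesis
    by (rule DERIV_cong[OF has_field_derivative_transform_within_open[where S="{..<0}"]])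
      (use less in \<open>auto simp: flat_exp_def\<close>)
next
  case equal
  have "((\<lambda>h. (flat_exp k (0 + h) - flat_exp k 0) / h) \<longlongrightarrow> 0) (at 0)"
  proof (rule Lim_transform_eventually[OF flat_exp_tendsto_0[of "k + 1"]])
    show "\<forall>\<^sub>F h in at 0. flat_exp (k + 1) h = (flat_exp k (0 + h) - flat_exp k 0) / h"
      by (auto simp: flat_exp_def eventually_at_filter)
  qed
  then show ?thesis
    using equal by (simp add: DERIV_def flat_exp_def)
next
  case greater
  have "((\<lambda>t. exp (- (1 / t)) / t ^ k) has_real_derivative
      (flat_exp (k + 2) t - real k * flat_exp (k + 1) t)) (at t)"
  proof (cases "k = 0")
    case True
    then show ?thesis
      using greater
      by (auto intro!: derivative_eq_intros simp: flat_exp_def field_simps power2_eq_square)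
  next
    case False
    then have P: "t ^ k = t * t ^ (k - Suc 0)"
      by (simp add: power_eq_if)
    show ?thesis
      using greater
      by (auto intro!: derivative_eq_intros simp: flat_exp_def field_simps power2_eq_square P)
  qed
  then show ?thesis
    by (rule has_field_derivative_transform_within_open[where S="{0<..}"])
      (use greater in \<open>auto simp: flat_exp_def\<close>)
qed


text \<open>The closure of the smooth functions under all operations needed for cutoff functions is
  stable under partial derivatives, hence consists of smooth functions.\<close>

inductive smooth_closure :: "'n::finite fn \<Rightarrow> bool" where
  base: "smooth_fun f \<Longrightarrow> smooth_closure f"
| add: "smooth_closure f \<Longrightarrow> smooth_closure g \<Longrightarrow> smooth_closure (\<lambda>x. f x + g x)"
| mult: "smooth_closure f \<Longrightarrow> smooth_closure g \<Longrightarrow> smooth_closure (\<lambda>x. f x * g x)"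
| flat: "smooth_fun f \<Longrightarrow> smooth_closure (\<lambda>x. flat_exp k (f x))"
| inv: "smooth_fun f \<Longrightarrow> (\<And>x. f x \<noteq> 0) \<Longrightarrow> smooth_closure (\<lambda>x. inverse (f x))"

text \<open>Sum, product and chain rule write each partial derivative as an expression of the same
  kind. Since \<open>flat\<close> and \<open>inv\<close> take a smooth inner function, the inner
  derivative from the chain rule is a \<open>base\<close> member.\<close>

lemma smooth_closure_pd:
  assumes "smooth_closure f"
  shows "(\<forall>x. f differentiable (at x)) \<and> (\<forall>i. smooth_closure (pd i f))"
  using assms
proof induction
  case (base f)
  then show ?case
    using smooth_closure.base smooth_fun_differentiable smooth_fun_pd by blast
next
  case (add f g)
  have "((\<lambda>x. f x + g x) has_derivative
      (\<lambda>h. frechet_derivative f (at x) h + frechet_derivative g (at x) h)) (at x)" for x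
    using add.IH by (intro has_derivative_add) (auto simp: frechet_derivative_works[symmetric])
  note D = this
  have *: "pd i (\<lambda>x. f x + g x) = (\<lambda>x. pd i f x + pd i g x)" for i
    using pd_has_derivative[OF D] by (auto simp: pd_def)
  have "smooth_closure (pd i (\<lambda>x. f x + g x))" for i
    unfolding * using add.IH by (intro smooth_closure.add) auto
  then show ?case
    using D differentiableI by blast
next
  case (mult f g)
  have "((\<lambda>x. f x * g x) has_derivative
      (\<lambda>h. f x * frechet_derivative g (at x) h + frechet_derivative f (at x) h * g x)) (at x)" for x
    using mult.IH by (intro has_derivative_mult) (auto simp: frechet_derivative_works[symmetric])
  note D = this
  have *: "pd i (\<lambda>x. f x * g x) = (\<lambda>x. f x * pd i g x + pd i f x * g x)" for i
    using pd_has_derivative[OF D] by (auto simp: pd_def)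
  have "smooth_closure (pd i (\<lambda>x. f x * g x))" for i
    unfolding * using mult by (intro smooth_closure.add smooth_closure.mult) auto
  then show ?case
    using D differentiableI by blast
next
  case (flat f k)
  have "((\<lambda>x. flat_exp k (f x)) has_derivative
      (\<lambda>h. frechet_derivative f (at x) h * (flat_exp (k + 2) (f x) - real k * flat_exp (k + 1) (f x)))) (at x)" for x
    using smooth_fun_differentiable[OF flat]
    by (intro DERIV_compose_FDERIV[OF flat_exp_has_real_derivative])
      (auto simp: frechet_derivative_works[symmetric])
  note D = this
  have *: "pd i (\<lambda>x. flat_exp k (f x)) =
      (\<lambda>x. pd i f x * (flat_exp (k + 2) (f x) + (- real k) * flat_exp (k + 1) (f x)))" for i
    using pd_has_derivative[OF D] by (auto simp: pd_def)
  have "smooth_closure (pd i (\<lambda>x. flat_exp k (f x)))" for i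
    unfolding * by (intro smooth_closure.intros flat smooth_fun_pd smooth_fun_const)
  then show ?case
    using D differentiableI by blast
next
  case (inv f)
  have "((\<lambda>x. inverse (f x)) has_derivative
      (\<lambda>h. - (inverse (f x) * frechet_derivative f (at x) h * inverse (f x)))) (at x)" for x
    using smooth_fun_differentiable[OF inv(1)] inv(2)
    by (intro Deriv.has_derivative_inverse) (auto simp: frechet_derivative_works[symmetric])
  note D = this
  have *: "pd i (\<lambda>x. inverse (f x)) =
      (\<lambda>x. (- 1) * (inverse (f x) * pd i f x * inverse (f x)))" for i
    using pd_has_derivative[OF D] by (auto simp: pd_def)
  have "smooth_closure (pd i (\<lambda>x. inverse (f x)))" for i
    unfolding * by (intro smooth_closure.intros inv smooth_fun_pd smooth_fun_const)
  then show ?case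
    using D differentiableI by blast
qed

lemma smooth_closure_smooth: "smooth_closure f \<Longrightarrow> smooth_fun f"
  by (rule smooth_fun_coinduct[where S="{f. smooth_closure f}"]) (auto simp: smooth_closure_pd)

lemma smooth_fun_add: "smooth_fun f \<Longrightarrow> smooth_fun g \<Longrightarrow> smooth_fun (\<lambda>x. f x + g x)"
  by (rule smooth_closure_smooth) (rule smooth_closure.add; simp add: smooth_closure.base)

lemma smooth_fun_mult: "smooth_fun f \<Longrightarrow> smooth_fun g \<Longrightarrow> smooth_fun (\<lambda>x. f x * g x)"
  by (rule smooth_closure_smooth) (rule smooth_closure.mult; simp add: smooth_closure.base)

lemma smooth_fun_flat_exp: "smooth_fun f \<Longrightarrow> smooth_fun (\<lambda>x. flat_exp k (f x))"
  by (rule smooth_closure_smooth) (rule smooth_closure.flat)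

lemma smooth_fun_inverse: "smooth_fun f \<Longrightarrow> (\<And>x. f x \<noteq> 0) \<Longrightarrow> smooth_fun (\<lambda>x. inverse (f x))"
  by (rule smooth_closure_smooth) (rule smooth_closure.inv)

lemma smooth_fun_diff: "smooth_fun f \<Longrightarrow> smooth_fun g \<Longrightarrow> smooth_fun (\<lambda>x. f x - g x)"
  using smooth_fun_add[of f "\<lambda>x. (-1) * g x"] smooth_fun_mult[OF smooth_fun_const[of "-1"], of g] by simp

lemma smooth_fun_sum:
  "(\<And>i. i \<in> I \<Longrightarrow> smooth_fun (f i)) \<Longrightarrow> smooth_fun (\<lambda>x. \<Sum>i\<in>I. f i x)"
  by (induction I rule: infinite_finite_induct) (auto intro: smooth_fun_add smooth_fun_const)

lemma smooth_fun_component: "smooth_fun (\<lambda>x. x $ i)"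
  by (intro smooth_fun_linear bounded_linear_vec_nth)

lemma smooth_fun_norm_squared: "smooth_fun (\<lambda>x. (norm (x - a))\<^sup>2)"
proof -
  have "smooth_fun (\<lambda>x. \<Sum>i\<in>UNIV. (x $ i - a $ i) * (x $ i - a $ i))"
    by (intro smooth_fun_sum smooth_fun_mult smooth_fun_diff smooth_fun_component smooth_fun_const)
  then show ?thesis
    by (simp add: power2_norm_eq_inner inner_vec_def)
qed

section \<open>Smooth functions with compact support\<close>

lemma zero_outside_tsupp: "x \<notin> tsupp f \<Longrightarrow> f x = 0"
  using closure_subset[of "{x. f x \<noteq> 0}"] by (auto simp: tsupp_def)

lemma tsupp_minimal: "closed S \<Longrightarrow> (\<And>x. x \<notin> S \<Longrightarrow> f x = 0) \<Longrightarrow> tsupp f \<subseteq> S"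
  unfolding tsupp_def by (rule closure_minimal) auto

lemma closed_tsupp: "closed (tsupp f)"
  by (simp add: tsupp_def)

lemma C0infI:
  assumes "smooth_fun f" "compact S" "S \<subseteq> U" "\<And>x. x \<notin> S \<Longrightarrow> f x = 0"
  shows "f \<in> C0inf U"
proof -
  have "tsupp f \<subseteq> S"
    using assms by (intro tsupp_minimal compact_imp_closed)
  moreover from this have "compact (tsupp f)"
    using compact_Int_closed[OF assms(2) closed_tsupp, of f] by (simp add: Int_absorb1)
  ultimately show ?thesis
    using assms by (auto simp: C0inf_def)
qed

lemma C0infD:
  assumes "f \<in> C0inf U"
  shows "smooth_fun f" "compact (tsupp f)" "tsupp f \<subseteq> U" "continuous_on S f" "x \<notin> U \<Longrightarrow> f x = 0"
  using assms zero_outside_tsupp[of x f] by (auto simp: C0inf_def smooth_fun_continuous)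

lemma C0inf_mono: "U \<subseteq> V \<Longrightarrow> C0inf U \<subseteq> C0inf V"
  by (auto simp: C0inf_def)

lemma C0inf_add: "f \<in> C0inf U \<Longrightarrow> g \<in> C0inf U \<Longrightarrow> (\<lambda>x. f x + g x) \<in> C0inf U"
  by (rule C0infI[where S="tsupp f \<union> tsupp g"])
    (auto simp: C0infD smooth_fun_add zero_outside_tsupp dest: C0infD(3))

lemma C0inf_mult_right: "f \<in> C0inf U \<Longrightarrow> smooth_fun g \<Longrightarrow> (\<lambda>x. f x * g x) \<in> C0inf U"
  by (rule C0infI[where S="tsupp f"])
    (auto simp: C0infD smooth_fun_mult zero_outside_tsupp dest: C0infD(3))

lemma C0inf_mult_left: "smooth_fun g \<Longrightarrow> f \<in> C0inf U \<Longrightarrow> (\<lambda>x. g x * f x) \<in> C0inf U"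
  using C0inf_mult_right[of f U g] by (simp add: mult.commute)

lemma C0inf_diff: "f \<in> C0inf U \<Longrightarrow> g \<in> C0inf U \<Longrightarrow> (\<lambda>x. f x - g x) \<in> C0inf U"
  using C0inf_add[of f U "\<lambda>x. (-1) * g x"] C0inf_mult_left[OF smooth_fun_const[of "-1"], of g U] by simp

lemma C0inf_zero: "(\<lambda>x. 0) \<in> C0inf U"
  by (rule C0infI[where S="{}"]) (auto simp: smooth_fun_const)

lemma C0inf_pd:
  assumes "f \<in> C0inf U"
  shows "pd i f \<in> C0inf U"
proof (rule C0infI[where S="tsupp f"])
  fix x assume x: "x \<notin> tsupp f"
  have "((\<lambda>x. 0) has_derivative (\<lambda>h. 0)) (at x)" by simp
  then have "(f has_derivative (\<lambda>h. 0)) (at x)"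
    by (rule has_derivative_transform_within_open[where s="- tsupp f"])
      (use x closed_tsupp in \<open>auto simp: zero_outside_tsupp open_Compl\<close>)
  then show "pd i f x = 0"
    by (simp add: pd_has_derivative)
qed (use assms in \<open>auto simp: C0infD smooth_fun_pd dest: C0infD(3)\<close>)

lemma C0inf_bounded:
  assumes "f \<in> C0inf U"
  obtains B where "B > 0" "\<And>x. \<bar>f x\<bar> \<le> B"
proof -
  have "compact (f ` tsupp f)"
    using assms by (intro compact_continuous_image) (auto simp: C0infD)
  then obtain B where B: "B > 0" "\<And>x. x \<in> tsupp f \<Longrightarrow> \<bar>f x\<bar> \<le> B"
    using compact_imp_bounded[of "f ` tsupp f"] by (auto simp: bounded_pos)
  have "\<bar>f x\<bar> \<le> B" for x
    using B zero_outside_tsupp[of x f] by (cases "x \<in> tsupp f") auto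
  then show ?thesis
    using that B(1) by blast
qed

text \<open>A finite sum s of bumps on balls inside W is positive on S and vanishes off these balls.
  With c below the minimum of s on S, the quotient of \<open>flat_exp 0 (s x)\<close> by
  \<open>flat_exp 0 (s x) + flat_exp 0 (c - s x)\<close> is 0 where s vanishes and 1 where s > c.
  The denominator never vanishes because s and c - s cannot both be nonpositive.\<close>

lemma cutoff_exists:
  fixes S W :: "(real^'n::finite) set"
  assumes "compact S" "open W" "S \<subseteq> W"
  obtains \<kappa> V where "\<kappa> \<in> C0inf W" "\<And>x. 0 \<le> \<kappa> x" "\<And>x. \<kappa> x \<le> 1"
    "open V" "S \<subseteq> V" "\<And>x. x \<in> V \<Longrightarrow> \<kappa> x = 1"
proof -
  have "\<exists>r>0. cball a r \<subseteq> W" if "a \<in> S" for a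
    using assms that open_contains_cball by blast
  then obtain r where r: "\<And>a. a \<in> S \<Longrightarrow> r a > 0" "\<And>a. a \<in> S \<Longrightarrow> cball a (r a) \<subseteq> W"
    by metis
  obtain F where F: "F \<subseteq> S" "finite F" "S \<subseteq> (\<Union>a\<in>F. ball a (r a))"
  proof (rule compactE_image[OF assms(1), of S "\<lambda>a. ball a (r a)"])
    show "S \<subseteq> (\<Union>a\<in>S. ball a (r a))"
      using r by force
  qed (use that in auto)
  define s where "s x = (\<Sum>a\<in>F. flat_exp 0 ((r a)\<^sup>2 - (norm (x - a))\<^sup>2))" for x :: "real^'n"
  have smooth_s: "smooth_fun s"
    unfolding s_def by (intro smooth_fun_sum smooth_fun_flat_exp smooth_fun_diff smooth_fun_const
      smooth_fun_norm_squared)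
  have flat_nonneg: "flat_exp k t \<ge> 0" for k t
    by (simp add: flat_exp_def)
  have flat_pos: "flat_exp k t > 0" if "t > 0" for k t
    using that by (simp add: flat_exp_def)
  have s_pos: "s x > 0" if "x \<in> S" for x
  proof -
    obtain a where "a \<in> F" "x \<in> ball a (r a)" using F \<open>x \<in> S\<close> by blast
    then show ?thesis
      unfolding s_def using F r
      by (intro sum_pos2[of F a] flat_nonneg flat_pos)
        (auto simp: dist_norm norm_minus_commute power_strict_mono)
  qed
  have s_supp: "s x = 0" if "x \<notin> (\<Union>a\<in>F. cball a (r a))" for x
  proof -
    have "(r a)\<^sup>2 - (norm (x - a))\<^sup>2 \<le> 0" if "a \<in> F" for a
    proof -
      have "r a > 0" "r a \<le> norm (x - a)"
        using that \<open>x \<notin> _\<close> F r by (force simp: dist_norm norm_minus_commute)+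
      then show ?thesis
        by (simp add: power_mono)
    qed
    then show ?thesis
      by (auto simp: s_def flat_exp_def intro!: sum.neutral)
  qed
  \<comment> \<open>Half the minimum of s on S gives a strict inequality there, so that the set
    where s exceeds c is an open neighbourhood of S. For empty S any positive c serves.\<close>
  obtain c where c: "c > 0" "\<And>x. x \<in> S \<Longrightarrow> c < s x"
  proof (cases "S = {}")
    case False
    obtain x0 where "x0 \<in> S" "\<And>x. x \<in> S \<Longrightarrow> s x0 \<le> s x"
      using continuous_attains_inf[OF assms(1) False smooth_fun_continuous[OF smooth_s]] by blast
    then show ?thesis
      using that[of "s x0 / 2"] s_pos by fastforce
  qed (use that[of 1] in auto)
  define p where "p x = flat_exp 0 (s x)" for x
  define q where "q x = flat_exp 0 (c - s x)" for x
  have pq: "p x + q x > 0" for x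
    using flat_pos[of "s x" 0] flat_pos[of "c - s x" 0] flat_nonneg[of 0 "s x"]
      flat_nonneg[of 0 "c - s x"] c(1) unfolding p_def q_def
    by (cases "s x > 0") (auto intro: add_pos_nonneg add_nonneg_pos)
  define \<kappa> where "\<kappa> x = p x * inverse (p x + q x)" for x
  show thesis
  proof (rule that[of \<kappa> "{x. c < s x}"])
    show "\<kappa> \<in> C0inf W"
    proof (rule C0infI[where S="\<Union>a\<in>F. cball a (r a)"])
      show "smooth_fun \<kappa>"
        unfolding \<kappa>_def p_def q_def
        using pq unfolding p_def q_def
        by (intro smooth_fun_mult smooth_fun_inverse smooth_fun_add smooth_fun_flat_exp
            smooth_fun_diff smooth_fun_const smooth_s) (metis less_irrefl)
      show "compact (\<Union>a\<in>F. cball a (r a))"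
        using F by (intro compact_UN) auto
      show "(\<Union>a\<in>F. cball a (r a)) \<subseteq> W"
        using F r by blast
      show "\<kappa> x = 0" if "x \<notin> (\<Union>a\<in>F. cball a (r a))" for x
        using s_supp[OF that] by (simp add: \<kappa>_def p_def flat_exp_def)
    qed
    have "p x \<ge> 0" "q x \<ge> 0" for x
      by (auto simp: p_def q_def flat_nonneg)
    then show "0 \<le> \<kappa> x" "\<kappa> x \<le> 1" for x
      using pq[of x] by (auto simp: \<kappa>_def field_simps)
    show "open {x. c < s x}"
      by (intro open_Collect_less continuous_on_const smooth_fun_continuous smooth_s)
    show "\<kappa> x = 1" if "x \<in> {x. c < s x}" for x
      using that pq[of x] by (simp add: \<kappa>_def q_def flat_exp_def)
  qed (use c in auto)
qed

section \<open>Mean value and Taylor estimates\<close>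

lemma C0inf_mvt:
  fixes f :: "'n::finite fn"
  assumes "f \<in> C0inf U"
  obtains \<xi> where "\<xi> \<in> closed_segment x y" "f y - f x = (\<Sum>i\<in>UNIV. (y - x) $ i * pd i f \<xi>)"
proof (cases "x = y")
  case False
  have "\<exists>t\<in>{0<..<1}. f (x + 1 *\<^sub>R (y - x)) - f (x + 0 *\<^sub>R (y - x))
      = (1 - 0) *\<^sub>R (\<Sum>i\<in>UNIV. (y - x) $ i * pd i f (x + t *\<^sub>R (y - x)))"
  proof -
    let ?g = "\<lambda>t. x + t *\<^sub>R (y - x)"
    have "((\<lambda>t. f (?g t)) has_derivative
        (\<lambda>s. \<Sum>i\<in>UNIV. (s *\<^sub>R (y - x)) $ i * pd i f (?g t))) (at t)" for t
    proof -
      have a: "(?g has_derivative (\<lambda>s. s *\<^sub>R (y - x))) (at t)"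
        by (auto intro!: derivative_eq_intros)
      have b: "(f has_derivative (\<lambda>h. \<Sum>i\<in>UNIV. h $ i * pd i f (?g t))) (at (?g t))"
        by (intro has_derivative_pd smooth_fun_differentiable C0infD(1)[OF assms])
      show ?thesis
        by (rule has_derivative_compose[OF a b])
    qed
    then have "DERIV (\<lambda>t. f (?g t)) t :> (\<Sum>i\<in>UNIV. (y - x) $ i * pd i f (?g t))" for t
      by (rule has_derivative_imp_has_field_derivative) (simp add: sum_distrib_left mult_ac)
    from MVT2[of 0 1 "\<lambda>t. f (?g t)", OF _ this]
    obtain z where "0 < z" "z < 1" "f (?g 1) - f (?g 0) = (1 - 0) * (\<Sum>i\<in>UNIV. (y - x) $ i * pd i f (?g z))"
      by auto
    then show ?thesis
      by (intro bexI[of _ z]) auto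
  qed
  then obtain t where t: "t \<in> {0<..<1}" "f y - f x = (\<Sum>i\<in>UNIV. (y - x) $ i * pd i f (x + t *\<^sub>R (y - x)))"
    by auto
  show ?thesis
  proof (rule that)
    show "x + t *\<^sub>R (y - x) \<in> closed_segment x y"
      using t(1) by (auto simp: in_segment algebra_simps intro!: exI[of _ t])
  qed (rule t(2))
qed (use that[of x] in auto)

lemma C0inf_lipschitz:
  fixes f :: "'n::finite fn"
  assumes "f \<in> C0inf U"
  obtains L where "L \<ge> 0" "\<And>x y. \<bar>f y - f x\<bar> \<le> L * dist x y"
proof -
  have "\<exists>B. \<forall>x. \<bar>pd i f x\<bar> \<le> B" for i
    using C0inf_bounded[OF C0inf_pd[OF assms]] by metis
  then obtain B where B: "\<And>i x. \<bar>pd i f x\<bar> \<le> B i"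
    by metis
  have Bnn: "B i \<ge> 0" for i
    using B[of i 0] by linarith
  show ?thesis
  proof (rule that)
    show "(\<Sum>i\<in>UNIV. B i) \<ge> 0"
      by (simp add: Bnn sum_nonneg)
    show "\<bar>f y - f x\<bar> \<le> (\<Sum>i\<in>UNIV. B i) * dist x y" for x y
    proof -
      obtain \<xi> where "f y - f x = (\<Sum>i\<in>UNIV. (y - x) $ i * pd i f \<xi>)"
        using C0inf_mvt[OF assms] by metis
      also have "\<bar>\<dots>\<bar> \<le> (\<Sum>i\<in>UNIV. dist x y * B i)"
        using B Bnn component_le_norm_cart[of "y - x"]
        by (intro order_trans[OF sum_abs] sum_mono)
          (auto simp: abs_mult dist_norm norm_minus_commute intro!: mult_mono)
      finally show ?thesis
        by (simp add: sum_distrib_right mult.commute)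
    qed
  qed
qed

text \<open>The mean value theorem expresses the increment by the gradient at a point of the
  segment, and the gradient is Lipschitz; second derivatives enter only through that constant. The
  expansion is at y, where the drift term takes its gradient.\<close>

lemma C0inf_taylor:
  fixes f :: "'n::finite fn"
  assumes "f \<in> C0inf U"
  obtains C where "C \<ge> 0"
    "\<And>x y. \<bar>f y - f x - (\<Sum>i\<in>UNIV. (y $ i - x $ i) * pd i f y)\<bar> \<le> C * (dist x y)\<^sup>2"
proof -
  have "\<exists>L\<ge>0. \<forall>x y. \<bar>pd i f y - pd i f x\<bar> \<le> L * dist x y" for i
    using C0inf_lipschitz[OF C0inf_pd[OF assms]] by metis
  then obtain L where L: "\<And>i. L i \<ge> 0" "\<And>i x y. \<bar>pd i f y - pd i f x\<bar> \<le> L i * dist x y"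
    by metis
  show ?thesis
  proof (rule that)
    show "(\<Sum>i\<in>UNIV. L i) \<ge> 0"
      by (simp add: L sum_nonneg)
    show "\<bar>f y - f x - (\<Sum>i\<in>UNIV. (y $ i - x $ i) * pd i f y)\<bar> \<le> (\<Sum>i\<in>UNIV. L i) * (dist x y)\<^sup>2" for x y
    proof -
      obtain \<xi> where \<xi>: "\<xi> \<in> closed_segment x y" "f y - f x = (\<Sum>i\<in>UNIV. (y - x) $ i * pd i f \<xi>)"
        using C0inf_mvt[OF assms] by metis
      have d: "dist y \<xi> \<le> dist x y"
        using segment_bound(2)[OF \<xi>(1)] by (simp add: dist_norm norm_minus_commute)
      have "f y - f x - (\<Sum>i\<in>UNIV. (y $ i - x $ i) * pd i f y) =
          (\<Sum>i\<in>UNIV. (y - x) $ i * (pd i f \<xi> - pd i f y))"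
        unfolding \<xi>(2) by (simp add: sum_subtractf[symmetric] algebra_simps)
      also have "\<bar>\<dots>\<bar> \<le> (\<Sum>i\<in>UNIV. dist x y * (L i * dist x y))"
      proof (intro order_trans[OF sum_abs] sum_mono)
        fix i
        have "\<bar>pd i f \<xi> - pd i f y\<bar> \<le> L i * dist x y"
          by (rule order_trans[OF L(2)]) (intro mult_left_mono d L)
        then show "\<bar>(y - x) $ i * (pd i f \<xi> - pd i f y)\<bar> \<le> dist x y * (L i * dist x y)"
          using component_le_norm_cart[of "y - x" i]
          by (auto simp: abs_mult dist_norm norm_minus_commute intro!: mult_mono)
      qed
      finally show ?thesis
        by (simp add: sum_distrib_right power2_eq_square mult_ac)
    qed
  qed
qed

section \<open>Square integrable functions\<close>

lemma L2_integrable_mult: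
  assumes "L2 m f" "L2 m g"
  shows "integrable m (\<lambda>x. f x * g x)"
proof (rule Bochner_Integration.integrable_bound)
  show "integrable m (\<lambda>x. (f x)\<^sup>2 + (g x)\<^sup>2)"
    using assms by (auto simp: L2_def)
  show "(\<lambda>x. f x * g x) \<in> borel_measurable m"
    using assms by (auto simp: L2_def)
  have "\<bar>a * b\<bar> \<le> a\<^sup>2 + b\<^sup>2" for a b :: real
  proof -
    have "0 \<le> (\<bar>a\<bar> - \<bar>b\<bar>)\<^sup>2" "0 \<le> a\<^sup>2" "0 \<le> b\<^sup>2" by auto
    moreover have "0 \<le> \<bar>a\<bar> * \<bar>b\<bar>"
      by simp
    ultimately show ?thesis
      unfolding abs_mult power2_diff by (simp only: power2_abs)
  qed
  then show "AE x in m. norm (f x * g x) \<le> norm ((f x)\<^sup>2 + (g x)\<^sup>2)"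
    by auto
qed

lemma L2_lincomb:
  assumes "L2 m f" "L2 m g"
  shows "L2 m (\<lambda>x. a * f x + b * g x)"
proof -
  have "integrable m (\<lambda>x. a\<^sup>2 * (f x)\<^sup>2 + b\<^sup>2 * (g x)\<^sup>2 + 2 * a * b * (f x * g x))"
    using assms L2_integrable_mult[OF assms] by (auto simp: L2_def)
  moreover have "(a * f x + b * g x)\<^sup>2 = a\<^sup>2 * (f x)\<^sup>2 + b\<^sup>2 * (g x)\<^sup>2 + 2 * a * b * (f x * g x)" for x
    by (simp add: power2_eq_square algebra_simps)
  ultimately have "integrable m (\<lambda>x. (a * f x + b * g x)\<^sup>2)"
    by simp
  then show ?thesis
    using assms by (auto simp: L2_def)
qed

lemma L2_add: "L2 m f \<Longrightarrow> L2 m g \<Longrightarrow> L2 m (\<lambda>x. f x + g x)"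
  using L2_lincomb[of m f g 1 1] by simp

lemma L2_diff: "L2 m f \<Longrightarrow> L2 m g \<Longrightarrow> L2 m (\<lambda>x. f x - g x)"
  using L2_lincomb[of m f g 1 "-1"] by simp

lemma L2_scale: "L2 m f \<Longrightarrow> L2 m (\<lambda>x. a * f x)"
  using L2_lincomb[of m f f a 0] by simp

lemma ip_commute: "ip m f g = ip m g f"
  by (simp add: ip_def mult.commute)

lemma ip_lincomb_left:
  assumes "L2 m f" "L2 m g" "L2 m h"
  shows "ip m (\<lambda>x. a * f x + b * g x) h = a * ip m f h + b * ip m g h"
proof -
  have "ip m (\<lambda>x. a * f x + b * g x) h = (\<integral>x. a * (f x * h x) + b * (g x * h x) \<partial>m)"
    unfolding ip_def by (simp add: algebra_simps)
  then show ?thesis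
    using assms by (simp add: L2_integrable_mult ip_def)
qed

lemma ip_add_left:
  "L2 m f \<Longrightarrow> L2 m g \<Longrightarrow> L2 m h \<Longrightarrow> ip m (\<lambda>x. f x + g x) h = ip m f h + ip m g h"
  using ip_lincomb_left[of m f g h 1 1] by simp

lemma ip_diff_left:
  "L2 m f \<Longrightarrow> L2 m g \<Longrightarrow> L2 m h \<Longrightarrow> ip m (\<lambda>x. f x - g x) h = ip m f h - ip m g h"
  using ip_lincomb_left[of m f g h 1 "-1"] by simp

lemma ip_scale_left: "ip m (\<lambda>x. a * f x) h = a * ip m f h"
  by (simp add: ip_def mult.assoc)

lemma ip_add_right:
  "L2 m f \<Longrightarrow> L2 m g \<Longrightarrow> L2 m h \<Longrightarrow> ip m h (\<lambda>x. f x + g x) = ip m h f + ip m h g"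
  using ip_add_left[of m f g h] by (simp add: ip_commute[of m h])

lemma ip_diff_right:
  "L2 m f \<Longrightarrow> L2 m g \<Longrightarrow> L2 m h \<Longrightarrow> ip m h (\<lambda>x. f x - g x) = ip m h f - ip m h g"
  using ip_diff_left[of m f g h] by (simp add: ip_commute[of m h])

lemma ip_scale_right: "ip m h (\<lambda>x. a * f x) = a * ip m h f"
  using ip_scale_left[of m a f h] by (simp add: ip_commute[of m h])

lemmas ip_linear = ip_add_left ip_diff_left ip_scale_left ip_add_right ip_diff_right ip_scale_right

lemma ip_self_nonneg: "0 \<le> ip m f f"
  unfolding ip_def by (rule Bochner_Integration.integral_nonneg) simp

lemma nrm_nonneg: "0 \<le> nrm m f"
  by (simp add: nrm_def ip_self_nonneg)

lemma nrm_squared: "(nrm m f)\<^sup>2 = ip m f f"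
  by (simp add: nrm_def ip_self_nonneg)

lemma ip_cong_AE:
  assumes "L2 m f" "L2 m f'" "L2 m g" "aeeq m f f'"
  shows "ip m f g = ip m f' g"
  unfolding ip_def using assms by (intro integral_cong_AE) (auto simp: L2_def aeeq_def)

lemma nrm_cong_AE:
  assumes "L2 m f" "L2 m f'" "aeeq m f f'"
  shows "nrm m f = nrm m f'"
  unfolding nrm_def using ip_cong_AE[of m f f' f] ip_cong_AE[of m f f' f'] assms
  by (simp add: ip_commute)

lemma quadratic_nonneg_discriminant:
  fixes a b c :: real
  assumes "\<And>t. 0 \<le> a - 2 * t * b + t\<^sup>2 * c" "0 \<le> c"
  shows "b\<^sup>2 \<le> a * c"
proof (cases "c = 0")
  case True
  have "b = 0"
  proof (rule ccontr)
    assume "b \<noteq> 0"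
    \<comment> \<open>For c = 0 the expression is affine in t, and this t gives it the value
      -1.\<close>
    then show False
      using assms(1)[of "(a + 1) / (2 * b)"] True by simp
  qed
  then show ?thesis using True by simp
next
  case False
  then show ?thesis
    using assms(1)[of "b / c"] assms(2) by (simp add: field_simps power2_eq_square)
qed

lemma ip_Cauchy_Schwarz:
  assumes "L2 m f" "L2 m g"
  shows "\<bar>ip m f g\<bar> \<le> nrm m f * nrm m g"
proof -
  have "0 \<le> ip m f f - 2 * t * ip m f g + t\<^sup>2 * ip m g g" for t
  proof -
    have "0 \<le> ip m (\<lambda>x. f x - t * g x) (\<lambda>x. f x - t * g x)"
      by (rule ip_self_nonneg)
    also have "\<dots> = ip m f f - 2 * t * ip m f g + t\<^sup>2 * ip m g g"
      using assms
      by (simp add: ip_linear L2_diff L2_scale ip_commute[of m g f] algebra_simps power2_eq_square)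
    finally show ?thesis .
  qed
  then have "(ip m f g)\<^sup>2 \<le> ip m f f * ip m g g"
    by (intro quadratic_nonneg_discriminant ip_self_nonneg)
  then have "(ip m f g)\<^sup>2 \<le> (nrm m f * nrm m g)\<^sup>2"
    by (simp add: power_mult_distrib nrm_squared)
  then show ?thesis
    using nrm_nonneg by (metis abs_le_square_iff abs_of_nonneg mult_nonneg_nonneg)
qed

lemma nrm_scale: "nrm m (\<lambda>x. a * f x) = \<bar>a\<bar> * nrm m f"
  by (simp add: nrm_def ip_scale_left ip_scale_right real_sqrt_mult mult.assoc[symmetric] flip: power2_eq_square)

lemma nrm_triangle:
  assumes "L2 m f" "L2 m g"
  shows "nrm m (\<lambda>x. f x + g x) \<le> nrm m f + nrm m g"
proof (rule power2_le_imp_le)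
  have "(nrm m (\<lambda>x. f x + g x))\<^sup>2 = ip m f f + 2 * ip m f g + ip m g g"
    unfolding nrm_squared using assms
    by (simp add: ip_linear L2_add ip_commute[of m g f])
  also have "\<dots> \<le> (nrm m f + nrm m g)\<^sup>2"
    using ip_Cauchy_Schwarz[OF assms] by (simp add: power2_sum nrm_squared)
  finally show "(nrm m (\<lambda>x. f x + g x))\<^sup>2 \<le> (nrm m f + nrm m g)\<^sup>2" .
qed (simp add: nrm_nonneg)

lemma nrm_commute: "nrm m (\<lambda>x. f x - g x) = nrm m (\<lambda>x. g x - f x)"
proof -
  have "(f x - g x) * (f x - g x) = (g x - f x) * (g x - f x)" for x
    by (simp add: algebra_simps)
  then show ?thesis
    by (simp add: nrm_def ip_def)
qed

lemma aeeq_if_nrm_diff_eq_0: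
  assumes "L2 m f" "L2 m g" "nrm m (\<lambda>x. f x - g x) = 0"
  shows "aeeq m f g"
proof -
  have "L2 m (\<lambda>x. f x - g x)"
    using assms L2_diff by blast
  moreover have "ip m (\<lambda>x. f x - g x) (\<lambda>x. f x - g x) = 0"
    using assms(3) by (metis nrm_squared zero_power2)
  ultimately have "AE x in m. (f x - g x) * (f x - g x) = 0"
    unfolding ip_def using L2_integrable_mult[of m "\<lambda>x. f x - g x" "\<lambda>x. f x - g x"]
    by (subst (asm) integral_nonneg_eq_0_iff_AE) auto
  then show ?thesis
    unfolding aeeq_def by (rule AE_mp) auto
qed

definition unit_clip :: "('a \<Rightarrow> real) \<Rightarrow> 'a \<Rightarrow> real" where
  "unit_clip w = (\<lambda>x. min (max (w x) 0) 1)"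

lemma L2_dominated:
  assumes "L2 m f" "g \<in> borel_measurable m" "\<And>x. \<bar>g x\<bar> \<le> \<bar>f x\<bar>"
  shows "L2 m g"
  using assms unfolding L2_def
  by (auto intro!: Bochner_Integration.integrable_bound[where f="\<lambda>x. (f x)\<^sup>2"] simp: abs_le_square_iff)

lemma L2_unit_clip: "L2 m w \<Longrightarrow> L2 m (unit_clip w)"
  by (rule L2_dominated[of m w]) (auto simp: unit_clip_def L2_def)

text \<open>Pointwise (f - w)(w - w#) \<le> - (w - w#)^2 for f with values in the unit interval, so the
  sign condition forces the clipped function w# to agree with w.\<close>

lemma unit_clip_fixed:
  assumes "L2 m f" "AE x in m. 0 \<le> f x \<and> f x \<le> 1" "L2 m w"
    and "0 \<le> ip m (\<lambda>x. f x - w x) (\<lambda>x. w x - unit_clip w x)"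
  shows "AE x in m. 0 \<le> w x \<and> w x \<le> 1"
proof -
  let ?d = "\<lambda>x. w x - unit_clip w x"
  have L: "L2 m ?d" "L2 m (\<lambda>x. f x - w x)"
    using assms by (auto intro: L2_diff L2_unit_clip)
  have ineq: "(a - b) * (b - min (max b 0) 1) \<le> - ((b - min (max b 0) 1) * (b - min (max b 0) 1))"
    if "0 \<le> a \<and> a \<le> 1" for a b :: real
  proof -
    have "(a - min (max b 0) 1) * (b - min (max b 0) 1) \<le> 0"
      using that by (auto simp: min_def max_def mult_le_0_iff)
    then show ?thesis by (simp add: algebra_simps)
  qed
  have "ip m (\<lambda>x. f x - w x) ?d \<le> (\<integral>x. - (?d x * ?d x) \<partial>m)"
    unfolding ip_def
  proof (rule integral_mono_AE)
    show "AE x in m. (f x - w x) * ?d x \<le> - (?d x * ?d x)"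
      using assms(2) by (rule AE_mp) (auto simp: unit_clip_def intro: ineq)
  qed (use L L2_integrable_mult in auto)
  then have "ip m ?d ?d \<le> 0"
    using assms(4) by (simp add: ip_def)
  then have "nrm m ?d = 0"
    using ip_self_nonneg[of m ?d] by (simp add: nrm_def)
  then have "aeeq m w (unit_clip w)"
    by (intro aeeq_if_nrm_diff_eq_0 assms L2_unit_clip)
  then show ?thesis
    unfolding aeeq_def by (rule AE_mp) (auto simp: unit_clip_def min_def max_def split: if_splits)
qed

section \<open>Generators\<close>

text \<open>The generator as a relation between representatives. \<open>generator\<close> fixes the
  values of A only up to null sets and states no linearity of A; linear combinations of related
  pairs are again related without comparing values of A.\<close>

definition generator_pair ::
  "'a measure \<Rightarrow> (real \<Rightarrow> ('a \<Rightarrow> real) \<Rightarrow> ('a \<Rightarrow> real)) \<Rightarrow> ('a \<Rightarrow> real) \<Rightarrow> ('a \<Rightarrow> real) \<Rightarrow> bool" where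
  "generator_pair m T f h \<longleftrightarrow> L2 m f \<and> L2 m h \<and>
     ((\<lambda>t. nrm m (\<lambda>x. (T t f x - f x) / t - h x)) \<longlongrightarrow> 0) (at_right 0)"

text \<open>Difference quotients converge in norm, so by Cauchy-Schwarz the sign of their pairing
  with z passes to the limit. With z = f this gives dissipativity, with z the excess of f over its
  unit clip the sub-Markov property of the resolvent.\<close>

lemma generator_pair_ip_nonpos:
  assumes gp: "generator_pair m T f h" and z: "L2 m z"
    and T: "\<And>t. t \<ge> 0 \<Longrightarrow> L2 m (T t f)"
    and le: "\<And>t. t > 0 \<Longrightarrow> ip m (\<lambda>x. T t f x - f x) z \<le> 0"
  shows "ip m h z \<le> 0"
proof -
  have L: "L2 m f" "L2 m h"
    using gp by (auto simp: generator_pair_def)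
  have "((\<lambda>t. nrm m (\<lambda>x. (T t f x - f x) / t - h x) * nrm m z) \<longlongrightarrow> 0 * nrm m z) (at_right 0)"
    using gp by (intro tendsto_mult tendsto_const) (auto simp: generator_pair_def)
  moreover have "\<forall>\<^sub>F t in at_right 0. ip m h z \<le> nrm m (\<lambda>x. (T t f x - f x) / t - h x) * nrm m z"
  proof (rule eventually_at_rightI[of 0 1])
    fix t :: real assume t: "t \<in> {0<..<1}"
    let ?q = "\<lambda>x. (1 / t) * (T t f x - f x)"
    have q: "L2 m ?q"
      using t T[of t] L by (intro L2_scale L2_diff) auto
    have "ip m (\<lambda>x. ?q x - h x) z = (1 / t) * ip m (\<lambda>x. T t f x - f x) z - ip m h z"
      using q L z by (simp only: ip_diff_left ip_scale_left)
    moreover have "(1 / t) * ip m (\<lambda>x. T t f x - f x) z \<le> 0"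
      using le[of t] t by (simp add: divide_le_0_iff)
    moreover have "\<bar>ip m (\<lambda>x. ?q x - h x) z\<bar> \<le> nrm m (\<lambda>x. ?q x - h x) * nrm m z"
      by (intro ip_Cauchy_Schwarz L2_diff q L z)
    ultimately show "ip m h z \<le> nrm m (\<lambda>x. (T t f x - f x) / t - h x) * nrm m z"
      by simp
  qed simp
  ultimately show ?thesis
    by (intro tendsto_lowerbound[of _ 0 "at_right 0"]) auto
qed

lemma contraction_subMarkov_sgD:
  assumes "contraction_subMarkov_sg m T" "t \<ge> 0" "L2 m f"
  shows "L2 m (T t f)" "nrm m (T t f) \<le> nrm m f"
    and "L2 m g \<Longrightarrow> aeeq m (T t (\<lambda>x. a * f x + g x)) (\<lambda>x. a * T t f x + T t g x)"
    and "(AE x in m. 0 \<le> f x \<and> f x \<le> 1) \<Longrightarrow> (AE x in m. 0 \<le> T t f x \<and> T t f x \<le> 1)"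
  using assms unfolding contraction_subMarkov_sg_def L2_linop_def by simp_all

lemma generator_pair_lincomb:
  assumes sg: "contraction_subMarkov_sg m T"
    and "generator_pair m T f h" "generator_pair m T f' h'"
  shows "generator_pair m T (\<lambda>x. a * f x + f' x) (\<lambda>x. a * h x + h' x)"
proof -
  have L: "L2 m f" "L2 m h" "L2 m f'" "L2 m h'"
    using assms by (auto simp: generator_pair_def)
  have T: "L2 m (T t g)" if "t \<ge> 0" "L2 m g" for t g
    using contraction_subMarkov_sgD(1)[OF sg] that by blast
  let ?F = "\<lambda>x. a * f x + f' x" and ?H = "\<lambda>x. a * h x + h' x"
  let ?p = "\<lambda>t x. (T t f x - f x) / t - h x" and ?p' = "\<lambda>t x. (T t f' x - f' x) / t - h' x"
  have LF: "L2 m ?F" "L2 m ?H"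
    using L by (auto intro: L2_add L2_scale)
  have quot: "L2 m (\<lambda>x. (T t g x - g x) / t - k x)" if "t > 0" "L2 m g" "L2 m k" for t g k
    using L2_diff[OF L2_scale[OF L2_diff[OF T[of t g] that(2)], of "1 / t"] that(3)] that by simp
  have lim: "((\<lambda>t. \<bar>a\<bar> * nrm m (?p t) + nrm m (?p' t)) \<longlongrightarrow> \<bar>a\<bar> * 0 + 0) (at_right 0)"
    using assms by (intro tendsto_intros) (auto simp: generator_pair_def)
  have le: "\<forall>\<^sub>F t in at_right 0. nrm m (\<lambda>x. (T t ?F x - ?F x) / t - ?H x)
      \<le> \<bar>a\<bar> * nrm m (?p t) + nrm m (?p' t)"
  proof (rule eventually_at_rightI[of 0 1])
    fix t :: real assume t: "t \<in> {0<..<1}"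
    have "aeeq m (T t ?F) (\<lambda>x. a * T t f x + T t f' x)"
      using L t by (intro contraction_subMarkov_sgD(3)[OF sg]) auto
    then have ae: "aeeq m (\<lambda>x. (T t ?F x - ?F x) / t - ?H x) (\<lambda>x. a * ?p t x + ?p' t x)"
      unfolding aeeq_def by (rule AE_mp) (use t in \<open>auto simp: field_simps\<close>)
    have "nrm m (\<lambda>x. (T t ?F x - ?F x) / t - ?H x) = nrm m (\<lambda>x. a * ?p t x + ?p' t x)"
      using t L LF by (intro nrm_cong_AE ae quot L2_add L2_scale) auto
    also have "\<dots> \<le> nrm m (\<lambda>x. a * ?p t x) + nrm m (?p' t)"
      using t L by (intro nrm_triangle L2_scale quot) auto
    finally show "nrm m (\<lambda>x. (T t ?F x - ?F x) / t - ?H x) \<le> \<bar>a\<bar> * nrm m (?p t) + nrm m (?p' t)"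
      by (simp add: nrm_scale)
  qed simp
  have "((\<lambda>t. nrm m (\<lambda>x. (T t ?F x - ?F x) / t - ?H x)) \<longlongrightarrow> 0) (at_right 0)"
    by (rule tendsto_sandwich[OF always_eventually le tendsto_const lim[simplified]]) (simp add: nrm_nonneg)
  then show ?thesis
    using LF by (simp add: generator_pair_def)
qed

text \<open>Contractivity and Cauchy-Schwarz bound the pairing of \<open>T t f\<close> with f by the
  squared norm of f.\<close>

lemma generator_pair_dissipative:
  assumes sg: "contraction_subMarkov_sg m T" and gp: "generator_pair m T f h"
  shows "ip m h f \<le> 0"
proof (rule generator_pair_ip_nonpos[OF gp])
  have f: "L2 m f"
    using gp by (simp add: generator_pair_def)
  then show "L2 m f" .
  show T: "L2 m (T t f)" if "t \<ge> 0" for t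
    using contraction_subMarkov_sgD(1)[OF sg] that f by blast
  show "ip m (\<lambda>x. T t f x - f x) f \<le> 0" if "t > 0" for t
  proof -
    have "ip m (T t f) f \<le> nrm m (T t f) * nrm m f"
      using ip_Cauchy_Schwarz[of m "T t f" f] T[of t] f that by linarith
    also have "\<dots> \<le> nrm m f * nrm m f"
      using f that by (intro mult_right_mono nrm_nonneg contraction_subMarkov_sgD(2)[OF sg]) auto
    finally show ?thesis
      using T[of t] f that by (simp add: ip_diff_left nrm_squared flip: power2_eq_square)
  qed
qed

text \<open>Split g into its clip c and the excess d. Contractivity controls the pairing of
  \<open>T t d\<close> with d. The sub-Markov property keeps \<open>T t c\<close> in the unit
  interval, and there \<open>T t c - c\<close> and d have opposite signs pointwise, because d is
  positive only where c = 1 and negative only where c = 0.\<close>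

lemma generator_pair_unit_clip:
  assumes sg: "contraction_subMarkov_sg m T" and gp: "generator_pair m T g h"
  shows "ip m h (\<lambda>x. g x - unit_clip g x) \<le> 0"
proof (rule generator_pair_ip_nonpos[OF gp])
  have g: "L2 m g"
    using gp by (simp add: generator_pair_def)
  let ?c = "unit_clip g" and ?d = "\<lambda>x. g x - unit_clip g x"
  have c: "L2 m ?c" and d: "L2 m ?d"
    using g by (auto intro: L2_unit_clip L2_diff)
  then show "L2 m ?d" by simp
  have T: "L2 m (T t k)" if "t \<ge> 0" "L2 m k" for t k
    using contraction_subMarkov_sgD(1)[OF sg] that by blast
  then show "L2 m (T t g)" if "t \<ge> 0" for t
    using that g by blast
  show "ip m (\<lambda>x. T t g x - g x) ?d \<le> 0" if t: "t > 0" for t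
  proof -
    have Tl: "L2 m (T t g)" "L2 m (T t ?c)" "L2 m (T t ?d)"
      using T t g c d by auto
    have "aeeq m (T t (\<lambda>x. 1 * ?c x + ?d x)) (\<lambda>x. 1 * T t ?c x + T t ?d x)"
      using c d t by (intro contraction_subMarkov_sgD(3)[OF sg]) auto
    then have "ip m (T t g) ?d = ip m (\<lambda>x. T t ?c x + T t ?d x) ?d"
      using Tl d by (intro ip_cong_AE L2_add) auto
    also have "\<dots> = ip m (T t ?c) ?d + ip m (T t ?d) ?d"
      using Tl d by (simp add: ip_add_left)
    finally have 1: "ip m (T t g) ?d = ip m (T t ?c) ?d + ip m (T t ?d) ?d" .
    have "ip m (T t ?d) ?d \<le> nrm m (T t ?d) * nrm m ?d"
      using ip_Cauchy_Schwarz[of m "T t ?d" ?d] Tl d by linarith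
    also have "\<dots> \<le> nrm m ?d * nrm m ?d"
      using d t by (intro mult_right_mono nrm_nonneg contraction_subMarkov_sgD(2)[OF sg]) auto
    finally have 2: "ip m (T t ?d) ?d \<le> ip m ?d ?d"
      by (simp add: nrm_squared flip: power2_eq_square)
    have "AE x in m. 0 \<le> ?c x \<and> ?c x \<le> 1"
      by (auto simp: unit_clip_def)
    then have Tc: "AE x in m. 0 \<le> T t ?c x \<and> T t ?c x \<le> 1"
      using c t by (intro contraction_subMarkov_sgD(4)[OF sg]) auto
    have "ip m (\<lambda>x. T t ?c x - ?c x) ?d \<le> (\<integral>x. 0 \<partial>m)"
      unfolding ip_def
    proof (rule integral_mono_AE)
      show "AE x in m. (T t ?c x - ?c x) * ?d x \<le> 0"
        using Tc by (rule AE_mp) (auto simp: unit_clip_def min_def max_def mult_le_0_iff)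
    qed (use Tl c d in \<open>auto intro: L2_integrable_mult L2_diff\<close>)
    then have 3: "ip m (T t ?c) ?d \<le> ip m ?c ?d"
      using Tl c d by (simp add: ip_diff_left)
    have 4: "ip m ?d ?d = ip m g ?d - ip m ?c ?d"
      using g c d by (rule ip_diff_left)
    have "ip m (\<lambda>x. T t g x - g x) ?d = ip m (T t g) ?d - ip m g ?d"
      using Tl g d by (simp add: ip_diff_left)
    then show ?thesis
      using 1 2 3 4 by linarith
  qed
qed

section \<open>Resolvents of generators\<close>

lemma generator_resolvent_tendsto:
  assumes sg: "contraction_subMarkov_sg m T" and gen: "generator m T DA A"
    and res: "resolvent_of_gen m DA A G"
    and u: "u \<in> DA" and v: "in_adjoint_domain m DA A v"
  shows "((\<lambda>\<beta>. \<beta> * (ip m u v - \<beta> * ip m (G \<beta> u) v)) \<longlongrightarrow> - ip m (A u) v) at_top"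
proof -
  obtain w where w: "L2 m v" "L2 m w" "\<And>f. f \<in> DA \<Longrightarrow> ip m (A f) v = ip m f w"
    using v by (auto simp: in_adjoint_domain_def)
  have pair: "generator_pair m T f (A f)" if "f \<in> DA" for f
    using gen that by (auto simp: generator_def generator_pair_def)
  have Lu: "L2 m u" "L2 m (A u)"
    using pair[OF u] by (auto simp: generator_pair_def)
  \<comment> \<open>The rate 1/\<beta> has two sources. With g = \<open>G \<beta> u\<close>, the
    difference r = \<beta> g - u equals A g almost everywhere, and dissipativity applied to r bounds
    its norm by that of A u divided by \<beta>. Moving A onto v turns the error of the approximation
    into the pairing of -r with w, the adjoint image of v.\<close>
  have est: "\<bar>\<beta> * (ip m u v - \<beta> * ip m (G \<beta> u) v) - (- ip m (A u) v)\<bar>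
      \<le> nrm m (A u) * nrm m w / \<beta>" if \<beta>: "\<beta> > 0" for \<beta>
  proof -
    define g where "g = G \<beta> u"
    have g: "g \<in> DA" and ae: "aeeq m (\<lambda>x. \<beta> * g x - A g x) u"
      using res \<beta> Lu by (auto simp: resolvent_of_gen_def g_def)
    have Lg: "L2 m g" "L2 m (A g)"
      using pair[OF g] by (auto simp: generator_pair_def)
    define r where "r = (\<lambda>x. \<beta> * g x - u x)"
    have r: "L2 m r"
      unfolding r_def by (intro L2_diff L2_scale Lg Lu)
    \<comment> \<open>\<open>generator_pair_lincomb\<close> only forms a f + f', so the innermost
      application builds the zero pair from u as a starting point.\<close>
    have "generator_pair m T (\<lambda>x. (-1) * u x + \<beta> * g x) (\<lambda>x. (-1) * A u x + \<beta> * A g x)"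
      using generator_pair_lincomb[OF sg pair[OF u] generator_pair_lincomb[OF sg pair[OF g] generator_pair_lincomb[OF sg pair[OF u] pair[OF u], of "-1"], of \<beta>], of "-1"]
      by simp
    then have "ip m (\<lambda>x. \<beta> * A g x - A u x) r \<le> 0"
      using generator_pair_dissipative[OF sg] by (fastforce simp: r_def)
    moreover have Ag: "aeeq m (A g) r"
      using ae unfolding aeeq_def r_def by (rule AE_mp) auto
    ultimately have "\<beta> * ip m r r \<le> ip m (A u) r"
      using ip_cong_AE[OF Lg(2) r r Ag] Lg Lu r by (simp add: ip_linear L2_scale)
    also have "\<dots> \<le> nrm m (A u) * nrm m r"
      using ip_Cauchy_Schwarz[OF Lu(2) r] by linarith
    finally have "(\<beta> * nrm m r) * nrm m r \<le> nrm m (A u) * nrm m r"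
      by (simp add: nrm_squared[symmetric] power2_eq_square mult.assoc)
    then have bound: "\<beta> * nrm m r \<le> nrm m (A u)"
      using nrm_nonneg[of m r] nrm_nonneg[of m "A u"] by (cases "nrm m r = 0") auto
    have "\<beta> * ip m g w - ip m u w = \<beta> * ip m (A g) v - ip m (A u) v"
      using w(3) g u by simp
    also have "ip m (A g) v = ip m r v"
      by (rule ip_cong_AE[OF Lg(2) r w(1) Ag])
    also have "ip m r v = \<beta> * ip m g v - ip m u v"
      unfolding r_def using Lg Lu w by (simp add: ip_linear L2_scale)
    finally have "\<beta> * (ip m u v - \<beta> * ip m g v) - (- ip m (A u) v) = - (\<beta> * ip m g w - ip m u w)"
      by (simp add: algebra_simps)
    also have "\<beta> * ip m g w - ip m u w = ip m r w"
      unfolding r_def using Lg Lu w by (simp add: ip_linear L2_scale)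
    finally have "\<bar>\<beta> * (ip m u v - \<beta> * ip m g v) - (- ip m (A u) v)\<bar> \<le> nrm m r * nrm m w"
      using ip_Cauchy_Schwarz[OF r w(2)] by simp
    also have "\<dots> \<le> (nrm m (A u) / \<beta>) * nrm m w"
      using bound \<beta> by (intro mult_right_mono nrm_nonneg) (simp add: field_simps)
    finally show ?thesis
      by (simp add: g_def)
  qed
  have lim: "((\<lambda>\<beta>. nrm m (A u) * nrm m w / \<beta>) \<longlongrightarrow> 0) at_top"
    by (intro tendsto_divide_0[OF tendsto_const] filterlim_at_top_imp_at_infinity filterlim_ident)
  have ev: "\<forall>\<^sub>F \<beta> in at_top. norm (\<beta> * (ip m u v - \<beta> * ip m (G \<beta> u) v) - (- ip m (A u) v))
      \<le> nrm m (A u) * nrm m w / \<beta>"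
    using eventually_gt_at_top[of 0] by eventually_elim (unfold real_norm_def, rule est)
  show ?thesis
    by (rule LIM_zero_cancel) (rule Lim_null_comparison[OF ev lim])
qed

text \<open>For w = \<beta> g the resolvent equation reads f - w = -A g, and
  \<open>generator_pair_unit_clip\<close> for w supplies the sign condition of
  \<open>unit_clip_fixed\<close>.\<close>

lemma generator_resolvent_subMarkov:
  assumes sg: "contraction_subMarkov_sg m T" and gen: "generator m T DA A"
    and res: "resolvent_of_gen m DA A G"
    and \<beta>: "\<beta> > 0" and f: "L2 m f" "AE x in m. 0 \<le> f x \<and> f x \<le> 1"
  shows "AE x in m. 0 \<le> \<beta> * G \<beta> f x \<and> \<beta> * G \<beta> f x \<le> 1"
proof -
  define g where "g = G \<beta> f"
  have g: "g \<in> DA" and ae: "aeeq m (\<lambda>x. \<beta> * g x - A g x) f"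
    using res \<beta> f by (auto simp: resolvent_of_gen_def g_def)
  have pair: "generator_pair m T g (A g)"
    using gen g by (auto simp: generator_def generator_pair_def)
  then have Lg: "L2 m g" "L2 m (A g)"
    by (auto simp: generator_pair_def)
  let ?w = "\<lambda>x. \<beta> * g x"
  have w: "L2 m ?w" "L2 m (\<lambda>x. ?w x - unit_clip ?w x)"
    by (intro L2_diff L2_unit_clip L2_scale Lg)+
  have "generator_pair m T ?w (\<lambda>x. \<beta> * A g x)"
    using generator_pair_lincomb[OF sg pair generator_pair_lincomb[OF sg pair pair, of "-1"], of \<beta>] by simp
  from generator_pair_unit_clip[OF sg this]
  have neg: "\<beta> * ip m (A g) (\<lambda>x. ?w x - unit_clip ?w x) \<le> 0"
    by (simp add: ip_scale_left)
  have "aeeq m (\<lambda>x. f x - ?w x) (\<lambda>x. (-1) * A g x)"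
    using ae unfolding aeeq_def by (rule AE_mp) auto
  then have "ip m (\<lambda>x. f x - ?w x) (\<lambda>x. ?w x - unit_clip ?w x) = ip m (\<lambda>x. (-1) * A g x) (\<lambda>x. ?w x - unit_clip ?w x)"
    by (intro ip_cong_AE L2_diff L2_scale f w Lg)
  also have "\<dots> \<ge> 0"
    using neg \<beta> unfolding ip_scale_left by (simp add: mult_le_0_iff)
  finally show ?thesis
    using unit_clip_fixed[OF f w(1)] by (simp add: g_def)
qed

section \<open>Semi-Dirichlet forms\<close>

locale semi_dirichlet_form =
  fixes m :: "'a measure" and D :: "('a \<Rightarrow> real) set" and E :: "('a \<Rightarrow> real) \<Rightarrow> ('a \<Rightarrow> real) \<Rightarrow> real"
  assumes semi_dirichlet: "semi_dirichlet m D E"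
begin

lemmas sd = semi_dirichlet[unfolded semi_dirichlet_def]

lemma D_L2: "f \<in> D \<Longrightarrow> L2 m f"
  using sd[THEN conjunct1] by blast

lemma D_zero: "(\<lambda>x. 0) \<in> D"
  by (rule sd[THEN conjunct2, THEN conjunct2, THEN conjunct1])

lemma D_lincomb': "f \<in> D \<Longrightarrow> g \<in> D \<Longrightarrow> (\<lambda>x. a * f x + g x) \<in> D"
  using sd[THEN conjunct2, THEN conjunct2, THEN conjunct2, THEN conjunct1] by blast

lemma D_scale: "f \<in> D \<Longrightarrow> (\<lambda>x. a * f x) \<in> D"
  using D_lincomb'[OF _ D_zero, of f a] by simp

lemma D_add: "f \<in> D \<Longrightarrow> g \<in> D \<Longrightarrow> (\<lambda>x. f x + g x) \<in> D"
  using D_lincomb'[of f g 1] by simp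

lemma D_diff: "f \<in> D \<Longrightarrow> g \<in> D \<Longrightarrow> (\<lambda>x. f x - g x) \<in> D"
  using D_lincomb'[of g f "-1"] by simp

lemma E_lincomb':
  assumes "f \<in> D" "g \<in> D" "h \<in> D"
  shows "E (\<lambda>x. a * f x + g x) h = a * E f h + E g h" "E h (\<lambda>x. a * f x + g x) = a * E h f + E h g"
  using sd[THEN conjunct2, THEN conjunct2, THEN conjunct2, THEN conjunct2, THEN conjunct2, THEN conjunct1] assms by blast+

lemma E_zero: "h \<in> D \<Longrightarrow> E (\<lambda>x. 0) h = 0" "h \<in> D \<Longrightarrow> E h (\<lambda>x. 0) = 0"
  using E_lincomb'[OF D_zero D_zero, of h 1] by simp_all

lemma E_scale:
  "f \<in> D \<Longrightarrow> h \<in> D \<Longrightarrow> E (\<lambda>x. a * f x) h = a * E f h"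
  "f \<in> D \<Longrightarrow> h \<in> D \<Longrightarrow> E h (\<lambda>x. a * f x) = a * E h f"
  using E_lincomb'[OF _ D_zero, of f h a] by (simp_all add: E_zero)

lemma E_add:
  "f \<in> D \<Longrightarrow> g \<in> D \<Longrightarrow> h \<in> D \<Longrightarrow> E (\<lambda>x. f x + g x) h = E f h + E g h"
  "f \<in> D \<Longrightarrow> g \<in> D \<Longrightarrow> h \<in> D \<Longrightarrow> E h (\<lambda>x. f x + g x) = E h f + E h g"
  using E_lincomb'[of f g h 1] by simp_all

lemma E_diff:
  "f \<in> D \<Longrightarrow> g \<in> D \<Longrightarrow> h \<in> D \<Longrightarrow> E (\<lambda>x. f x - g x) h = E f h - E g h"
  "f \<in> D \<Longrightarrow> g \<in> D \<Longrightarrow> h \<in> D \<Longrightarrow> E h (\<lambda>x. f x - g x) = E h f - E h g"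
  using E_lincomb'[of g f h "-1"] by simp_all

lemmas E_linear = E_scale E_add E_diff
lemmas D_intros = D_scale D_add D_diff

lemma E_nonneg: "f \<in> D \<Longrightarrow> 0 \<le> E f f"
  using sd[THEN conjunct2, THEN conjunct2, THEN conjunct2, THEN conjunct2, THEN conjunct2, THEN conjunct2, THEN conjunct2, THEN conjunct1] by blast

lemma E_cong_AE: "f \<in> D \<Longrightarrow> f' \<in> D \<Longrightarrow> g \<in> D \<Longrightarrow> aeeq m f f' \<Longrightarrow> E f g = E f' g"
  using sd[THEN conjunct2, THEN conjunct2, THEN conjunct2, THEN conjunct2, THEN conjunct2, THEN conjunct2, THEN conjunct1] by blast

lemma E_unit_clip:
  assumes "f \<in> D"
  shows "unit_clip f \<in> D" "0 \<le> E (\<lambda>x. f x + unit_clip f x) (\<lambda>x. f x - unit_clip f x)"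
  using sd[THEN conjunct2, THEN conjunct2, THEN conjunct2, THEN conjunct2, THEN conjunct2, THEN conjunct2, THEN conjunct2, THEN conjunct2, THEN conjunct2, THEN conjunct2] assms unfolding unit_clip_def by blast+

text \<open>The squared norm in which the domain is complete. As E need not be symmetric, only its
  diagonal enters.\<close>

definition E1 :: "('a \<Rightarrow> real) \<Rightarrow> real" where
  "E1 f = E f f + ip m f f"

lemma E1_nonneg: "f \<in> D \<Longrightarrow> 0 \<le> E1 f"
  by (simp add: E1_def E_nonneg ip_self_nonneg)

lemma nrm_le_E1: "f \<in> D \<Longrightarrow> nrm m f \<le> sqrt (E1 f)"
  by (simp add: nrm_def E1_def E_nonneg)

lemma E1_complete:
  assumes "\<And>n. s n \<in> D"
    and "\<And>\<epsilon>. \<epsilon> > 0 \<Longrightarrow> \<exists>N. \<forall>p\<ge>N. \<forall>q\<ge>N. E1 (\<lambda>x. s p x - s q x) < \<epsilon>"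
  obtains u where "u \<in> D" "(\<lambda>n. E1 (\<lambda>x. s n x - u x)) \<longlonglongrightarrow> 0"
proof -
  have "\<forall>s. (\<forall>n. s n \<in> D) \<longrightarrow>
        (\<forall>\<epsilon>>0. \<exists>N. \<forall>p\<ge>N. \<forall>q\<ge>N. E1 (\<lambda>x. s p x - s q x) < \<epsilon>) \<longrightarrow>
        (\<exists>u\<in>D. (\<lambda>n. E1 (\<lambda>x. s n x - u x)) \<longlonglongrightarrow> 0)"
    unfolding E1_def by (rule sd[THEN conjunct2, THEN conjunct2, THEN conjunct2, THEN conjunct2, THEN conjunct2, THEN conjunct2, THEN conjunct2, THEN conjunct2, THEN conjunct2, THEN conjunct1])
  then show ?thesis
    using assms that by blast
qed

text \<open>The sector condition restated for E alone. The absolute value of its constant is taken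
  because no sign is prescribed for it.\<close>

lemma sector:
  obtains Kc where "Kc \<ge> 0"
    "\<And>f g. f \<in> D \<Longrightarrow> g \<in> D \<Longrightarrow> \<bar>E f g\<bar> \<le> Kc * sqrt (E1 f) * sqrt (E1 g) + nrm m f * nrm m g"
proof -
  obtain K where K: "\<And>f g. f \<in> D \<Longrightarrow> g \<in> D \<Longrightarrow> \<bar>E f g + ip m f g\<bar> \<le> K * sqrt (E1 f) * sqrt (E1 g)"
    using sd[THEN conjunct2, THEN conjunct2, THEN conjunct2, THEN conjunct2, THEN conjunct2, THEN conjunct2, THEN conjunct2, THEN conjunct2, THEN conjunct1] unfolding E1_def by blast
  show ?thesis
  proof (rule that[of "\<bar>K\<bar>"])
    fix f g assume fg: "f \<in> D" "g \<in> D"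
    have "\<bar>E f g\<bar> \<le> \<bar>E f g + ip m f g\<bar> + \<bar>ip m f g\<bar>"
      by linarith
    also have "\<dots> \<le> K * sqrt (E1 f) * sqrt (E1 g) + nrm m f * nrm m g"
      using fg by (intro add_mono K ip_Cauchy_Schwarz D_L2)
    also have "K * sqrt (E1 f) * sqrt (E1 g) \<le> \<bar>K\<bar> * sqrt (E1 f) * sqrt (E1 g)"
      using fg by (intro mult_right_mono) (auto simp: E1_nonneg)
    finally show "\<bar>E f g\<bar> \<le> \<bar>K\<bar> * sqrt (E1 f) * sqrt (E1 g) + nrm m f * nrm m g"
      by simp
  qed simp
qed

text \<open>The mixed terms E f g and E g f occur only through their sum, so the identity holds
  without symmetry.\<close>

lemma E1_parallelogram:
  assumes "f \<in> D" "g \<in> D"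
  shows "E1 (\<lambda>x. f x - g x) = 2 * E1 f + 2 * E1 g - 4 * E1 (\<lambda>x. (1/2) * f x + (1/2) * g x)"
  unfolding E1_def using assms D_L2[OF assms(1)] D_L2[OF assms(2)]
  by (simp only: E_linear ip_linear D_intros L2_add L2_diff L2_scale) (simp add: algebra_simps)

text \<open>If the bound fails, the nested convex sets C n below carry an E1-Cauchy sequence of almost
  minimisers (Mazur's argument), whose limit must be u.\<close>

lemma weak_upper_bound:
  assumes u: "u \<in> D" and v: "v \<in> D" and \<epsilon>: "\<epsilon> > 0"
  shows "\<exists>\<eta>>0. \<forall>z\<in>D. E1 z \<le> B \<longrightarrow> nrm m (\<lambda>x. z x - u x) < \<eta> \<longrightarrow> E z v < E u v + \<epsilon>"
proof (rule ccontr)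
  assume contra: "\<not> ?thesis"
  define C where "C n = {z \<in> D. E u v + \<epsilon> \<le> E z v \<and> nrm m (\<lambda>x. z x - u x) < inverse (real (Suc n))}" for n
  have ex: "\<exists>z\<in>C n. E1 z \<le> B" for n
  proof -
    have "\<exists>z\<in>D. E1 z \<le> B \<and> nrm m (\<lambda>x. z x - u x) < inverse (real (Suc n)) \<and> \<not> E z v < E u v + \<epsilon>"
      using contra by (metis inverse_positive_iff_positive of_nat_0_less_iff zero_less_Suc)
    then show ?thesis
      unfolding C_def by force
  qed
  have CD: "z \<in> D" if "z \<in> C n" for z n
    using that by (simp add: C_def)
  have C_mono: "C q \<subseteq> C p" if "p \<le> q" for p q
  proof -
    have "inverse (real (Suc q)) \<le> inverse (real (Suc p))"
      using that by (intro le_imp_inverse_le) auto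
    then show ?thesis
      by (auto simp: C_def simp del: of_nat_Suc intro: less_le_trans)
  qed
  define d where "d n = Inf (E1 ` C n)" for n
  have bdd: "bdd_below (E1 ` C n)" for n
    using CD E1_nonneg by (intro bdd_belowI[of _ 0]) auto
  have d_le: "d n \<le> E1 z" if "z \<in> C n" for z n
    unfolding d_def using that bdd by (intro cInf_lower) auto
  have d_mono: "d p \<le> d q" if "p \<le> q" for p q
    unfolding d_def using C_mono[OF that] ex[of q] bdd by (intro cInf_superset_mono image_mono) auto
  have d_bound: "d n \<le> B" for n
    using ex d_le order_trans by blast
  have "incseq d"
    by (simp add: d_mono incseq_def)
  then obtain L where L: "d \<longlonglongrightarrow> L" "\<And>n. d n \<le> L"
    using incseq_convergent[of d B] d_bound by blast
  have "\<exists>z\<in>C n. E1 z < d n + inverse (real (Suc n))" for n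
    using cInf_lessD[of "E1 ` C n" "d n + inverse (real (Suc n))"] ex[of n] by (auto simp: d_def)
  then obtain c where c: "\<And>n. c n \<in> C n" "\<And>n. E1 (c n) < d n + inverse (real (Suc n))"
    by metis
  have cD: "c n \<in> D" for n
    using c CD by blast
  \<comment> \<open>Of convexity only midpoints are used: they are what the parallelogram identity
    compares.\<close>
  have mid: "(\<lambda>x. (1/2) * f x + (1/2) * g x) \<in> C n" if f: "f \<in> C n" and g: "g \<in> C n" for f g n
  proof -
    have D: "f \<in> D" "g \<in> D"
      using f g CD by auto
    have eq: "(\<lambda>x. (1/2) * f x + (1/2) * g x - u x) = (\<lambda>x. (1/2) * (f x - u x) + (1/2) * (g x - u x))"
      by (auto simp: field_simps)
    have "nrm m (\<lambda>x. (1/2) * f x + (1/2) * g x - u x)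
        \<le> nrm m (\<lambda>x. (1/2) * (f x - u x)) + nrm m (\<lambda>x. (1/2) * (g x - u x))"
      unfolding eq by (intro nrm_triangle L2_scale L2_diff D_L2 D u)
    also have "\<dots> < inverse (real (Suc n))"
      using f g by (simp only: nrm_scale) (auto simp: C_def)
    finally have "nrm m (\<lambda>x. (1/2) * f x + (1/2) * g x - u x) < inverse (real (Suc n))" .
    moreover have "E u v + \<epsilon> \<le> E (\<lambda>x. (1/2) * f x + (1/2) * g x) v"
      using f g D v by (simp only: E_linear D_intros) (auto simp: C_def)
    moreover have "(\<lambda>x. (1/2) * f x + (1/2) * g x) \<in> D"
      by (intro D_intros D)
    ultimately show ?thesis
      unfolding C_def by blast
  qed
  \<comment> \<open>Both members lie in C N, so their midpoint has E1 at least d N, while each has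
    E1 below L plus 1/(N+1). The parallelogram identity turns these bounds into an estimate of the
    difference.\<close>
  have cauchy: "E1 (\<lambda>x. c p x - c q x) \<le> 4 * (L - d N) + 4 * inverse (real (Suc N))"
    if pq: "N \<le> p" "N \<le> q" for p q N
  proof -
    have "c p \<in> C N" "c q \<in> C N"
      using c(1) C_mono pq by blast+
    then have "d N \<le> E1 (\<lambda>x. (1/2) * c p x + (1/2) * c q x)"
      by (intro d_le mid)
    moreover have "inverse (real (Suc p)) \<le> inverse (real (Suc N))" "inverse (real (Suc q)) \<le> inverse (real (Suc N))"
      using pq by (auto intro!: le_imp_inverse_le)
    moreover have "e \<le> 4 * (L - dN) + 4 * k"
      if "dN \<le> M" "i \<le> k" "j \<le> k" "e = 2 * a + 2 * b - 4 * M" "a < dp + i" "b < dq + j" "dp \<le> L" "dq \<le> L"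
      for e dN k M i j a b dp dq :: real
      using that by argo
    ultimately show ?thesis
      using E1_parallelogram[OF cD[of p] cD[of q]] c(2)[of p] c(2)[of q] L(2)[of p] L(2)[of q] by blast
  qed
  have "(\<lambda>N. 4 * (L - d N) + 4 * inverse (real (Suc N))) \<longlonglongrightarrow> 4 * (L - L) + 4 * 0"
    by (intro tendsto_intros L LIMSEQ_inverse_real_of_nat)
  then have small: "\<exists>N. 4 * (L - d N) + 4 * inverse (real (Suc N)) < e" if "e > 0" for e
    using order_tendstoD(2)[of _ 0 sequentially e] that eventually_happens' sequentially_bot by fastforce
  obtain z where z: "z \<in> D" "(\<lambda>n. E1 (\<lambda>x. c n x - z x)) \<longlonglongrightarrow> 0"
  proof (rule E1_complete[of c, OF cD])
    fix e :: real assume "e > 0"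
    then show "\<exists>N. \<forall>p\<ge>N. \<forall>q\<ge>N. E1 (\<lambda>x. c p x - c q x) < e"
      using small cauchy by (meson le_less_trans)
  qed
  have sq: "(\<lambda>n. sqrt (E1 (\<lambda>x. c n x - z x))) \<longlonglongrightarrow> 0"
    using tendsto_real_sqrt[OF z(2)] by simp
  have nz: "(\<lambda>n. nrm m (\<lambda>x. c n x - z x)) \<longlonglongrightarrow> 0"
    by (rule tendsto_sandwich[OF _ _ tendsto_const sq])
      (use cD z in \<open>auto simp: nrm_nonneg intro!: always_eventually nrm_le_E1 D_diff\<close>)
  have "nrm m (\<lambda>x. z x - u x) \<le> nrm m (\<lambda>x. c n x - z x) + inverse (real (Suc n))" for n
  proof -
    have "nrm m (\<lambda>x. (z x - c n x) + (c n x - u x)) \<le> nrm m (\<lambda>x. z x - c n x) + nrm m (\<lambda>x. c n x - u x)"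
      by (intro nrm_triangle D_L2 D_diff z cD u)
    then show ?thesis
      using c(1)[of n] nrm_commute[of m z "c n"] by (simp add: C_def)
  qed
  moreover have "(\<lambda>n. nrm m (\<lambda>x. c n x - z x) + inverse (real (Suc n))) \<longlonglongrightarrow> 0 + 0"
    by (intro tendsto_add nz LIMSEQ_inverse_real_of_nat)
  ultimately have "nrm m (\<lambda>x. z x - u x) \<le> 0"
    by (intro LIMSEQ_le_const) auto
  then have "aeeq m z u"
    using nrm_nonneg[of m "\<lambda>x. z x - u x"] z u by (intro aeeq_if_nrm_diff_eq_0 D_L2) auto
  then have Ez: "E z v = E u v"
    using z u v by (intro E_cong_AE)
  obtain K where K: "K \<ge> 0" "\<And>f g. f \<in> D \<Longrightarrow> g \<in> D \<Longrightarrow> \<bar>E f g\<bar> \<le> K * sqrt (E1 f) * sqrt (E1 g) + nrm m f * nrm m g"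
    using sector by blast
  \<comment> \<open>Every c n exceeds E u v = E z v by at least \<epsilon>, although the sector
    condition makes E (c n - z) v tend to 0.\<close>
  have "\<epsilon> \<le> K * sqrt (E1 (\<lambda>x. c n x - z x)) * sqrt (E1 v) + nrm m (\<lambda>x. c n x - z x) * nrm m v" for n
  proof -
    have "\<epsilon> \<le> E (\<lambda>x. c n x - z x) v"
      using c(1)[of n] z v cD[of n] Ez by (simp add: E_diff C_def)
    then show ?thesis
      using K(2)[OF D_diff[OF cD[of n] z(1)] v] by linarith
  qed
  moreover have "(\<lambda>n. K * sqrt (E1 (\<lambda>x. c n x - z x)) * sqrt (E1 v) + nrm m (\<lambda>x. c n x - z x) * nrm m v)
      \<longlonglongrightarrow> K * 0 * sqrt (E1 v) + 0 * nrm m v"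
    by (intro tendsto_intros sq nz)
  ultimately have "\<epsilon> \<le> 0"
    by (intro LIMSEQ_le_const) auto
  then show False
    using \<epsilon> by simp
qed

section \<open>Resolvents of semi-Dirichlet forms\<close>

context
  fixes G :: "real \<Rightarrow> ('a \<Rightarrow> real) \<Rightarrow> ('a \<Rightarrow> real)"
  assumes res: "resolvent_form m D E G"
begin

lemma resolvent_D: "\<beta> > 0 \<Longrightarrow> L2 m f \<Longrightarrow> G \<beta> f \<in> D"
  using res by (simp add: resolvent_form_def)

lemma resolvent_E:
  assumes "\<beta> > 0" "L2 m f" "z \<in> D"
  shows "E (\<lambda>x. \<beta> * G \<beta> f x) z = \<beta> * (ip m f z - \<beta> * ip m (G \<beta> f) z)"
proof -
  have "E (G \<beta> f) z + \<beta> * ip m (G \<beta> f) z = ip m f z"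
    using res assms by (auto simp: resolvent_form_def)
  then have "E (G \<beta> f) z = ip m f z - \<beta> * ip m (G \<beta> f) z"
    by simp
  then show ?thesis
    using assms by (simp add: E_scale resolvent_D)
qed

text \<open>With w = \<beta> G f and its clip c, adding the nonnegative numbers E (w + c) (w - c)
  and E (w - c) (w - c) gives twice E w (w - c). The resolvent equation turns this into the sign
  condition of \<open>unit_clip_fixed\<close>.\<close>

lemma form_resolvent_subMarkov:
  assumes "\<beta> > 0" "L2 m f" "AE x in m. 0 \<le> f x \<and> f x \<le> 1"
  shows "AE x in m. 0 \<le> \<beta> * G \<beta> f x \<and> \<beta> * G \<beta> f x \<le> 1"
proof -
  define w where "w = (\<lambda>x. \<beta> * G \<beta> f x)"
  let ?c = "unit_clip w"
  have w: "w \<in> D"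
    unfolding w_def using assms by (intro D_scale resolvent_D)
  have c: "?c \<in> D" "(\<lambda>x. w x - ?c x) \<in> D"
    using w by (auto intro: E_unit_clip D_diff)
  have "0 \<le> E (\<lambda>x. w x + ?c x) (\<lambda>x. w x - ?c x) + E (\<lambda>x. w x - ?c x) (\<lambda>x. w x - ?c x)"
    using E_unit_clip(2)[OF w] E_nonneg[OF c(2)] by simp
  then have "0 \<le> E w (\<lambda>x. w x - ?c x)"
    using w c by (simp add: E_add(1) E_diff(1))
  also have "\<dots> = \<beta> * (ip m f (\<lambda>x. w x - ?c x) - ip m w (\<lambda>x. w x - ?c x))"
    unfolding w_def using resolvent_E[OF assms(1,2) c(2)] by (simp add: w_def ip_scale_left)
  also have "\<dots> = \<beta> * ip m (\<lambda>x. f x - w x) (\<lambda>x. w x - ?c x)"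
    using assms w c by (simp add: ip_diff_left D_L2)
  finally have "0 \<le> ip m (\<lambda>x. f x - w x) (\<lambda>x. w x - ?c x)"
    using assms(1) by (simp add: zero_le_mult_iff)
  then show ?thesis
    using unit_clip_fixed[OF assms(2,3) D_L2[OF w]] by (simp add: w_def)
qed

text \<open>By the resolvent equation the expression equals E (\<beta> G u) v. The family \<beta> G
  u stays bounded in \<open>E1\<close> and converges to u in L2, so \<open>weak_upper_bound\<close>,
  applied to v and to -v, bounds the limit from both sides.\<close>

lemma form_resolvent_tendsto:
  assumes u: "u \<in> D" and v: "v \<in> D"
  shows "((\<lambda>\<beta>. \<beta> * (ip m u v - \<beta> * ip m (G \<beta> u) v)) \<longlongrightarrow> E u v) at_top"
proof -
  define w where "w = (\<lambda>\<beta> x. \<beta> * G \<beta> u x)"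
  have Lu: "L2 m u"
    using u D_L2 by blast
  have w: "w \<beta> \<in> D" if "\<beta> > 0" for \<beta>
    unfolding w_def using that Lu by (intro D_scale resolvent_D)
  have Ew: "E (w \<beta>) z = \<beta> * ip m (\<lambda>x. u x - w \<beta> x) z" if "\<beta> > 0" "z \<in> D" for \<beta> z
  proof -
    have "E (w \<beta>) z = \<beta> * (ip m u z - ip m (w \<beta>) z)"
      unfolding w_def using resolvent_E[OF that(1) Lu that(2)] by (simp add: ip_scale_left)
    then show ?thesis
      using that w Lu by (simp add: ip_diff_left D_L2)
  qed
  obtain K where K: "K \<ge> 0" "\<And>f g. f \<in> D \<Longrightarrow> g \<in> D \<Longrightarrow> \<bar>E f g\<bar> \<le> K * sqrt (E1 f) * sqrt (E1 g) + nrm m f * nrm m g"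
    using sector by blast
  define b where "b = nrm m u"
  define p where "p = K * sqrt (E1 u)"
  \<comment> \<open>The constant is chosen so that
    \<open>s\<^sup>2 \<le> p * s + 2 * b\<^sup>2\<close> forces s \<le> S: an s above S exceeds 1,
    and then already S s is larger than the right side.\<close>
  define S where "S = p + 2 * b\<^sup>2 + 1"
  have p: "p \<ge> 0" and b: "b \<ge> 0"
    using K(1) E1_nonneg[OF u] by (auto simp: p_def b_def nrm_nonneg)
  have bounds: "E1 (w \<beta>) \<le> S\<^sup>2 \<and> \<beta> * (nrm m (\<lambda>x. w \<beta> x - u x))\<^sup>2 \<le> p * S + b\<^sup>2" if \<beta>: "\<beta> > 0" for \<beta>
  proof -
    note wD = w[OF \<beta>]
    have Lw: "L2 m (w \<beta>)"
      using wD D_L2 by blast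
    have "0 \<le> \<beta> * ip m (\<lambda>x. u x - w \<beta> x) (w \<beta>)"
      using Ew[OF \<beta> wD] E_nonneg[OF wD] by simp
    then have "ip m (w \<beta>) (w \<beta>) \<le> ip m u (w \<beta>)"
      using \<beta> Lu Lw by (simp add: zero_le_mult_iff ip_diff_left)
    also have "\<dots> \<le> b * nrm m (w \<beta>)"
      using ip_Cauchy_Schwarz[OF Lu Lw] by (simp add: b_def)
    finally have "nrm m (w \<beta>) * nrm m (w \<beta>) \<le> b * nrm m (w \<beta>)"
      by (simp add: nrm_squared[symmetric] power2_eq_square)
    then have nw: "nrm m (w \<beta>) \<le> b"
      using nrm_nonneg[of m "w \<beta>"] b by (cases "nrm m (w \<beta>) = 0") auto
    \<comment> \<open>Testing the resolvent equation with w - u yields one identity that bounds the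
      form energy of w and \<beta> times the squared L2 distance to u at the same time.\<close>
    have "E (w \<beta>) (w \<beta>) - E (w \<beta>) u = \<beta> * ip m (\<lambda>x. u x - w \<beta> x) (\<lambda>x. w \<beta> x - u x)"
      using Ew[OF \<beta> D_diff[OF wD u]] wD u by (simp add: E_diff)
    also have "ip m (\<lambda>x. u x - w \<beta> x) (\<lambda>x. w \<beta> x - u x) = - (nrm m (\<lambda>x. w \<beta> x - u x))\<^sup>2"
      unfolding nrm_squared using Lu Lw by (simp add: ip_linear L2_diff)
    finally have eq: "E (w \<beta>) (w \<beta>) + \<beta> * (nrm m (\<lambda>x. w \<beta> x - u x))\<^sup>2 = E (w \<beta>) u"
      by simp
    define s where "s = sqrt (E1 (w \<beta>))"
    have s: "s \<ge> 0" "s\<^sup>2 = E1 (w \<beta>)"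
      using E1_nonneg[OF wD] by (auto simp: s_def)
    have "E (w \<beta>) u \<le> K * s * sqrt (E1 u) + nrm m (w \<beta>) * b"
      using K(2)[OF wD u] by (simp add: s_def b_def)
    also have "\<dots> \<le> p * s + b * b"
      using nw b by (simp add: p_def mult_ac mult_left_mono)
    finally have Ewu: "E (w \<beta>) u \<le> p * s + b\<^sup>2"
      by (simp add: power2_eq_square)
    have "(nrm m (w \<beta>))\<^sup>2 \<le> b\<^sup>2"
      using nw nrm_nonneg by (intro power_mono)
    moreover have "0 \<le> \<beta> * (nrm m (\<lambda>x. w \<beta> x - u x))\<^sup>2"
      using \<beta> by simp
    moreover have "s\<^sup>2 = E (w \<beta>) (w \<beta>) + (nrm m (w \<beta>))\<^sup>2"
      unfolding s(2) E1_def nrm_squared ..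
    ultimately have quad: "s\<^sup>2 \<le> p * s + 2 * b\<^sup>2"
      using Ewu eq by argo
    have sS: "s \<le> S"
    proof (rule ccontr)
      assume "\<not> s \<le> S"
      then have "s > S" by simp
      have "p * s + 2 * b\<^sup>2 < p * s + 2 * b\<^sup>2 * s + s"
      proof -
        have "s > 1"
          using \<open>s > S\<close> p zero_le_power2[of b] unfolding S_def by linarith
        then show ?thesis
          using mult_left_mono[of 1 s "2 * b\<^sup>2"] by simp
      qed
      also have "\<dots> = S * s"
        by (simp add: S_def algebra_simps)
      also have "\<dots> \<le> s\<^sup>2"
        using mult_right_mono[of S s s] \<open>s > S\<close> s(1) by (simp add: power2_eq_square)
      finally show False
        using quad by simp
    qed
    have "E1 (w \<beta>) \<le> S\<^sup>2"
      using power_mono[OF sS s(1), of 2] s(2) by simp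
    moreover have "\<beta> * (nrm m (\<lambda>x. w \<beta> x - u x))\<^sup>2 \<le> p * s + b\<^sup>2"
      using eq Ewu E_nonneg[OF wD] by linarith
    moreover have "p * s \<le> p * S"
      using p sS by (intro mult_left_mono)
    ultimately show ?thesis
      by linarith
  qed
  let ?M = "p * S + b\<^sup>2"
  have M: "?M \<ge> 0"
    using p by (simp add: S_def)
  have lim: "((\<lambda>\<beta>. sqrt (?M / \<beta>)) \<longlongrightarrow> sqrt 0) at_top"
    by (intro tendsto_real_sqrt tendsto_divide_0[OF tendsto_const] filterlim_at_top_imp_at_infinity filterlim_ident)
  have le: "\<forall>\<^sub>F \<beta> in at_top. nrm m (\<lambda>x. w \<beta> x - u x) \<le> sqrt (?M / \<beta>)"
    using eventually_gt_at_top[of 0]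
  proof eventually_elim
    case (elim \<beta>)
    then show ?case
      using bounds[OF elim] by (intro real_le_rsqrt) (simp add: field_simps)
  qed
  have L2conv: "((\<lambda>\<beta>. nrm m (\<lambda>x. w \<beta> x - u x)) \<longlongrightarrow> 0) at_top"
    by (rule tendsto_sandwich[OF always_eventually le tendsto_const lim[simplified]]) (simp add: nrm_nonneg)
  have upper: "\<forall>\<^sub>F \<beta> in at_top. E (w \<beta>) z < E u z + \<epsilon>" if "\<epsilon> > 0" "z \<in> D" for \<epsilon> z
  proof -
    obtain \<eta> where \<eta>: "\<eta> > 0" "\<And>y. y \<in> D \<Longrightarrow> E1 y \<le> S\<^sup>2 \<Longrightarrow> nrm m (\<lambda>x. y x - u x) < \<eta> \<Longrightarrow> E y z < E u z + \<epsilon>"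
      using weak_upper_bound[OF u \<open>z \<in> D\<close> \<open>\<epsilon> > 0\<close>] by blast
    from order_tendstoD(2)[OF L2conv \<eta>(1)] eventually_gt_at_top[of 0] show ?thesis
      by eventually_elim (use \<eta> w bounds in blast)
  qed
  have "((\<lambda>\<beta>. E (w \<beta>) v) \<longlongrightarrow> E u v) at_top"
  proof (rule tendstoI)
    fix \<epsilon> :: real assume \<epsilon>: "\<epsilon> > 0"
    have v': "(\<lambda>x. (-1) * v x) \<in> D"
      using v by (rule D_scale)
    from upper[OF \<epsilon> v] upper[OF \<epsilon> v'] eventually_gt_at_top[of 0]
    show "\<forall>\<^sub>F \<beta> in at_top. dist (E (w \<beta>) v) (E u v) < \<epsilon>"
    proof eventually_elim
      case (elim \<beta>)
      moreover have "E (w \<beta>) (\<lambda>x. (-1) * v x) = - E (w \<beta>) v" "E u (\<lambda>x. (-1) * v x) = - E u v"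
        using E_scale(2)[OF v w, of \<beta> "-1"] E_scale(2)[OF v u, of "-1"] elim by auto
      ultimately show ?case
        by (simp add: dist_real_def)
    qed
  qed
  then show ?thesis
  proof (rule Lim_transform_eventually)
    show "\<forall>\<^sub>F \<beta> in at_top. E (w \<beta>) v = \<beta> * (ip m u v - \<beta> * ip m (G \<beta> u) v)"
      using eventually_gt_at_top[of 0] by eventually_elim (simp add: w_def resolvent_E Lu v)
  qed
qed

end

end

text \<open>The two alternatives of the setting enter the rest of the argument only through these facts.\<close>

lemma resolvent_facts:
  assumes "case1 m U E G Gh \<or> case2 m U E G Gh"
  shows "\<And>\<beta> f. \<beta> > 0 \<Longrightarrow> L2 m f \<Longrightarrow> L2 m (G \<beta> f)"
    and "\<And>\<beta> f. \<beta> > 0 \<Longrightarrow> L2 m f \<Longrightarrow> L2 m (Gh \<beta> f)"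
    and "\<And>\<beta> f g. \<beta> > 0 \<Longrightarrow> L2 m f \<Longrightarrow> L2 m g \<Longrightarrow> ip m (G \<beta> f) g = ip m f (Gh \<beta> g)"
    and "\<And>\<beta> f. \<beta> > 0 \<Longrightarrow> L2 m f \<Longrightarrow> (AE x in m. 0 \<le> f x \<and> f x \<le> 1) \<Longrightarrow>
           (AE x in m. 0 \<le> \<beta> * G \<beta> f x \<and> \<beta> * G \<beta> f x \<le> 1)"
    and "\<And>u v. u \<in> C0inf U \<Longrightarrow> v \<in> C0inf U \<Longrightarrow>
           ((\<lambda>\<beta>. \<beta> * (ip m u v - \<beta> * ip m (G \<beta> u) v)) \<longlongrightarrow> E u v) at_top"
    and "\<And>u. u \<in> C0inf U \<Longrightarrow> L2 m u"
proof -
  have "(\<forall>\<beta> f. \<beta> > 0 \<longrightarrow> L2 m f \<longrightarrow> L2 m (G \<beta> f)) \<and>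
    (\<forall>\<beta> f. \<beta> > 0 \<longrightarrow> L2 m f \<longrightarrow> L2 m (Gh \<beta> f)) \<and>
    (\<forall>\<beta> f g. \<beta> > 0 \<longrightarrow> L2 m f \<longrightarrow> L2 m g \<longrightarrow> ip m (G \<beta> f) g = ip m f (Gh \<beta> g)) \<and>
    (\<forall>\<beta> f. \<beta> > 0 \<longrightarrow> L2 m f \<longrightarrow> (AE x in m. 0 \<le> f x \<and> f x \<le> 1) \<longrightarrow>
           (AE x in m. 0 \<le> \<beta> * G \<beta> f x \<and> \<beta> * G \<beta> f x \<le> 1)) \<and>
    (\<forall>u v. u \<in> C0inf U \<longrightarrow> v \<in> C0inf U \<longrightarrow>
           ((\<lambda>\<beta>. \<beta> * (ip m u v - \<beta> * ip m (G \<beta> u) v)) \<longlongrightarrow> E u v) at_top) \<and>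
    (\<forall>u. u \<in> C0inf U \<longrightarrow> L2 m u)" (is ?P)
    using assms
  proof
    assume "case1 m U E G Gh"
    then obtain T DA A where c: "contraction_subMarkov_sg m T" "generator m T DA A"
        "C0inf U \<subseteq> DA" "\<forall>v\<in>C0inf U. in_adjoint_domain m DA A v"
        "\<forall>u\<in>C0inf U. \<forall>v\<in>C0inf U. E u v = - ip m (A u) v"
        "resolvent_of_gen m DA A G" "coresolvent_adj m G Gh"
      unfolding case1_def by blast
    have DA: "L2 m f" if "f \<in> DA" for f
      using c(2) that by (auto simp: generator_def)
    have "\<forall>\<beta> f. \<beta> > 0 \<longrightarrow> L2 m f \<longrightarrow> L2 m (G \<beta> f)"
      using c(6) DA by (auto simp: resolvent_of_gen_def)
    moreover have "\<forall>\<beta> f. \<beta> > 0 \<longrightarrow> L2 m f \<longrightarrow> L2 m (Gh \<beta> f)"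
      using c(7) by (auto simp: coresolvent_adj_def)
    moreover have "\<forall>\<beta> f g. \<beta> > 0 \<longrightarrow> L2 m f \<longrightarrow> L2 m g \<longrightarrow> ip m (G \<beta> f) g = ip m f (Gh \<beta> g)"
      using c(7) by (simp add: coresolvent_adj_def ip_commute[of m "G _ _"] ip_commute[of m _ "Gh _ _"])
    moreover have "((\<lambda>\<beta>. \<beta> * (ip m u v - \<beta> * ip m (G \<beta> u) v)) \<longlongrightarrow> E u v) at_top"
      if "u \<in> C0inf U" "v \<in> C0inf U" for u v
      using generator_resolvent_tendsto[OF c(1,2,6), of u v] c(3,4,5) that by auto
    moreover have "L2 m u" if "u \<in> C0inf U" for u
      using that c(3) DA by blast
    ultimately show ?P
      using generator_resolvent_subMarkov[OF c(1,2,6)] by blast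
  next
    assume "case2 m U E G Gh"
    then obtain D where c: "semi_dirichlet m D E" "C0inf U \<subseteq> D" "resolvent_form m D E G" "coresolvent_form m D E Gh"
      unfolding case2_def by blast
    interpret semi_dirichlet_form m D E
      by unfold_locales (rule c)
    have GhD: "\<forall>\<beta> f. \<beta> > 0 \<longrightarrow> L2 m f \<longrightarrow> Gh \<beta> f \<in> D"
      using c(4) by (auto simp: coresolvent_form_def)
    \<comment> \<open>Each resolvent equation is tested with the other resolvent; the two left sides
      coincide.\<close>
    have adj: "ip m (G \<beta> f) g = ip m f (Gh \<beta> g)" if "\<beta> > 0" "L2 m f" "L2 m g" for \<beta> f g
    proof -
      have "E (G \<beta> f) (Gh \<beta> g) + \<beta> * ip m (G \<beta> f) (Gh \<beta> g) = ip m f (Gh \<beta> g)"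
        using c(3) GhD that by (auto simp: resolvent_form_def)
      moreover have "E (G \<beta> f) (Gh \<beta> g) + \<beta> * ip m (G \<beta> f) (Gh \<beta> g) = ip m g (G \<beta> f)"
        using c(4) resolvent_D[OF c(3)] that by (auto simp: coresolvent_form_def)
      ultimately show ?thesis
        by (simp add: ip_commute)
    qed
    show ?P
    proof (intro conjI allI impI)
      fix \<beta> :: real and f assume "\<beta> > 0" "L2 m f"
      then show "L2 m (G \<beta> f)" "L2 m (Gh \<beta> f)"
        using resolvent_D[OF c(3)] GhD D_L2 by auto
    next
      fix u v assume "u \<in> C0inf U" "v \<in> C0inf U"
      then show "((\<lambda>\<beta>. \<beta> * (ip m u v - \<beta> * ip m (G \<beta> u) v)) \<longlongrightarrow> E u v) at_top"
        using c(2) by (intro form_resolvent_tendsto[OF c(3)]) auto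
    next
      fix u assume "u \<in> C0inf U"
      then show "L2 m u"
        using c(2) D_L2 by auto
    qed (use adj form_resolvent_subMarkov[OF c(3)] in \<open>simp_all\<close>)
  qed
  note P = this
  show "\<And>\<beta> f. \<beta> > 0 \<Longrightarrow> L2 m f \<Longrightarrow> L2 m (G \<beta> f)"
    "\<And>\<beta> f. \<beta> > 0 \<Longrightarrow> L2 m f \<Longrightarrow> L2 m (Gh \<beta> f)"
    "\<And>\<beta> f g. \<beta> > 0 \<Longrightarrow> L2 m f \<Longrightarrow> L2 m g \<Longrightarrow> ip m (G \<beta> f) g = ip m f (Gh \<beta> g)"
    "\<And>\<beta> f. \<beta> > 0 \<Longrightarrow> L2 m f \<Longrightarrow> (AE x in m. 0 \<le> f x \<and> f x \<le> 1) \<Longrightarrow>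
           (AE x in m. 0 \<le> \<beta> * G \<beta> f x \<and> \<beta> * G \<beta> f x \<le> 1)"
    "\<And>u v. u \<in> C0inf U \<Longrightarrow> v \<in> C0inf U \<Longrightarrow>
           ((\<lambda>\<beta>. \<beta> * (ip m u v - \<beta> * ip m (G \<beta> u) v)) \<longlongrightarrow> E u v) at_top"
    "\<And>u. u \<in> C0inf U \<Longrightarrow> L2 m u"
    using P by simp_all
qed

section \<open>Convergence of the kernel measures off the diagonal\<close>

text \<open>The defining identity of the kernel measure takes place in the extended nonnegative
  reals, where a negative inner product would be truncated to 0. Nonnegativity of the inner product
  is what makes the real value recoverable.\<close>

lemma nonneg_kernel_integral:
  assumes ker: "kernel_measures m U G \<sigma>" and \<beta>: "\<beta> > 0"
    and f: "L2 m f" "\<And>x. 0 \<le> f x" "f \<in> borel_measurable borel"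
    and g: "L2 m g" "\<And>x. 0 \<le> g x" "g \<in> borel_measurable borel"
    and nn: "0 \<le> ip m (G \<beta> f) g"
  shows "has_bochner_integral (\<sigma> \<beta>) (\<lambda>z. f (fst z) * g (snd z)) (\<beta> * ip m (G \<beta> f) g)"
proof (rule has_bochner_integral_nn_integral)
  have "sets (\<sigma> \<beta>) = sets (borel :: (_ \<times> _) measure)"
    using ker \<beta> by (auto simp: kernel_measures_def radon_on_def)
  moreover have "(\<lambda>z. f (fst z) * g (snd z)) \<in> borel_measurable borel"
    using f g by (intro borel_measurable_times measurable_compose[OF _ f(3)] measurable_compose[OF _ g(3)])
      (auto intro!: borel_measurable_continuous_onI continuous_intros)
  ultimately show "(\<lambda>z. f (fst z) * g (snd z)) \<in> borel_measurable (\<sigma> \<beta>)"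
    by (simp cong: measurable_cong_sets)
  show "(\<integral>\<^sup>+ z. ennreal (f (fst z) * g (snd z)) \<partial>\<sigma> \<beta>) = ennreal (\<beta> * ip m (G \<beta> f) g)"
    using ker \<beta> f g by (auto simp: kernel_measures_def)
qed (use f g \<beta> nn in auto)

text \<open>Both functions are split into positive and negative parts. Additivity of the pairing in
  its first argument comes from the adjoint H, so no linearity of G is required. The common bound c
  in the positivity condition reflects that positivity will be derived by rescaling a bounded
  function into the unit interval.\<close>

lemma C0inf_kernel_integral:
  assumes m: "sets m = sets borel" and ker: "kernel_measures m U G \<sigma>" and \<beta>: "\<beta> > 0"
    and LG: "\<And>f. L2 m f \<Longrightarrow> L2 m (G \<beta> f)" and LH: "\<And>f. L2 m f \<Longrightarrow> L2 m (H \<beta> f)"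
    and adj: "\<And>f g. L2 m f \<Longrightarrow> L2 m g \<Longrightarrow> ip m (G \<beta> f) g = ip m f (H \<beta> g)"
    and nn: "\<And>f g c. L2 m f \<Longrightarrow> L2 m g \<Longrightarrow> (\<And>x. 0 \<le> f x \<and> f x \<le> c) \<Longrightarrow>
        (\<And>x. 0 \<le> g x \<and> g x \<le> c) \<Longrightarrow> 0 \<le> ip m (G \<beta> f) g"
    and u: "u \<in> C0inf U" "L2 m u" and v: "v \<in> C0inf U" "L2 m v"
  shows "has_bochner_integral (\<sigma> \<beta>) (\<lambda>z. u (fst z) * v (snd z)) (\<beta> * ip m (G \<beta> u) v)"
proof -
  obtain Bu Bv where B: "\<And>x. \<bar>u x\<bar> \<le> Bu" "\<And>x. \<bar>v x\<bar> \<le> Bv"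
    using C0inf_bounded[OF u(1)] C0inf_bounded[OF v(1)] by metis
  define c where "c = max Bu Bv"
  have c: "\<bar>u x\<bar> \<le> c" "\<bar>v x\<bar> \<le> c" for x
    using B[of x] by (auto simp: c_def)
  define up where "up = (\<lambda>x. max (u x) 0)"
  define un where "un = (\<lambda>x. max (- u x) 0)"
  define vp where "vp = (\<lambda>x. max (v x) 0)"
  define vn where "vn = (\<lambda>x. max (- v x) 0)"
  note defs = up_def un_def vp_def vn_def
  have meas: "u \<in> borel_measurable borel" "v \<in> borel_measurable borel"
    using u v by (auto intro!: borel_measurable_continuous_onI C0infD(4))
  have bm: "up \<in> borel_measurable borel" "un \<in> borel_measurable borel"
    "vp \<in> borel_measurable borel" "vn \<in> borel_measurable borel"
    unfolding defs using meas by auto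
  have bm': "f \<in> borel_measurable m" if "f \<in> borel_measurable borel" for f :: "_ \<Rightarrow> real"
    using that m by (simp cong: measurable_cong_sets)
  have "L2 m up" "L2 m un"
    by (auto intro!: L2_dominated[OF u(2)] bm' bm) (auto simp: defs)
  moreover have "L2 m vp" "L2 m vn"
    by (auto intro!: L2_dominated[OF v(2)] bm' bm) (auto simp: defs)
  ultimately have L: "L2 m up" "L2 m un" "L2 m vp" "L2 m vn" by auto
  have rng: "0 \<le> up x \<and> up x \<le> c" "0 \<le> un x \<and> un x \<le> c" "0 \<le> vp x \<and> vp x \<le> c" "0 \<le> vn x \<and> vn x \<le> c" for x
    using c[of x] by (auto simp: defs abs_le_iff)
  have K: "has_bochner_integral (\<sigma> \<beta>) (\<lambda>z. f (fst z) * g (snd z)) (\<beta> * ip m (G \<beta> f) g)"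
    if "L2 m f" "L2 m g" "\<And>x. 0 \<le> f x \<and> f x \<le> c" "\<And>x. 0 \<le> g x \<and> g x \<le> c"
      "f \<in> borel_measurable borel" "g \<in> borel_measurable borel" for f g
    using that nn[of f g c] by (intro nonneg_kernel_integral[OF ker \<beta>]) auto
  have "has_bochner_integral (\<sigma> \<beta>)
      (\<lambda>z. up (fst z) * vp (snd z) - up (fst z) * vn (snd z) - (un (fst z) * vp (snd z) - un (fst z) * vn (snd z)))
      (\<beta> * ip m (G \<beta> up) vp - \<beta> * ip m (G \<beta> up) vn - (\<beta> * ip m (G \<beta> un) vp - \<beta> * ip m (G \<beta> un) vn))"
    by (intro has_bochner_integral_diff K L rng bm)
  moreover have "(\<lambda>z. up (fst z) * vp (snd z) - up (fst z) * vn (snd z) - (un (fst z) * vp (snd z) - un (fst z) * vn (snd z)))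
      = (\<lambda>z. u (fst z) * v (snd z))"
  proof
    fix z
    have eqs: "u (fst z) = up (fst z) - un (fst z)" "v (snd z) = vp (snd z) - vn (snd z)"
      by (auto simp: defs)
    show "up (fst z) * vp (snd z) - up (fst z) * vn (snd z) - (un (fst z) * vp (snd z) - un (fst z) * vn (snd z))
      = u (fst z) * v (snd z)"
      unfolding eqs by (simp only: left_diff_distrib right_diff_distrib)
  qed
  moreover have "\<beta> * ip m (G \<beta> up) vp - \<beta> * ip m (G \<beta> up) vn - (\<beta> * ip m (G \<beta> un) vp - \<beta> * ip m (G \<beta> un) vn)
      = \<beta> * ip m (G \<beta> u) v"
  proof -
    have uv: "v = (\<lambda>x. vp x - vn x)" "u = (\<lambda>x. up x - un x)"
      by (auto simp: defs fun_eq_iff)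
    have "ip m (G \<beta> u) v = ip m up (H \<beta> v) - ip m un (H \<beta> v)"
      using adj[OF u(2) v(2)] ip_diff_left[OF L(1,2) LH[OF v(2)]] uv(2) by simp
    also have "\<dots> = ip m (G \<beta> up) v - ip m (G \<beta> un) v"
      using adj L v by simp
    also have "ip m (G \<beta> up) v = ip m (G \<beta> up) vp - ip m (G \<beta> up) vn"
      using ip_diff_right[OF L(3,4) LG[OF L(1)]] uv(1) by simp
    also have "ip m (G \<beta> un) v = ip m (G \<beta> un) vp - ip m (G \<beta> un) vn"
      using ip_diff_right[OF L(3,4) LG[OF L(2)]] uv(1) by simp
    finally have eq: "ip m (G \<beta> u) v = ip m (G \<beta> up) vp - ip m (G \<beta> up) vn - (ip m (G \<beta> un) vp - ip m (G \<beta> un) vn)" .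
    show ?thesis
      unfolding eq by (simp only: right_diff_distrib)
  qed
  ultimately show ?thesis
    by simp
qed

lemma radon_on_integrable_compact:
  fixes F :: "'a::t2_space \<Rightarrow> real"
  assumes M: "radon_on M V" and S: "compact S" "S \<subseteq> V"
    and F: "F \<in> borel_measurable borel" "\<And>z. z \<in> S \<Longrightarrow> \<bar>F z\<bar> \<le> B" "\<And>z. z \<notin> S \<Longrightarrow> F z = 0"
  shows "integrable M F"
proof (rule Bochner_Integration.integrable_bound)
  have sets: "sets M = sets borel"
    using M by (simp add: radon_on_def)
  have "S \<in> sets M"
    using sets S(1) by (simp add: borel_compact)
  moreover have "emeasure M S < \<infinity>"
    using M S by (simp add: radon_on_def)
  ultimately show "integrable M (\<lambda>z. \<bar>B\<bar> * indicator S z)"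
    by (intro integrable_mult_right) simp
  show "F \<in> borel_measurable M"
    using F(1) sets by (simp cong: measurable_cong_sets)
  show "AE z in M. norm (F z) \<le> norm (\<bar>B\<bar> * indicator S z)"
    using F(2,3) by (intro always_eventually) (auto simp: indicator_def intro: order_trans[OF _ abs_ge_self])
qed

lemma open_offdiag: "open U \<Longrightarrow> open (offdiag U :: ('a::t2_space \<times> 'a) set)"
proof -
  assume "open U"
  then have "open ((U \<times> U) \<inter> {z :: 'a \<times> 'a. fst z \<noteq> snd z})"
    by (intro open_Int open_Times open_Collect_neq continuous_intros)
  moreover have "(U \<times> U) \<inter> {z :: 'a \<times> 'a. fst z \<noteq> snd z} = offdiag U"
    by (auto simp: offdiag_def)
  ultimately show ?thesis by simp
qed

text \<open>These facts hold for E with J and for the transposed form with \<open>Jhat J\<close>. Of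
  J only its effect on functions with disjoint supports is recorded; positivity of E at cutoff
  functions is left out and reappears as a hypothesis where the direct form needs it.\<close>

locale approximated_form =
  fixes U :: "(real^'n::finite) set" and m :: "(real^'n) measure" and E :: "'n fn \<Rightarrow> 'n fn \<Rightarrow> real"
    and \<sigma> :: "real \<Rightarrow> ((real^'n) \<times> (real^'n)) measure" and J :: "((real^'n) \<times> (real^'n)) measure"
  assumes open_U: "open U"
    and L2_C0inf: "\<And>u. u \<in> C0inf U \<Longrightarrow> L2 m u"
    and radon_\<sigma>: "\<And>\<beta>. \<beta> > 0 \<Longrightarrow> radon_on (\<sigma> \<beta>) (U \<times> U)"
    and radon_J: "radon_on J (offdiag U)"
    and approx: "\<And>u v. u \<in> C0inf U \<Longrightarrow> v \<in> C0inf U \<Longrightarrow>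
      ((\<lambda>\<beta>. \<beta> * (ip m u v - (\<integral>z. u (fst z) * v (snd z) \<partial>\<sigma> \<beta>))) \<longlongrightarrow> E u v) at_top"
    and jump: "\<And>u v. u \<in> C0inf U \<Longrightarrow> v \<in> C0inf U \<Longrightarrow> tsupp u \<inter> tsupp v = {} \<Longrightarrow>
      E u v = - 2 * (\<integral>z. u (fst z) * v (snd z) \<partial>J)"
begin

lemma sets_J: "sets J = sets borel"
  using radon_J by (simp add: radon_on_def)

lemma sets_\<sigma>: "\<beta> > 0 \<Longrightarrow> sets (\<sigma> \<beta>) = sets borel"
  using radon_\<sigma> by (simp add: radon_on_def)

lemma measurable_\<sigma>: "\<beta> > 0 \<Longrightarrow> F \<in> borel_measurable borel \<Longrightarrow> F \<in> borel_measurable (\<sigma> \<beta>)"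
  using sets_\<sigma> by (simp cong: measurable_cong_sets)

lemma measurable_J: "F \<in> borel_measurable borel \<Longrightarrow> F \<in> borel_measurable J"
  using sets_J by (simp cong: measurable_cong_sets)

text \<open>Test functions along which the measures \<beta> \<open>\<sigma> \<beta>\<close> converge
  to 2 J, together with the integrability that keeps Bochner integrals from taking their default
  value.\<close>

definition jump_limit :: "((real^'n) \<times> (real^'n) \<Rightarrow> real) \<Rightarrow> bool" where
  "jump_limit F \<longleftrightarrow> F \<in> borel_measurable borel \<and> (\<forall>\<beta>>0. integrable (\<sigma> \<beta>) F) \<and> integrable J F \<and>
     ((\<lambda>\<beta>. \<beta> * (\<integral>z. F z \<partial>\<sigma> \<beta>)) \<longlongrightarrow> 2 * (\<integral>z. F z \<partial>J)) at_top"

lemma jump_limitD: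
  assumes "jump_limit F"
  shows "F \<in> borel_measurable borel" "\<beta> > 0 \<Longrightarrow> integrable (\<sigma> \<beta>) F" "integrable J F"
    "((\<lambda>\<beta>. \<beta> * (\<integral>z. F z \<partial>\<sigma> \<beta>)) \<longlongrightarrow> 2 * (\<integral>z. F z \<partial>J)) at_top"
  using assms by (auto simp: jump_limit_def)

lemma jump_limit_add:
  assumes "jump_limit F" "jump_limit H"
  shows "jump_limit (\<lambda>z. F z + H z)"
proof -
  have "((\<lambda>\<beta>. \<beta> * (\<integral>z. F z \<partial>\<sigma> \<beta>) + \<beta> * (\<integral>z. H z \<partial>\<sigma> \<beta>)) \<longlongrightarrow> 2 * (\<integral>z. F z \<partial>J) + 2 * (\<integral>z. H z \<partial>J)) at_top"
    by (intro tendsto_add jump_limitD assms)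
  moreover have "\<forall>\<^sub>F \<beta> in at_top. \<beta> * (\<integral>z. F z \<partial>\<sigma> \<beta>) + \<beta> * (\<integral>z. H z \<partial>\<sigma> \<beta>) = \<beta> * (\<integral>z. F z + H z \<partial>\<sigma> \<beta>)"
    using eventually_gt_at_top[of 0]
    by eventually_elim (simp add: jump_limitD(2)[OF assms(1)] jump_limitD(2)[OF assms(2)] distrib_left)
  ultimately have "((\<lambda>\<beta>. \<beta> * (\<integral>z. F z + H z \<partial>\<sigma> \<beta>)) \<longlongrightarrow> 2 * (\<integral>z. F z \<partial>J) + 2 * (\<integral>z. H z \<partial>J)) at_top"
    by (rule Lim_transform_eventually)
  then show ?thesis
    using assms[THEN jump_limitD(1)] assms[THEN jump_limitD(3)] jump_limitD(2)[OF assms(1)] jump_limitD(2)[OF assms(2)]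
    unfolding jump_limit_def by (auto simp: distrib_left intro!: borel_measurable_add)
qed

lemma jump_limit_scale:
  assumes "jump_limit F"
  shows "jump_limit (\<lambda>z. c * F z)"
proof -
  have "((\<lambda>\<beta>. c * (\<beta> * (\<integral>z. F z \<partial>\<sigma> \<beta>))) \<longlongrightarrow> c * (2 * (\<integral>z. F z \<partial>J))) at_top"
    by (intro tendsto_mult tendsto_const jump_limitD assms)
  then show ?thesis
    using jump_limitD[OF assms] unfolding jump_limit_def by (auto simp: mult_ac intro!: borel_measurable_times)
qed

text \<open>The majorant R must itself be a test function: the error of replacing F by Q is then
  controlled under \<open>\<sigma> \<beta>\<close> as well, since the scaled integrals of R converge
  to twice its small J-integral.\<close>

lemma jump_limit_sandwich:
  assumes F: "F \<in> borel_measurable borel"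
    and ex: "\<And>\<epsilon>. \<epsilon> > 0 \<Longrightarrow> \<exists>Q R. jump_limit Q \<and> jump_limit R \<and> (\<forall>z. \<bar>F z - Q z\<bar> \<le> R z) \<and> (\<integral>z. R z \<partial>J) \<le> \<epsilon>"
  shows "jump_limit F"
proof -
  have int: "integrable M F" if "integrable M Q" "integrable M R" "F \<in> borel_measurable M"
    "\<forall>z. \<bar>F z - Q z\<bar> \<le> R z" for M Q R
  proof (rule Bochner_Integration.integrable_bound)
    show "integrable M (\<lambda>z. \<bar>Q z\<bar> + R z)"
      using that by auto
    have "\<bar>F z\<bar> \<le> \<bar>\<bar>Q z\<bar> + R z\<bar>" for z
      using that(4)[rule_format, of z] by argo
    then show "AE z in M. norm (F z) \<le> norm (\<bar>Q z\<bar> + R z)"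
      by simp
  qed (use that in auto)
  have diff: "\<bar>(\<integral>z. F z \<partial>M) - (\<integral>z. Q z \<partial>M)\<bar> \<le> (\<integral>z. R z \<partial>M)" if "integrable M Q" "integrable M R" "F \<in> borel_measurable M"
    "\<forall>z. \<bar>F z - Q z\<bar> \<le> R z" for M Q R
  proof -
    have "(\<integral>z. F z \<partial>M) - (\<integral>z. Q z \<partial>M) = (\<integral>z. F z - Q z \<partial>M)"
      using that int[OF that] by simp
    also have "\<bar>\<dots>\<bar> \<le> (\<integral>z. \<bar>F z - Q z\<bar> \<partial>M)"
      by (rule integral_abs_bound)
    also have "\<dots> \<le> (\<integral>z. R z \<partial>M)"
      using that int[OF that] by (intro integral_mono) auto
    finally show ?thesis .
  qed
  obtain Q0 R0 where QR0: "jump_limit Q0" "jump_limit R0" "\<forall>z. \<bar>F z - Q0 z\<bar> \<le> R0 z"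
    using ex[of 1] by auto
  have "((\<lambda>\<beta>. \<beta> * (\<integral>z. F z \<partial>\<sigma> \<beta>)) \<longlongrightarrow> 2 * (\<integral>z. F z \<partial>J)) at_top"
  proof (rule tendstoI)
    fix e :: real assume "e > 0"
    \<comment> \<open>The error is below 3\<epsilon> for replacing F by Q under
      \<open>\<sigma> \<beta>\<close>, \<epsilon> for the convergence at Q, and 2\<epsilon> for
      returning to F under 2 J.\<close>
    define \<epsilon> where "\<epsilon> = e / 6"
    have \<epsilon>: "\<epsilon> > 0"
      using \<open>e > 0\<close> by (simp add: \<epsilon>_def)
    obtain Q R where QR: "jump_limit Q" "jump_limit R" "\<forall>z. \<bar>F z - Q z\<bar> \<le> R z" "(\<integral>z. R z \<partial>J) \<le> \<epsilon>"
      using ex[OF \<epsilon>] by auto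
    have J: "\<bar>(\<integral>z. F z \<partial>J) - (\<integral>z. Q z \<partial>J)\<bar> \<le> (\<integral>z. R z \<partial>J)"
      using QR F by (intro diff) (auto simp: jump_limitD measurable_J)
    have "\<forall>\<^sub>F \<beta> in at_top. dist (\<beta> * (\<integral>z. Q z \<partial>\<sigma> \<beta>)) (2 * (\<integral>z. Q z \<partial>J)) < \<epsilon>"
      using jump_limitD(4)[OF QR(1)] \<epsilon> by (rule tendstoD)
    moreover have "\<forall>\<^sub>F \<beta> in at_top. dist (\<beta> * (\<integral>z. R z \<partial>\<sigma> \<beta>)) (2 * (\<integral>z. R z \<partial>J)) < \<epsilon>"
      using jump_limitD(4)[OF QR(2)] \<epsilon> by (rule tendstoD)
    ultimately show "\<forall>\<^sub>F \<beta> in at_top. dist (\<beta> * (\<integral>z. F z \<partial>\<sigma> \<beta>)) (2 * (\<integral>z. F z \<partial>J)) < e"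
      using eventually_gt_at_top[of 0]
    proof eventually_elim
      case (elim \<beta>)
      have "\<bar>(\<integral>z. F z \<partial>\<sigma> \<beta>) - (\<integral>z. Q z \<partial>\<sigma> \<beta>)\<bar> \<le> (\<integral>z. R z \<partial>\<sigma> \<beta>)"
        using QR F elim by (intro diff) (auto simp: jump_limitD measurable_\<sigma>)
      then have "\<beta> * \<bar>(\<integral>z. F z \<partial>\<sigma> \<beta>) - (\<integral>z. Q z \<partial>\<sigma> \<beta>)\<bar> \<le> \<beta> * (\<integral>z. R z \<partial>\<sigma> \<beta>)"
        using elim by (intro mult_left_mono) auto
      then have "\<bar>\<beta> * (\<integral>z. F z \<partial>\<sigma> \<beta>) - \<beta> * (\<integral>z. Q z \<partial>\<sigma> \<beta>)\<bar> \<le> \<beta> * (\<integral>z. R z \<partial>\<sigma> \<beta>)"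
        using elim by (simp add: right_diff_distrib[symmetric] abs_mult)
      moreover have "\<bar>a - 2 * b\<bar> < e" if "\<bar>a - q\<bar> \<le> r" "\<bar>q - 2 * q'\<bar> < \<epsilon>" "\<bar>r - 2 * r'\<bar> < \<epsilon>" "\<bar>b - q'\<bar> \<le> r'" "r' \<le> \<epsilon>"
        for a b q q' r r' :: real
        using that unfolding \<epsilon>_def by (simp add: abs_if split: if_splits)
      ultimately show ?case
        using elim J QR(4) unfolding dist_real_def by blast
    qed
  qed
  then show ?thesis
    unfolding jump_limit_def using F QR0 int[of _ Q0 R0]
    by (auto simp: jump_limitD measurable_J measurable_\<sigma>)
qed

text \<open>Products of functions with disjoint supports are the test functions for which the
  behaviour of E is known: J alone determines E on them.\<close>

inductive tensor_span :: "((real^'n) \<times> (real^'n) \<Rightarrow> real) \<Rightarrow> bool" where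
  tensor: "f \<in> C0inf U \<Longrightarrow> g \<in> C0inf U \<Longrightarrow> tsupp f \<inter> tsupp g = {} \<Longrightarrow>
    tensor_span (\<lambda>z. f (fst z) * g (snd z))"
| plus: "tensor_span F \<Longrightarrow> tensor_span H \<Longrightarrow> tensor_span (\<lambda>z. F z + H z)"

lemma integrable_\<sigma>_tensor:
  assumes "\<beta> > 0" "f \<in> C0inf U" "g \<in> C0inf U"
  shows "integrable (\<sigma> \<beta>) (\<lambda>z. f (fst z) * g (snd z))"
proof -
  obtain A B where AB: "\<And>x. \<bar>f x\<bar> \<le> A" "\<And>x. \<bar>g x\<bar> \<le> B" "A > 0"
    using C0inf_bounded[OF assms(2)] C0inf_bounded[OF assms(3)] by metis
  show ?thesis
  proof (rule radon_on_integrable_compact[OF radon_\<sigma>[OF assms(1)], of "tsupp f \<times> tsupp g" _ "A * B"])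
    show "compact (tsupp f \<times> tsupp g)" "tsupp f \<times> tsupp g \<subseteq> U \<times> U"
      using assms C0infD(2,3) by (auto intro!: compact_Times) blast+
    show "(\<lambda>z. f (fst z) * g (snd z)) \<in> borel_measurable borel"
      using assms by (intro borel_measurable_continuous_onI continuous_on_mult
        continuous_on_compose2[OF C0infD(4)[of _ U UNIV]] continuous_intros) auto
    show "\<bar>f (fst z) * g (snd z)\<bar> \<le> A * B" for z
      unfolding abs_mult using AB by (intro mult_mono) auto
    show "f (fst z) * g (snd z) = 0" if "z \<notin> tsupp f \<times> tsupp g" for z
      using that zero_outside_tsupp[of "fst z" f] zero_outside_tsupp[of "snd z" g] by (auto simp: mem_Times_iff)
  qed
qed

text \<open>Disjoint supports make the L2 inner product vanish, so the approximation of E consists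
  of the kernel integral alone, and \<open>jump\<close> evaluates its limit.\<close>

lemma tensor_span_properties:
  assumes "tensor_span F"
  shows "jump_limit F \<and> continuous_on UNIV F \<and> (\<exists>C. compact C \<and> (\<forall>z. z \<notin> C \<longrightarrow> F z = 0))"
  using assms
proof induction
  case (tensor f g)
  let ?F = "\<lambda>z. f (fst z) * g (snd z)" and ?S = "tsupp f \<times> tsupp g"
  have S: "compact ?S" "?S \<subseteq> offdiag U"
    using tensor C0infD(2,3) by (auto intro!: compact_Times simp: offdiag_def) blast+
  have cont: "continuous_on UNIV ?F"
    using tensor by (intro continuous_on_mult continuous_on_compose2[OF C0infD(4)[of _ U UNIV]] continuous_intros) auto
  have zero: "?F z = 0" if "z \<notin> ?S" for z
    using that zero_outside_tsupp[of "fst z" f] zero_outside_tsupp[of "snd z" g] by (auto simp: mem_Times_iff)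
  have "bounded (?F ` ?S)"
    using cont S by (intro compact_imp_bounded compact_continuous_image) (auto intro: continuous_on_subset)
  then obtain B where B': "\<And>y. y \<in> ?F ` ?S \<Longrightarrow> norm y \<le> B"
    unfolding bounded_iff by blast
  have B: "\<bar>?F z\<bar> \<le> B" if "z \<in> ?S" for z
    using B'[OF imageI[OF that]] by simp
  have meas: "?F \<in> borel_measurable borel"
    using cont by (rule borel_measurable_continuous_onI)
  have int: "integrable J ?F"
    by (rule radon_on_integrable_compact[OF radon_J S meas B zero])
  have ip0: "ip m f g = 0"
  proof -
    have zero: "f x * g x = 0" for x
      using tensor(3) zero_outside_tsupp[of x f] zero_outside_tsupp[of x g] by (cases "x \<in> tsupp f") auto
    show ?thesis
      unfolding ip_def zero by simp
  qed
  have "((\<lambda>\<beta>. - (\<beta> * (ip m f g - (\<integral>z. ?F z \<partial>\<sigma> \<beta>)))) \<longlongrightarrow> - E f g) at_top"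
    using tensor by (intro tendsto_minus approx)
  then have "((\<lambda>\<beta>. \<beta> * (\<integral>z. ?F z \<partial>\<sigma> \<beta>)) \<longlongrightarrow> 2 * (\<integral>z. ?F z \<partial>J)) at_top"
    using jump[OF tensor] by (simp add: ip0)
  then have "jump_limit ?F"
    using tensor int meas by (auto simp: jump_limit_def intro: integrable_\<sigma>_tensor)
  then show ?case
    using cont S(1) zero by blast
next
  case (plus F H)
  then obtain C C' where "compact C" "compact C'" "\<forall>z. z \<notin> C \<longrightarrow> F z = 0" "\<forall>z. z \<notin> C' \<longrightarrow> H z = 0"
    by blast
  then have "compact (C \<union> C') \<and> (\<forall>z. z \<notin> C \<union> C' \<longrightarrow> F z + H z = 0)"
    by auto
  then show ?case
    using plus.IH jump_limit_add by (auto intro: continuous_on_add)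
qed

lemma tensor_span_mult_smooth:
  assumes "tensor_span F" "smooth_fun a" "smooth_fun b"
  shows "tensor_span (\<lambda>z. a (fst z) * b (snd z) * F z)"
  using assms(1)
proof induction
  case (tensor f g)
  have "tsupp (\<lambda>x. a x * f x) \<subseteq> tsupp f" "tsupp (\<lambda>x. b x * g x) \<subseteq> tsupp g"
    by (rule tsupp_minimal[OF closed_tsupp], simp add: zero_outside_tsupp)+
  then have "tensor_span (\<lambda>z. (a (fst z) * f (fst z)) * (b (snd z) * g (snd z)))"
    using tensor assms(2,3) by (intro tensor_span.tensor[of "\<lambda>x. a x * f x" "\<lambda>x. b x * g x"] C0inf_mult_left) auto
  then show ?case
    by (simp add: mult_ac)
next
  case (plus F H)
  then show ?case
    using tensor_span.plus[OF plus.IH] by (simp add: algebra_simps)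
qed

text \<open>A linear functional on the product space is a function of x plus a function of y, and
  multiplication by either respects products and does not enlarge supports. Sums and products of
  polynomials follow by induction.\<close>

lemma tensor_span_mult_polynomial:
  assumes "real_polynomial_function q" "tensor_span F"
  shows "tensor_span (\<lambda>z. q z * F z)"
  using assms
proof (induction arbitrary: F)
  case (linear f)
  interpret f: bounded_linear f by (rule linear(1))
  have a: "smooth_fun (\<lambda>x. f (x, 0))" and b: "smooth_fun (\<lambda>y. f (0, y))"
    by (auto intro!: smooth_fun_linear bounded_linear_compose[OF linear(1)] bounded_linear_Pair
      bounded_linear_ident bounded_linear_zero)
  have eq: "f z = f (fst z, 0) * 1 + 1 * f (0, snd z)" for z
    using f.add[of "(fst z, 0)" "(0, snd z)"] by simp
  have "(\<lambda>z. f z * F z) = (\<lambda>z. (f (fst z, 0) * 1) * F z + (1 * f (0, snd z)) * F z)"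
    by (rule ext) (subst eq, simp only: distrib_right)
  moreover have "tensor_span (\<lambda>z. (f (fst z, 0) * 1) * F z + (1 * f (0, snd z)) * F z)"
    by (intro tensor_span.plus tensor_span_mult_smooth[OF linear(2), of "\<lambda>x. f (x, 0)" "\<lambda>y. 1"]
      tensor_span_mult_smooth[OF linear(2), of "\<lambda>y. 1" "\<lambda>y. f (0, y)"] a b smooth_fun_const)
  ultimately show ?case by simp
next
  case (const c)
  then show ?case
    using tensor_span_mult_smooth[OF const smooth_fun_const[of c] smooth_fun_const[of 1]] by simp
next
  case (add f g)
  then show ?case
    using tensor_span.plus[OF add.IH(1)[OF add.prems] add.IH(2)[OF add.prems]] by (simp add: distrib_right)
next
  case (mult f g)
  then show ?case
    using mult.IH(1)[OF mult.IH(2)[OF mult.prems]] by (simp add: mult.assoc)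
qed

lemma tensor_span_sum:
  assumes "finite I" "\<And>i. i \<in> I \<Longrightarrow> tensor_span (F i)"
  shows "tensor_span (\<lambda>z. \<Sum>i\<in>I. F i z)"
  using assms
proof (induction I rule: finite_induct)
  case empty
  have "tsupp (\<lambda>x. 0::real) = {}"
    by (simp add: tsupp_def)
  then show ?case
    using tensor_span.tensor[OF C0inf_zero C0inf_zero] by simp
next
  case (insert i I)
  then show ?case
    using tensor_span.plus[of "F i" "\<lambda>z. \<Sum>i\<in>I. F i z"] by simp
qed

text \<open>Around a point off the diagonal, cutoff functions of two disjoint neighbourhoods form a
  product in the span that equals 1 near the point. Finitely many of these cover S.\<close>

lemma tensor_span_majorant:
  assumes S: "compact S" "S \<subseteq> offdiag U"
  obtains P where "tensor_span P" "\<And>z. 0 \<le> P z" "\<And>z. z \<in> S \<Longrightarrow> 1 \<le> P z"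
proof -
  have "\<exists>f g V W. f \<in> C0inf U \<and> g \<in> C0inf U \<and> tsupp f \<inter> tsupp g = {} \<and> (\<forall>x. 0 \<le> f x) \<and> (\<forall>x. 0 \<le> g x) \<and>
      open V \<and> open W \<and> z \<in> V \<times> W \<and> (\<forall>x\<in>V. f x = 1) \<and> (\<forall>x\<in>W. g x = 1)" if z: "z \<in> S" for z
  proof -
    obtain a b where ab: "z = (a, b)" "a \<in> U" "b \<in> U" "a \<noteq> b"
      using z S(2) by (auto simp: offdiag_def)
    obtain A B where AB: "open A" "open B" "a \<in> A" "b \<in> B" "A \<inter> B = {}"
      using hausdorff[OF ab(4)] by blast
    obtain f V where f: "f \<in> C0inf (A \<inter> U)" "\<And>x. 0 \<le> f x" "open V" "{a} \<subseteq> V" "\<And>x. x \<in> V \<Longrightarrow> f x = 1"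
      using cutoff_exists[of "{a}" "A \<inter> U"] AB ab open_U by (metis Int_iff compact_sing empty_subsetI insert_subset open_Int)
    obtain g W where g: "g \<in> C0inf (B \<inter> U)" "\<And>x. 0 \<le> g x" "open W" "{b} \<subseteq> W" "\<And>x. x \<in> W \<Longrightarrow> g x = 1"
      using cutoff_exists[of "{b}" "B \<inter> U"] AB ab open_U by (metis Int_iff compact_sing empty_subsetI insert_subset open_Int)
    have "f \<in> C0inf U" "g \<in> C0inf U" "tsupp f \<inter> tsupp g = {}"
      using f(1) g(1) AB C0inf_mono[of "A \<inter> U" U] C0inf_mono[of "B \<inter> U" U] C0infD(3)[OF f(1)] C0infD(3)[OF g(1)] by auto
    then show ?thesis
      using f g ab(1) by (intro exI[of _ f] exI[of _ g] exI[of _ V] exI[of _ W]) auto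
  qed
  then obtain f g V W where fg: "\<And>z. z \<in> S \<Longrightarrow> f z \<in> C0inf U \<and> g z \<in> C0inf U \<and> tsupp (f z) \<inter> tsupp (g z) = {} \<and>
      (\<forall>x. 0 \<le> f z x) \<and> (\<forall>x. 0 \<le> g z x) \<and> open (V z) \<and> open (W z) \<and> z \<in> V z \<times> W z \<and>
      (\<forall>x\<in>V z. f z x = 1) \<and> (\<forall>x\<in>W z. g z x = 1)"
    by metis
  obtain I where I: "I \<subseteq> S" "finite I" "S \<subseteq> (\<Union>z\<in>I. V z \<times> W z)"
  proof (rule compactE_image[OF S(1), of S "\<lambda>z. V z \<times> W z"])
    show "S \<subseteq> (\<Union>z\<in>S. V z \<times> W z)"
      using fg by blast
  qed (use that fg in \<open>auto intro: open_Times\<close>)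
  define P where "P z = (\<Sum>i\<in>I. f i (fst z) * g i (snd z))" for z
  show ?thesis
  proof (rule that)
    show "tensor_span P"
      unfolding P_def
    proof (intro tensor_span_sum I(2))
      fix i assume "i \<in> I"
      then have "i \<in> S"
        using I(1) by blast
      from fg[OF this] show "tensor_span (\<lambda>z. f i (fst z) * g i (snd z))"
        by (intro tensor_span.tensor) simp_all
    qed
    show nn: "0 \<le> P z" for z
      unfolding P_def using I fg by (intro sum_nonneg mult_nonneg_nonneg) auto
    show "1 \<le> P z" if "z \<in> S" for z
    proof -
      obtain i where i: "i \<in> I" "z \<in> V i \<times> W i"
        using I \<open>z \<in> S\<close> by blast
      have "f i (fst z) * g i (snd z) \<le> P z"
        unfolding P_def using I fg i(1) by (intro member_le_sum mult_nonneg_nonneg) auto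
      moreover have "f i (fst z) = 1" "g i (snd z) = 1"
        using i fg[of i] I by (auto simp: mem_Times_iff)
      ultimately show ?thesis by simp
    qed
  qed
qed

text \<open>F / P is uniformly approximated by polynomials, and multiplication by polynomials preserves the span of the products.\<close>

lemma jump_limit_compact_support:
  assumes F: "continuous_on UNIV F" and S: "compact S" "S \<subseteq> offdiag U" "\<And>z. z \<notin> S \<Longrightarrow> F z = 0"
  shows "jump_limit F"
proof -
  obtain P where P: "tensor_span P" "\<And>z. 0 \<le> P z" "\<And>z. z \<in> S \<Longrightarrow> 1 \<le> P z"
    using tensor_span_majorant[OF S(1,2)] by blast
  have Plim: "jump_limit P" and Pc: "continuous_on UNIV P"
    using tensor_span_properties[OF P(1)] by auto
  obtain C where C: "compact C" "\<And>z. z \<notin> C \<Longrightarrow> P z = 0"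
    using tensor_span_properties[OF P(1)] by auto
  \<comment> \<open>Dividing by the maximum of P and 1 keeps h continuous on all of C; on S it is F
    / P, because P is at least 1 there.\<close>
  define h where "h z = F z / max (P z) 1" for z
  have hc: "continuous_on C h"
    unfolding h_def using continuous_on_subset[OF F] continuous_on_subset[OF Pc]
    by (intro continuous_intros) (auto simp: max_def)
  have hP: "F z = h z * P z" for z
    using P(3)[of z] S(3)[of z] by (cases "z \<in> S") (auto simp: h_def max_def)
  show ?thesis
  proof (rule jump_limit_sandwich)
    show "F \<in> borel_measurable borel"
      using F by (rule borel_measurable_continuous_onI)
    fix \<epsilon> :: real assume \<epsilon>: "\<epsilon> > 0"
    define I where "I = (\<integral>z. P z \<partial>J)"
    have I: "I \<ge> 0"
      unfolding I_def using P(2) by (intro Bochner_Integration.integral_nonneg)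
    \<comment> \<open>Adding 1 avoids division by zero when P has J-integral 0.\<close>
    define e where "e = \<epsilon> / (I + 1)"
    have e: "e > 0"
      using \<epsilon> I by (simp add: e_def)
    obtain q where q: "real_polynomial_function q" "\<And>z. z \<in> C \<Longrightarrow> \<bar>h z - q z\<bar> < e"
      using Stone_Weierstrass_real_polynomial_function[OF C(1) hc e] by blast
    have "\<bar>F z - q z * P z\<bar> \<le> e * P z" for z
    proof (cases "z \<in> C")
      case True
      have "F z - q z * P z = (h z - q z) * P z"
        by (simp add: hP left_diff_distrib)
      then show ?thesis
        using q(2)[OF True] P(2)[of z] by (auto simp: abs_mult intro!: mult_right_mono)
    qed (use C hP in auto)
    moreover have "jump_limit (\<lambda>z. q z * P z)"
      using tensor_span_properties[OF tensor_span_mult_polynomial[OF q(1) P(1)]] by blast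
    moreover have "jump_limit (\<lambda>z. e * P z)"
      by (rule jump_limit_scale[OF Plim])
    moreover have "(\<integral>z. e * P z \<partial>J) \<le> \<epsilon>"
      using I \<epsilon> by (simp add: I_def[symmetric] e_def field_simps)
    ultimately show "\<exists>Q R. jump_limit Q \<and> jump_limit R \<and> (\<forall>z. \<bar>F z - Q z\<bar> \<le> R z) \<and> (\<integral>z. R z \<partial>J) \<le> \<epsilon>"
      by (intro exI[of _ "\<lambda>z. q z * P z"] exI[of _ "\<lambda>z. e * P z"]) auto
  qed
qed

end

text \<open>Fatou's lemma, in the form that yields integrability of the limit.\<close>

lemma integrable_of_bounded_limit:
  fixes f :: "'a \<Rightarrow> real"
  assumes "\<And>n. integrable M (F n)" "\<And>n x. 0 \<le> F n x" "\<And>n. (\<integral>x. F n x \<partial>M) \<le> C"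
    and "f \<in> borel_measurable M" "AE x in M. (\<lambda>n. F n x) \<longlonglongrightarrow> f x"
  shows "integrable M f"
proof -
  have nn: "AE x in M. 0 \<le> f x"
    using assms(5)
  proof eventually_elim
    case (elim x)
    then show ?case
      using assms(2) by (intro LIMSEQ_le_const) auto
  qed
  have "(\<integral>\<^sup>+x. ennreal (f x) \<partial>M) = (\<integral>\<^sup>+x. liminf (\<lambda>n. ennreal (F n x)) \<partial>M)"
  proof (rule nn_integral_cong_AE)
    show "AE x in M. ennreal (f x) = liminf (\<lambda>n. ennreal (F n x))"
      using assms(5)
    proof eventually_elim
      case (elim x)
      then show ?case
        using lim_imp_Liminf[OF sequentially_bot tendsto_ennrealI] by metis
    qed
  qed
  also have "\<dots> \<le> liminf (\<lambda>n. \<integral>\<^sup>+x. ennreal (F n x) \<partial>M)"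
    using assms(1) by (intro nn_integral_liminf) auto
  also have "\<dots> \<le> limsup (\<lambda>n. \<integral>\<^sup>+x. ennreal (F n x) \<partial>M)"
    by (intro Liminf_le_Limsup sequentially_bot)
  also have "\<dots> \<le> ennreal C"
  proof (intro Limsup_bounded always_eventually allI)
    fix n
    have "(\<integral>\<^sup>+x. ennreal (F n x) \<partial>M) = ennreal (\<integral>x. F n x \<partial>M)"
      using assms(1,2) by (intro nn_integral_eq_integral) auto
    then show "(\<integral>\<^sup>+x. ennreal (F n x) \<partial>M) \<le> ennreal C"
      using assms(3)[of n] by (simp add: ennreal_leI)
  qed
  finally have "(\<integral>\<^sup>+x. ennreal (f x) \<partial>M) < \<infinity>"
    by (simp add: le_less_trans[OF _ ennreal_less_top])
  then show ?thesis
    using assms(4) nn by (intro integrableI_nonneg)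
qed

section \<open>Test functions with discontinuities on a null set\<close>

context approximated_form
begin

lemma small_majorant:
  assumes N: "compact N" "N \<subseteq> offdiag U" "emeasure J N = 0" and \<epsilon>: "\<epsilon> > 0"
  obtains R where "jump_limit R" "continuous_on UNIV R" "\<And>z. 0 \<le> R z" "\<And>z. R z \<le> 1"
    "\<And>z. z \<in> N \<Longrightarrow> R z = 1" "(\<integral>z. R z \<partial>J) \<le> \<epsilon>"
proof (cases "N = {}")
  case True
  have "jump_limit (\<lambda>z. 0)"
    by (rule jump_limit_compact_support[of _ "{}"]) auto
  then show ?thesis
    using that[of "\<lambda>z. 0"] True \<epsilon> by auto
next
  case False
  obtain r where r: "r > 0" "(\<Union>z\<in>N. cball z r) \<subseteq> offdiag U"
    using compact_subset_open_imp_cball_epsilon_subset[OF N(1) open_offdiag[OF open_U] N(2)] by blast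
  \<comment> \<open>These neighbourhoods of N are compact subsets of the off-diagonal set, hence of
    finite J-mass, and decrease to N. Continuity from above makes their mass small.\<close>
  define K where "K n = {z. infdist z N \<le> r / real (Suc n)}" for n
  have K_compact: "compact (K n)" for n
    unfolding K_def using N(1) False r by (intro compact_infdist_le) auto
  have K_sub: "K n \<subseteq> offdiag U" for n
  proof
    fix z assume "z \<in> K n"
    then have "infdist z N \<le> r / real (Suc n)"
      by (simp add: K_def)
    also have "\<dots> \<le> r"
      using r(1) by (simp add: field_simps)
    finally have "infdist z N \<le> r" .
    moreover obtain y where "y \<in> N" "infdist z N = dist z y"
      using infdist_attains_inf[OF compact_imp_closed[OF N(1)] False] by blast
    ultimately have "z \<in> (\<Union>z\<in>N. cball z r)"
      by (auto simp: dist_commute)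
    then show "z \<in> offdiag U"
      using r(2) by blast
  qed
  have fin: "emeasure J (K n) < \<infinity>" for n
    using radon_J K_compact K_sub by (simp add: radon_on_def)
  have "(\<lambda>n. emeasure J (K n)) \<longlonglongrightarrow> emeasure J (\<Inter>n. K n)"
  proof (rule Lim_emeasure_decseq)
    show "range K \<subseteq> sets J"
      using K_compact by (auto simp: sets_J borel_compact)
    show "decseq K"
    proof (rule decseq_SucI)
      fix n
      have "r / real (Suc (Suc n)) \<le> r / real (Suc n)"
        using r(1) by (intro divide_left_mono) auto
      then show "K (Suc n) \<subseteq> K n"
        unfolding K_def by auto
    qed
  qed (use fin in \<open>auto simp: less_top[symmetric]\<close>)
  moreover have "(\<Inter>n. K n) = N"
  proof
    show "(\<Inter>n. K n) \<subseteq> N"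
    proof
      fix z assume "z \<in> (\<Inter>n. K n)"
      then have "infdist z N \<le> r * inverse (real (Suc n))" for n
        by (auto simp: K_def divide_inverse)
      moreover have "(\<lambda>n. r * inverse (real (Suc n))) \<longlonglongrightarrow> r * 0"
        by (intro tendsto_intros LIMSEQ_inverse_real_of_nat)
      ultimately have "infdist z N \<le> 0"
        by (intro LIMSEQ_le_const) auto
      then have "infdist z N = 0"
        using infdist_nonneg[of z N] by simp
      then show "z \<in> N"
        using in_closed_iff_infdist_zero[OF compact_imp_closed[OF N(1)] False] by simp
    qed
    show "N \<subseteq> (\<Inter>n. K n)"
      using r(1) by (auto simp: K_def)
  qed
  ultimately have "(\<lambda>n. emeasure J (K n)) \<longlonglongrightarrow> 0"
    using N(3) by simp
  then have "\<forall>\<^sub>F n in sequentially. emeasure J (K n) < ennreal \<epsilon>"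
    using \<epsilon> by (intro order_tendstoD(2)) auto
  then obtain n where n: "emeasure J (K n) < ennreal \<epsilon>"
    by (auto simp: eventually_sequentially)
  \<comment> \<open>The slope is chosen so that the tent function reaches 0 at distance r / (n + 1),
    the radius of K n.\<close>
  define R where "R z = max 0 (1 - real (Suc n) / r * infdist z N)" for z
  have Rc: "continuous_on UNIV R"
    unfolding R_def by (intro continuous_intros)
  have R_out: "R z = 0" if "z \<notin> K n" for z
    using that r(1) by (auto simp: R_def K_def field_simps)
  have R_le: "R z \<le> 1" for z
    using r(1) infdist_nonneg[of z N] by (auto simp: R_def)
  have Rlim: "jump_limit R"
    by (rule jump_limit_compact_support[OF Rc K_compact K_sub R_out])
  show ?thesis
  proof (rule that[OF Rlim Rc])
    show "0 \<le> R z" for z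
      by (simp add: R_def)
    show "R z = 1" if "z \<in> N" for z
      using that by (simp add: R_def)
    have Ks: "K n \<in> sets J"
      using K_compact by (auto simp: sets_J borel_compact)
    have "(\<integral>z. R z \<partial>J) \<le> (\<integral>z. indicator (K n) z \<partial>J)"
    proof (rule integral_mono[OF jump_limitD(3)[OF Rlim]])
      show "integrable J (indicator (K n) :: _ \<Rightarrow> real)"
        using Ks fin[of n] by simp
      show "R z \<le> indicator (K n) z" for z
        using R_out R_le by (simp add: indicator_def)
    qed
    also have "\<dots> = measure J (K n)"
      using Ks sets.sets_into_space[OF Ks] by (simp add: Int_absorb2)
    also have "\<dots> \<le> \<epsilon>"
      unfolding measure_def using n \<epsilon> by (intro enn2real_leI) auto
    finally show "(\<integral>z. R z \<partial>J) \<le> \<epsilon>" .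
  qed (rule R_le)
qed

text \<open>Let R equal 1 on the frontier of B and have small J-integral. Multiplying the indicator
  by 1 - R removes its discontinuities, so the product with g is a continuous test function, and the
  error is at most a multiple of R.\<close>

lemma jump_limit_indicator:
  assumes g: "continuous_on UNIV g" and B: "B \<in> sets borel" "compact (closure B)" "closure B \<subseteq> offdiag U"
    and null: "emeasure J (frontier B) = 0"
  shows "jump_limit (\<lambda>z. g z * indicator B z)"
proof (rule jump_limit_sandwich)
  show "(\<lambda>z. g z * indicator B z) \<in> borel_measurable borel"
    using g B(1) by (intro borel_measurable_times borel_measurable_continuous_onI borel_measurable_indicator)
  have "compact (g ` closure B)"
    using g B(2) by (intro compact_continuous_image) (auto intro: continuous_on_subset)
  then obtain M where M: "M > 0" "\<And>y. y \<in> g ` closure B \<Longrightarrow> norm y \<le> M"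
    using compact_imp_bounded bounded_pos by metis
  have gM: "\<bar>g z\<bar> \<le> M" if "z \<in> closure B" for z
    using M(2)[OF imageI[OF that]] by simp
  fix \<epsilon> :: real assume "\<epsilon> > 0"
  then have "\<epsilon> / M > 0"
    using M(1) by simp
  have N: "compact (frontier B)" "frontier B \<subseteq> offdiag U"
    using B by (auto simp: frontier_def compact_diff)
  obtain R where R: "jump_limit R" "continuous_on UNIV R" "\<And>z. 0 \<le> R z" "\<And>z. R z \<le> 1"
    "\<And>z. z \<in> frontier B \<Longrightarrow> R z = 1" "(\<integral>z. R z \<partial>J) \<le> \<epsilon> / M"
    using small_majorant[OF N null \<open>\<epsilon> / M > 0\<close>] by blast
  define h where "h z = indicator B z * (1 - R z)" for z
  have hc: "isCont h z" for z
  proof -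
    have R1: "continuous_on UNIV (\<lambda>z. 1 - R z)"
      by (intro continuous_intros R)
    consider "z \<in> interior B" | "z \<in> - closure B" | "z \<in> frontier B"
      by (auto simp: frontier_def)
    then show ?thesis
    proof cases
      case 1
      have "continuous_on (interior B) h"
        by (rule continuous_on_eq[OF continuous_on_subset[OF R1]])
          (use interior_subset in \<open>auto simp: h_def indicator_def\<close>)
      then show ?thesis
        using 1 by (simp add: continuous_on_eq_continuous_at)
    next
      case 2
      have "continuous_on (- closure B) h"
        by (rule continuous_on_eq[OF continuous_on_const[of _ 0]])
          (use closure_subset in \<open>auto simp: h_def indicator_def\<close>)
      then show ?thesis
        using 2 by (simp add: continuous_on_eq_continuous_at open_Compl)
    next
      case 3
      have "isCont (\<lambda>z. 1 - R z) z"
        using R1 continuous_on_eq_continuous_at[OF open_UNIV] by blast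
      then have lim: "((\<lambda>z. 1 - R z) \<longlongrightarrow> 0) (at z)"
        using R(5)[OF 3] by (simp add: isCont_def)
      have "\<forall>\<^sub>F y in at z. norm (h y) \<le> 1 - R y"
        using R(4) by (intro always_eventually) (auto simp: h_def indicator_def)
      then have "(h \<longlongrightarrow> 0) (at z)"
        using lim by (rule Lim_null_comparison)
      then show ?thesis
        using R(5)[OF 3] by (simp add: isCont_def h_def)
    qed
  qed
  have Q: "jump_limit (\<lambda>z. g z * h z)"
  proof (rule jump_limit_compact_support[OF _ B(2,3)])
    show "continuous_on UNIV (\<lambda>z. g z * h z)"
      using hc by (intro continuous_on_mult g continuous_at_imp_continuous_on) auto
    show "g z * h z = 0" if "z \<notin> closure B" for z
      using that closure_subset[of B] by (auto simp: h_def indicator_def)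
  qed
  have "\<bar>g z * indicator B z - g z * h z\<bar> \<le> M * R z" for z
  proof (cases "z \<in> B")
    case True
    then have "g z * indicator B z - g z * h z = g z * R z"
      by (simp add: h_def algebra_simps)
    moreover have "\<bar>g z\<bar> \<le> M"
      using gM True closure_subset by blast
    ultimately show ?thesis
      using R(3)[of z] by (simp add: abs_mult mult_right_mono)
  qed (use M R(3) in \<open>auto simp: h_def\<close>)
  moreover have "(\<integral>z. M * R z \<partial>J) \<le> \<epsilon>"
    using R(6) M(1) by (simp add: field_simps)
  ultimately show "\<exists>Q R. jump_limit Q \<and> jump_limit R \<and> (\<forall>z. \<bar>g z * indicator B z - Q z\<bar> \<le> R z) \<and> (\<integral>z. R z \<partial>J) \<le> \<epsilon>"
    using Q jump_limit_scale[OF R(1), of M]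
    by (intro exI[of _ "\<lambda>z. g z * h z"] exI[of _ "\<lambda>z. M * R z"]) auto
qed

section \<open>Local integrability of the squared distance\<close>

definition sq_weight :: "'n fn \<Rightarrow> (real^'n) \<times> (real^'n) \<Rightarrow> real" where
  "sq_weight \<theta> z = (dist (fst z) (snd z))\<^sup>2 * \<theta> (fst z) * \<theta> (snd z)"

text \<open>Expanding the square writes the weight as a combination of products f(x) g(y) whose
  L2 inner products cancel, so that its \<beta>-scaled integrals converge to values of E.\<close>

lemma sq_weight_limit:
  assumes \<theta>: "\<theta> \<in> C0inf U"
  obtains M where "((\<lambda>\<beta>. \<beta> * (\<integral>z. sq_weight \<theta> z \<partial>\<sigma> \<beta>)) \<longlongrightarrow> M) at_top"
    "\<And>\<beta>. \<beta> > 0 \<Longrightarrow> integrable (\<sigma> \<beta>) (sq_weight \<theta>)"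
proof -
  define f1 where "f1 i = (\<lambda>x. x $ i * \<theta> x)" for i :: 'n
  define f2 where "f2 i = (\<lambda>x. x $ i * (x $ i * \<theta> x))" for i :: 'n
  have f: "f1 i \<in> C0inf U" "f2 i \<in> C0inf U" for i
    unfolding f1_def f2_def by (intro C0inf_mult_left smooth_fun_component \<theta>)+
  define D where "D i z = f2 i (fst z) * \<theta> (snd z) + \<theta> (fst z) * f2 i (snd z) - 2 * (f1 i (fst z) * f1 i (snd z))" for i z
  have sq: "sq_weight \<theta> = (\<lambda>z. \<Sum>i\<in>UNIV. D i z)"
  proof
    fix z :: "(real^'n) \<times> (real^'n)"
    have "(dist (fst z) (snd z))\<^sup>2 = (\<Sum>i\<in>UNIV. (fst z $ i - snd z $ i)\<^sup>2)"
      unfolding dist_norm power2_norm_eq_inner inner_vec_def by (simp add: power2_eq_square)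
    then have "sq_weight \<theta> z = (\<Sum>i\<in>UNIV. (fst z $ i - snd z $ i)\<^sup>2 * \<theta> (fst z) * \<theta> (snd z))"
      by (simp add: sq_weight_def sum_distrib_right)
    also have "\<dots> = (\<Sum>i\<in>UNIV. D i z)"
      by (intro sum.cong) (auto simp: D_def f1_def f2_def power2_eq_square algebra_simps)
    finally show "sq_weight \<theta> z = (\<Sum>i\<in>UNIV. D i z)" .
  qed
  have intD: "integrable (\<sigma> \<beta>) (D i)" if "\<beta> > 0" for \<beta> i
    unfolding D_def using f \<theta> that
    by (intro Bochner_Integration.integrable_add Bochner_Integration.integrable_diff integrable_mult_right integrable_\<sigma>_tensor)
  define T where "T f g \<beta> = \<beta> * (ip m f g - (\<integral>z. f (fst z) * g (snd z) \<partial>\<sigma> \<beta>))" for f g :: "'n fn" and \<beta>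
  have T: "(T f g \<longlongrightarrow> E f g) at_top" if "f \<in> C0inf U" "g \<in> C0inf U" for f g
    unfolding T_def using approx[OF that] .
  have eq: "\<beta> * (\<integral>z. D i z \<partial>\<sigma> \<beta>) = 2 * T (f1 i) (f1 i) \<beta> - T (f2 i) \<theta> \<beta> - T \<theta> (f2 i) \<beta>" if "\<beta> > 0" for \<beta> i
  proof -
    have int: "(\<integral>z. D i z \<partial>\<sigma> \<beta>) = (\<integral>z. f2 i (fst z) * \<theta> (snd z) \<partial>\<sigma> \<beta>) + (\<integral>z. \<theta> (fst z) * f2 i (snd z) \<partial>\<sigma> \<beta>)
        - 2 * (\<integral>z. f1 i (fst z) * f1 i (snd z) \<partial>\<sigma> \<beta>)"
      unfolding D_def using that f \<theta>
      by (simp add: integrable_\<sigma>_tensor Bochner_Integration.integrable_add)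
    have ips: "ip m (f2 i) \<theta> = ip m (f1 i) (f1 i)" "ip m \<theta> (f2 i) = ip m (f1 i) (f1 i)"
      unfolding ip_def f1_def f2_def by (simp_all add: mult_ac)
    show ?thesis
      unfolding T_def int ips by (simp add: algebra_simps)
  qed
  let ?M = "\<Sum>i\<in>UNIV. (2 * E (f1 i) (f1 i) - E (f2 i) \<theta> - E \<theta> (f2 i))"
  have "((\<lambda>\<beta>. \<Sum>i\<in>UNIV. (2 * T (f1 i) (f1 i) \<beta> - T (f2 i) \<theta> \<beta> - T \<theta> (f2 i) \<beta>)) \<longlongrightarrow> ?M) at_top"
    by (intro tendsto_intros T f \<theta>)
  then have "((\<lambda>\<beta>. \<beta> * (\<integral>z. sq_weight \<theta> z \<partial>\<sigma> \<beta>)) \<longlongrightarrow> ?M) at_top"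
  proof (rule Lim_transform_eventually)
    show "\<forall>\<^sub>F \<beta> in at_top. (\<Sum>i\<in>UNIV. (2 * T (f1 i) (f1 i) \<beta> - T (f2 i) \<theta> \<beta> - T \<theta> (f2 i) \<beta>))
        = \<beta> * (\<integral>z. sq_weight \<theta> z \<partial>\<sigma> \<beta>)"
      using eventually_gt_at_top[of 0]
    proof eventually_elim
      case (elim \<beta>)
      have "\<beta> * (\<integral>z. sq_weight \<theta> z \<partial>\<sigma> \<beta>) = (\<Sum>i\<in>UNIV. \<beta> * (\<integral>z. D i z \<partial>\<sigma> \<beta>))"
        unfolding sq using intD[OF elim] by (simp add: sum_distrib_left)
      then show ?case
        using eq[OF elim] by simp
    qed
  qed
  moreover have "integrable (\<sigma> \<beta>) (sq_weight \<theta>)" if "\<beta> > 0" for \<beta>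
    unfolding sq using intD[OF that] by simp
  ultimately show ?thesis
    using that by blast
qed

lemma continuous_sq_weight:
  assumes "\<theta> \<in> C0inf U"
  shows "continuous_on UNIV (sq_weight \<theta>)"
  unfolding sq_weight_def
  by (intro continuous_intros continuous_on_compose2[OF C0infD(4)[OF assms, of UNIV]]) auto

text \<open>Truncations that vanish near the diagonal are test functions. Their integrals against
  \<open>\<sigma> \<beta>\<close> do not exceed those of the full weight, whose scaled limit is M,
  so twice their J-integrals are at most M. Letting the truncation tend to 1 off the diagonal is
  harmless on it, where the weight is 0.\<close>

lemma integrable_sq_weight:
  assumes \<theta>: "\<theta> \<in> C0inf U" "\<And>x. 0 \<le> \<theta> x"
  shows "integrable J (sq_weight \<theta>)"
proof -
  obtain M where M: "((\<lambda>\<beta>. \<beta> * (\<integral>z. sq_weight \<theta> z \<partial>\<sigma> \<beta>)) \<longlongrightarrow> M) at_top"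
    and int: "\<And>\<beta>. \<beta> > 0 \<Longrightarrow> integrable (\<sigma> \<beta>) (sq_weight \<theta>)"
    using sq_weight_limit[OF \<theta>(1)] by blast
  have nn: "0 \<le> sq_weight \<theta> z" for z
    using \<theta>(2) by (simp add: sq_weight_def)
  \<comment> \<open>The value is 0 up to distance 1/n and 1 from distance 2/n on.\<close>
  define \<phi> where "\<phi> n z = min 1 (max 0 (real n * dist (fst z) (snd z) - 1))" for n and z :: "(real^'n) \<times> (real^'n)"
  have \<phi>: "0 \<le> \<phi> n z" "\<phi> n z \<le> 1" for n z
    by (auto simp: \<phi>_def)
  have lim: "jump_limit (\<lambda>z. \<phi> n z * sq_weight \<theta> z)" for n
  proof (rule jump_limit_compact_support)
    let ?S = "(tsupp \<theta> \<times> tsupp \<theta>) \<inter> {z. 1 \<le> real n * dist (fst z) (snd z)}"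
    show "continuous_on UNIV (\<lambda>z. \<phi> n z * sq_weight \<theta> z)"
      unfolding \<phi>_def by (intro continuous_intros continuous_sq_weight \<theta>)
    show "compact ?S"
      by (intro compact_Int_closed compact_Times C0infD(2)[OF \<theta>(1)] closed_Collect_le continuous_intros)
    show "?S \<subseteq> offdiag U"
      using C0infD(3)[OF \<theta>(1)] by (auto simp: offdiag_def)
    show "\<phi> n z * sq_weight \<theta> z = 0" if "z \<notin> ?S" for z
    proof (cases "fst z \<in> tsupp \<theta> \<and> snd z \<in> tsupp \<theta>")
      case True
      then show ?thesis
        using that by (auto simp: \<phi>_def mem_Times_iff)
    next
      case False
      then show ?thesis
        using zero_outside_tsupp[of "fst z" \<theta>] zero_outside_tsupp[of "snd z" \<theta>] by (auto simp: sq_weight_def)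
    qed
  qed
  show ?thesis
  proof (rule integrable_of_bounded_limit[where F="\<lambda>n z. \<phi> n z * sq_weight \<theta> z" and C="M / 2"])
    show "integrable J (\<lambda>z. \<phi> n z * sq_weight \<theta> z)" for n
      using lim by (rule jump_limitD)
    show "0 \<le> \<phi> n z * sq_weight \<theta> z" for n z
      using \<phi> nn by simp
    show "(\<integral>z. \<phi> n z * sq_weight \<theta> z \<partial>J) \<le> M / 2" for n
    proof -
      have "2 * (\<integral>z. \<phi> n z * sq_weight \<theta> z \<partial>J) \<le> M"
      proof (rule tendsto_le[OF trivial_limit_at_top_linorder M jump_limitD(4)[OF lim]])
        show "\<forall>\<^sub>F \<beta> in at_top. \<beta> * (\<integral>z. \<phi> n z * sq_weight \<theta> z \<partial>\<sigma> \<beta>) \<le> \<beta> * (\<integral>z. sq_weight \<theta> z \<partial>\<sigma> \<beta>)"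
          using eventually_gt_at_top[of 0]
        proof eventually_elim
          case (elim \<beta>)
          have "(\<integral>z. \<phi> n z * sq_weight \<theta> z \<partial>\<sigma> \<beta>) \<le> (\<integral>z. sq_weight \<theta> z \<partial>\<sigma> \<beta>)"
            by (intro integral_mono jump_limitD(2)[OF lim elim] int elim mult_left_le_one_le nn \<phi>)
          then show ?case
            using elim by simp
        qed
      qed
      then show ?thesis by simp
    qed
    show "sq_weight \<theta> \<in> borel_measurable J"
      by (intro measurable_J borel_measurable_continuous_onI continuous_sq_weight \<theta>)
    have "(\<lambda>n. \<phi> n z * sq_weight \<theta> z) \<longlonglongrightarrow> sq_weight \<theta> z" for z
    proof (cases "fst z = snd z")
      case False
      then have "dist (fst z) (snd z) > 0" by simp
      then obtain N where N: "2 / dist (fst z) (snd z) < real N"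
        using reals_Archimedean2 by blast
      have "\<phi> n z = 1" if "n \<ge> N" for n
      proof -
        have "2 < real N * dist (fst z) (snd z)"
          using N \<open>dist _ _ > 0\<close> by (simp add: field_simps)
        also have "\<dots> \<le> real n * dist (fst z) (snd z)"
          using that by (intro mult_right_mono) auto
        finally show ?thesis
          by (simp add: \<phi>_def)
      qed
      then have "\<forall>\<^sub>F n in sequentially. sq_weight \<theta> z = \<phi> n z * sq_weight \<theta> z"
        by (auto simp: eventually_sequentially intro!: exI[of _ N])
      then show ?thesis
        by (rule Lim_transform_eventually[OF tendsto_const])
    qed (simp add: sq_weight_def)
    then show "AE z in J. (\<lambda>n. \<phi> n z * sq_weight \<theta> z) \<longlonglongrightarrow> sq_weight \<theta> z"
      by simp
  qed
qed

text \<open>Because u \<psi> = u, the truncated increment is a difference of two products of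
  compactly supported functions, each integrable on its own. Without the factor \<psi>(x) the term
  u(y) v(y) would have no compact support in x.\<close>

lemma integrable_\<sigma>_increment:
  assumes u: "u \<in> C0inf U" and v: "v \<in> C0inf U" and \<psi>: "\<psi> \<in> C0inf U" and "\<beta> > 0"
    and one: "\<And>x. x \<in> tsupp u \<union> tsupp v \<Longrightarrow> \<psi> x = 1"
  shows "integrable (\<sigma> \<beta>) (\<lambda>z. (u (snd z) - u (fst z)) * \<psi> (fst z) * v (snd z))"
    and "(\<integral>z. (u (snd z) - u (fst z)) * \<psi> (fst z) * v (snd z) \<partial>\<sigma> \<beta>) =
      (\<integral>z. \<psi> (fst z) * (u (snd z) * v (snd z)) \<partial>\<sigma> \<beta>) - (\<integral>z. u (fst z) * v (snd z) \<partial>\<sigma> \<beta>)"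
proof -
  have uv: "(\<lambda>x. u x * v x) \<in> C0inf U"
    using u v by (intro C0inf_mult_right C0infD(1))
  have "u x * \<psi> x = u x" for x
    using one[of x] zero_outside_tsupp[of x u] by (cases "x \<in> tsupp u") auto
  then have eq: "(\<lambda>z. (u (snd z) - u (fst z)) * \<psi> (fst z) * v (snd z)) =
      (\<lambda>z. \<psi> (fst z) * (u (snd z) * v (snd z)) - u (fst z) * v (snd z))"
    by (auto simp: fun_eq_iff left_diff_distrib)
  note int = integrable_\<sigma>_tensor[OF assms(4) \<psi> uv] integrable_\<sigma>_tensor[OF assms(4) u v]
  show "integrable (\<sigma> \<beta>) (\<lambda>z. (u (snd z) - u (fst z)) * \<psi> (fst z) * v (snd z))"
    unfolding eq using int by (rule Bochner_Integration.integrable_diff)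
  show "(\<integral>z. (u (snd z) - u (fst z)) * \<psi> (fst z) * v (snd z) \<partial>\<sigma> \<beta>) =
      (\<integral>z. \<psi> (fst z) * (u (snd z) * v (snd z)) \<partial>\<sigma> \<beta>) - (\<integral>z. u (fst z) * v (snd z) \<partial>\<sigma> \<beta>)"
    unfolding eq using int by (rule Bochner_Integration.integral_diff)
qed

lemma increment_limit:
  assumes u: "u \<in> C0inf U" and v: "v \<in> C0inf U" and \<psi>: "\<psi> \<in> C0inf U"
    and one: "\<And>x. x \<in> tsupp u \<union> tsupp v \<Longrightarrow> \<psi> x = 1"
  shows "((\<lambda>\<beta>. \<beta> * (\<integral>z. (u (snd z) - u (fst z)) * \<psi> (fst z) * v (snd z) \<partial>\<sigma> \<beta>))
    \<longlongrightarrow> E u v - E \<psi> (\<lambda>x. u x * v x)) at_top"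
proof -
  have uv: "(\<lambda>x. u x * v x) \<in> C0inf U"
    using u v by (intro C0inf_mult_right C0infD(1))
  have absorb: "\<psi> x * (u x * v x) = u x * v x" for x
    using one[of x] zero_outside_tsupp[of x u] by (cases "x \<in> tsupp u") auto
  have ip: "ip m \<psi> (\<lambda>x. u x * v x) = ip m u v"
    unfolding ip_def absorb ..
  have "((\<lambda>\<beta>. \<beta> * (ip m u v - (\<integral>z. u (fst z) * v (snd z) \<partial>\<sigma> \<beta>))
      - \<beta> * (ip m \<psi> (\<lambda>x. u x * v x) - (\<integral>z. \<psi> (fst z) * (u (snd z) * v (snd z)) \<partial>\<sigma> \<beta>)))
      \<longlongrightarrow> E u v - E \<psi> (\<lambda>x. u x * v x)) at_top"
    by (intro tendsto_diff approx u v \<psi> uv)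
  then show ?thesis
  proof (rule Lim_transform_eventually)
    show "\<forall>\<^sub>F \<beta> in at_top. \<beta> * (ip m u v - (\<integral>z. u (fst z) * v (snd z) \<partial>\<sigma> \<beta>))
      - \<beta> * (ip m \<psi> (\<lambda>x. u x * v x) - (\<integral>z. \<psi> (fst z) * (u (snd z) * v (snd z)) \<partial>\<sigma> \<beta>))
      = \<beta> * (\<integral>z. (u (snd z) - u (fst z)) * \<psi> (fst z) * v (snd z) \<partial>\<sigma> \<beta>)"
      using eventually_gt_at_top[of 0]
      by eventually_elim (simp only: ip integrable_\<sigma>_increment(2)[OF u v \<psi> _ one], simp add: algebra_simps)
  qed
qed

end

section \<open>The decomposition\<close>

lemma compact_if_closed_subset:
  fixes S :: "'a::t2_space set"
  assumes "compact S" "closed A" "A \<subseteq> S"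
  shows "compact A"
  using compact_Int_closed[OF assms(1,2)] assms(3) by (simp add: Int_absorb1)

text \<open>A ball is connected, so if it met both U and the complement it would meet the frontier,
  which stays at distance at least \<epsilon> from the centre.\<close>

lemma Udelta_ball_subset:
  assumes "y \<in> Udelta U \<delta>"
  obtains \<epsilon> where "\<epsilon> > \<delta>" "ball y \<epsilon> \<subseteq> U"
proof -
  obtain \<epsilon> where \<epsilon>: "y \<in> U" "\<epsilon> > \<delta>" "\<And>z. z \<in> frontier U \<Longrightarrow> \<epsilon> \<le> dist y z"
    using assms by (auto simp: Udelta_def)
  have "ball y \<epsilon> \<subseteq> U"
  proof (rule ccontr)
    assume not: "\<not> ball y \<epsilon> \<subseteq> U"
    then have "\<epsilon> > 0"
      by (metis ball_empty empty_subsetI not_less)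
    then have "y \<in> ball y \<epsilon> \<inter> U"
      using \<epsilon>(1) by simp
    moreover have "ball y \<epsilon> - U \<noteq> {}"
      using not by blast
    ultimately have "ball y \<epsilon> \<inter> frontier U \<noteq> {}"
      by (intro connected_Int_frontier connected_ball) blast+
    then show False
      using \<epsilon>(3) by fastforce
  qed
  then show ?thesis
    using that \<epsilon>(2) by blast
qed

text \<open>Compactness makes the excess over \<delta> uniform. A strict margin is needed because
  the radii \<open>\<delta>s k\<close> may lie above \<delta>.\<close>

lemma Udelta_compact_margin:
  fixes U :: "(real^'n::finite) set"
  assumes S: "compact S" "S \<subseteq> Udelta U \<delta>"
  obtains \<delta>' where "\<delta>' > \<delta>" "\<And>x y. y \<in> S \<Longrightarrow> dist x y \<le> \<delta>' \<Longrightarrow> x \<in> U"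
proof -
  have "\<exists>\<epsilon>>\<delta>. ball y \<epsilon> \<subseteq> U" if "y \<in> S" for y
    using Udelta_ball_subset[of y U \<delta>] S(2) that by blast
  then obtain \<epsilon> where \<epsilon>: "\<And>y. y \<in> S \<Longrightarrow> \<epsilon> y > \<delta>" "\<And>y. y \<in> S \<Longrightarrow> ball y (\<epsilon> y) \<subseteq> U"
    by metis
  obtain I where I: "I \<subseteq> S" "finite I" "S \<subseteq> (\<Union>y\<in>I. ball y ((\<epsilon> y - \<delta>) / 2))"
  proof (rule compactE_image[OF S(1), of S "\<lambda>y. ball y ((\<epsilon> y - \<delta>) / 2)"])
    show "S \<subseteq> (\<Union>y\<in>S. ball y ((\<epsilon> y - \<delta>) / 2))"
      using \<epsilon>(1) by force
  qed (use that in auto)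
  \<comment> \<open>With covering balls of radius (\<epsilon> - \<delta>)/2, adding the margin
    (\<epsilon> + \<delta>)/2 stays within radius \<epsilon>. The entry \<delta> + 1 keeps the set
    nonempty when S is empty.\<close>
  define \<delta>' where "\<delta>' = Min (insert (\<delta> + 1) ((\<lambda>y. (\<epsilon> y + \<delta>) / 2) ` I))"
  show ?thesis
  proof (rule that)
    show "\<delta>' > \<delta>"
    proof -
      have "\<delta> < (\<epsilon> y + \<delta>) / 2" if "y \<in> I" for y
        using \<epsilon>(1)[of y] that I(1) by auto
      then show ?thesis
        unfolding \<delta>'_def using I(2) by (subst Min_gr_iff) auto
    qed
    fix x y assume y: "y \<in> S" and d: "dist x y \<le> \<delta>'"
    obtain i where i: "i \<in> I" "dist i y < (\<epsilon> i - \<delta>) / 2"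
      using I(3) y by auto
    have "\<delta>' \<le> (\<epsilon> i + \<delta>) / 2"
      unfolding \<delta>'_def using I i by (intro Min_le) auto
    then have "x \<in> ball i (\<epsilon> i)"
      using dist_triangle[of i x y] i(2) d by (simp add: dist_commute field_simps)
    then show "x \<in> U"
      using \<epsilon>(2)[of i] i(1) I(1) by blast
  qed
qed

lemma compact_neighbourhood:
  fixes S :: "(real^'n::finite) set"
  assumes "compact S"
  shows "compact {x. \<exists>y\<in>S. dist x y \<le> r}"
proof -
  have "compact {a + b | a b. a \<in> S \<and> b \<in> cball 0 r}"
    by (intro compact_sums assms compact_cball)
  moreover have "{a + b | a b. a \<in> S \<and> b \<in> cball 0 r} = {x. \<exists>y\<in>S. dist x y \<le> r}"
  proof (intro set_eqI iffI)
    fix x assume "x \<in> {x. \<exists>y\<in>S. dist x y \<le> r}"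
    then obtain y where y: "y \<in> S" "dist x y \<le> r" by blast
    then have "x = y + (x - y)" "x - y \<in> cball 0 r"
      by (auto simp: dist_norm norm_minus_commute)
    with y(1) show "x \<in> {a + b | a b. a \<in> S \<and> b \<in> cball 0 r}"
      by blast
  qed (force simp: dist_norm)
  ultimately show ?thesis by simp
qed

text \<open>The continuous factor of \<open>drift\<close>; separating it confines the
  discontinuities of \<open>drift\<close> to the pairs at distance exactly r.\<close>

definition gradient_term :: "'n::finite fn \<Rightarrow> (real^'n) \<times> (real^'n) \<Rightarrow> real" where
  "gradient_term u z = (\<Sum>i\<in>UNIV. (snd z $ i - fst z $ i) * pd i u (snd z))"

lemma drift_eq: "drift u r z = (if dist (fst z) (snd z) \<le> r then gradient_term u z else 0)"
  by (simp add: drift_def gradient_term_def)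

section \<open>The compensated jump integrand\<close>

context approximated_form
begin

definition compensated :: "'n fn \<Rightarrow> 'n fn \<Rightarrow> 'n fn \<Rightarrow> real \<Rightarrow> (real^'n) \<times> (real^'n) \<Rightarrow> real" where
  "compensated \<psi> u v r z = ((u (snd z) - u (fst z)) * \<psi> (fst z) - drift u r z) * v (snd z)"

text \<open>Near the diagonal \<psi> is 1 and the drift is active, so Taylor's estimate gives a
  quadratic bound. At distance at least \<epsilon>, bounded quantities are absorbed by the squared
  distance over the squared \<epsilon>. The cutoff \<theta> is 1 wherever the integrand can be
  nonzero. The constant is the same for all radii from \<delta> to \<delta>', as dominated
  convergence in the radius requires.\<close>

lemma compensated_bound:
  assumes \<delta>: "0 < \<delta>" and u: "u \<in> C0inf U" and v: "v \<in> C0inf U" and \<psi>: "\<psi> \<in> C0inf U"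
    and W: "open W" "tsupp v \<subseteq> W" "\<And>x. x \<in> W \<Longrightarrow> \<psi> x = 1"
    and \<delta>': "\<delta>' > \<delta>" "\<And>x y. y \<in> tsupp v \<Longrightarrow> dist x y \<le> \<delta>' \<Longrightarrow> x \<in> U"
  obtains \<theta> C where "\<theta> \<in> C0inf U" "\<And>x. 0 \<le> \<theta> x" "C \<ge> 0"
    "\<And>r z. \<delta> \<le> r \<Longrightarrow> r \<le> \<delta>' \<Longrightarrow> \<bar>compensated \<psi> u v r z\<bar> \<le> C * sq_weight \<theta> z"
proof -
  define T where "T = {x. \<exists>y\<in>tsupp v. dist x y \<le> \<delta>'}"
  have "compact (T \<union> tsupp \<psi>)" "T \<union> tsupp \<psi> \<subseteq> U"
    unfolding T_def using \<delta>'(2) C0infD(2,3)[OF \<psi>]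
    by (auto intro!: compact_Un compact_neighbourhood C0infD(2)[OF v])
  then obtain \<theta> V where \<theta>: "\<theta> \<in> C0inf U" "\<And>x. 0 \<le> \<theta> x" "\<And>x. \<theta> x \<le> 1" "T \<union> tsupp \<psi> \<subseteq> V" "\<And>x. x \<in> V \<Longrightarrow> \<theta> x = 1"
    using cutoff_exists[OF _ open_U] by metis
  have \<theta>T: "\<theta> x = 1" if "y \<in> tsupp v" "dist x y \<le> \<delta>'" for x y
    using \<theta>(4,5) that by (auto simp: T_def)
  have \<theta>\<psi>: "\<theta> x = 1" if "\<psi> x \<noteq> 0" for x
    using \<theta>(4,5) that zero_outside_tsupp[of x \<psi>] by blast
  obtain \<epsilon>0 where \<epsilon>0: "\<epsilon>0 > 0" "(\<Union>y\<in>tsupp v. cball y \<epsilon>0) \<subseteq> W"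
    using compact_subset_open_imp_cball_epsilon_subset[OF C0infD(2)[OF v] W(1,2)] by blast
  \<comment> \<open>The bound by \<delta> guarantees that for distances below \<epsilon> the drift
    is not cut off, for any radius r \<ge> \<delta>.\<close>
  define \<epsilon> where "\<epsilon> = min \<epsilon>0 \<delta>"
  have \<epsilon>: "\<epsilon> > 0" "\<epsilon> \<le> \<delta>" "\<And>x y. y \<in> tsupp v \<Longrightarrow> dist x y < \<epsilon> \<Longrightarrow> \<psi> x = 1"
  proof -
    show "\<epsilon> > 0" "\<epsilon> \<le> \<delta>"
      using \<epsilon>0(1) \<delta> by (auto simp: \<epsilon>_def)
    fix x y assume "y \<in> tsupp v" "dist x y < \<epsilon>"
    then have "x \<in> (\<Union>y\<in>tsupp v. cball y \<epsilon>0)"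
      by (auto simp: \<epsilon>_def dist_commute intro!: bexI[of _ y])
    then show "\<psi> x = 1"
      using \<epsilon>0(2) W(3) by blast
  qed
  obtain Bu where Bu: "Bu > 0" "\<And>x. \<bar>u x\<bar> \<le> Bu"
    using C0inf_bounded[OF u] by blast
  obtain Bv where Bv: "Bv > 0" "\<And>x. \<bar>v x\<bar> \<le> Bv"
    using C0inf_bounded[OF v] by blast
  obtain Bp where Bp: "Bp > 0" "\<And>x. \<bar>\<psi> x\<bar> \<le> Bp"
    using C0inf_bounded[OF \<psi>] by blast
  obtain Ct where Ct: "Ct \<ge> 0" "\<And>z. \<bar>u (snd z) - u (fst z) - gradient_term u z\<bar> \<le> Ct * (dist (fst z) (snd z))\<^sup>2"
  proof (rule C0inf_taylor[OF u])
    fix C assume "C \<ge> 0" "\<And>x y. \<bar>u y - u x - (\<Sum>i\<in>UNIV. (y $ i - x $ i) * pd i u y)\<bar> \<le> C * (dist x y)\<^sup>2"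
    then show thesis
      using that[of C] by (simp add: gradient_term_def)
  qed
  \<comment> \<open>A bounds the truncated increment and B the drift at distance at least
    \<epsilon>. For B the gradient term is estimated by the increment plus the Taylor remainder, so
    no separate gradient bound is needed.\<close>
  define A where "A = 2 * Bu * Bp / \<epsilon>\<^sup>2"
  define B where "B = 2 * Bu / \<epsilon>\<^sup>2 + Ct"
  have AB: "A \<ge> 0" "B \<ge> 0"
    using Bu Bp Ct \<epsilon>(1) by (auto simp: A_def B_def)
  have sq_nonneg: "0 \<le> sq_weight \<theta> z" for z
    using \<theta>(2) by (simp add: sq_weight_def)
  show ?thesis
  proof (rule that[OF \<theta>(1,2)])
    show "(A + B + Ct) * Bv \<ge> 0"
      using AB Bv(1) Ct(1) by simp
    fix r and z :: "(real^'n) \<times> (real^'n)" assume r: "\<delta> \<le> r" "r \<le> \<delta>'"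
    let ?x = "fst z" and ?y = "snd z"
    let ?d = "dist ?x ?y"
    show "\<bar>compensated \<psi> u v r z\<bar> \<le> (A + B + Ct) * Bv * sq_weight \<theta> z"
    proof (cases "v ?y = 0")
      case True
      then show ?thesis
        using AB Bv(1) Ct(1) sq_nonneg[of z] by (simp add: compensated_def)
    next
      case False
      then have y: "?y \<in> tsupp v"
        using zero_outside_tsupp by blast
      have \<theta>y: "\<theta> ?y = 1"
        using \<theta>T[OF y, of ?y] \<delta> \<delta>'(1) by simp
      have du: "\<bar>u ?y - u ?x\<bar> \<le> 2 * Bu"
        using Bu(2)[of ?x] Bu(2)[of ?y] by linarith
      have main: "\<bar>(u ?y - u ?x) * \<psi> ?x - drift u r z\<bar> \<le> (A + B + Ct) * sq_weight \<theta> z"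
      proof (cases "?d < \<epsilon>")
        case True
        then have "\<psi> ?x = 1" "?d \<le> r" "?d \<le> \<delta>'"
          using \<epsilon>(2,3) y r by auto
        moreover from this have "\<theta> ?x = 1"
          using \<theta>T[OF y] by blast
        ultimately have "\<bar>(u ?y - u ?x) * \<psi> ?x - drift u r z\<bar> \<le> Ct * sq_weight \<theta> z"
          using Ct(2)[of z] \<theta>y by (simp add: drift_eq sq_weight_def)
        also have "\<dots> \<le> (A + B + Ct) * sq_weight \<theta> z"
          using AB by (intro mult_right_mono sq_nonneg) auto
        finally show ?thesis .
      next
        case False
        then have d1: "1 \<le> ?d\<^sup>2 / \<epsilon>\<^sup>2"
          using \<epsilon>(1) power_mono[of \<epsilon> ?d 2] by simp
        have 1: "\<bar>(u ?y - u ?x) * \<psi> ?x\<bar> \<le> A * sq_weight \<theta> z"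
        proof (cases "\<psi> ?x = 0")
          case True
          then show ?thesis using AB sq_nonneg by simp
        next
          case False
          have "\<bar>(u ?y - u ?x) * \<psi> ?x\<bar> \<le> 2 * Bu * Bp"
            unfolding abs_mult using du Bp Bu by (intro mult_mono) auto
          also have "\<dots> \<le> (2 * Bu * Bp) * (?d\<^sup>2 / \<epsilon>\<^sup>2)"
            using mult_left_mono[OF d1, of "2 * Bu * Bp"] Bu(1) Bp(1) by simp
          also have "\<dots> = A * sq_weight \<theta> z"
            using \<theta>y \<theta>\<psi>[OF False] by (simp add: A_def sq_weight_def)
          finally show ?thesis .
        qed
        have 2: "\<bar>drift u r z\<bar> \<le> B * sq_weight \<theta> z"
        proof (cases "?d \<le> r")
          case True
          then have "?d \<le> \<delta>'"
            using r(2) by simp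
          then have \<theta>x: "\<theta> ?x = 1"
            using \<theta>T[OF y] by blast
          have "\<bar>gradient_term u z\<bar> \<le> 2 * Bu + Ct * ?d\<^sup>2"
            using Ct(2)[of z] du by linarith
          also have "2 * Bu \<le> 2 * Bu * (?d\<^sup>2 / \<epsilon>\<^sup>2)"
            using mult_left_mono[OF d1, of "2 * Bu"] Bu(1) by simp
          finally have "\<bar>gradient_term u z\<bar> \<le> B * ?d\<^sup>2"
            by (simp add: B_def algebra_simps)
          then show ?thesis
            using True \<theta>x \<theta>y by (simp add: drift_eq sq_weight_def)
        qed (use AB sq_nonneg in \<open>auto simp: drift_eq\<close>)
        have "\<bar>(u ?y - u ?x) * \<psi> ?x - drift u r z\<bar> \<le> A * sq_weight \<theta> z + B * sq_weight \<theta> z"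
          using 1 2 by linarith
        also have "\<dots> \<le> (A + B + Ct) * sq_weight \<theta> z"
          using mult_nonneg_nonneg[OF Ct(1) sq_nonneg[of z]] by (simp add: distrib_right)
        finally show ?thesis .
      qed
      have "\<bar>compensated \<psi> u v r z\<bar> \<le> ((A + B + Ct) * sq_weight \<theta> z) * Bv"
        unfolding compensated_def abs_mult using main Bv AB Ct(1) sq_nonneg[of z] by (intro mult_mono) auto
      then show ?thesis
        by (simp add: mult_ac)
    qed
  qed
qed

lemma continuous_gradient_term:
  assumes "u \<in> C0inf U"
  shows "continuous_on UNIV (gradient_term u)"
  unfolding gradient_term_def
  by (intro continuous_intros continuous_on_compose2[OF C0infD(4)[OF C0inf_pd[OF assms], of UNIV]]) auto

lemma measurable_compensated:
  assumes u: "u \<in> C0inf U" and v: "v \<in> C0inf U" and \<psi>: "\<psi> \<in> C0inf U"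
  shows "compensated \<psi> u v r \<in> borel_measurable borel"
proof -
  have fs: "(\<lambda>z. f (fst z)) \<in> borel_measurable borel" "(\<lambda>z. f (snd z)) \<in> borel_measurable borel"
    if "f \<in> C0inf U" for f
    by (intro borel_measurable_continuous_onI continuous_on_compose2[OF C0infD(4)[OF that, of UNIV]] continuous_intros; simp)+
  have "closed {w :: (real^'n) \<times> (real^'n). dist (fst w) (snd w) \<le> r}"
    by (intro closed_Collect_le continuous_intros)
  then have "(\<lambda>z. gradient_term u z * indicator {w. dist (fst w) (snd w) \<le> r} z) \<in> borel_measurable borel"
    by (intro borel_measurable_times borel_measurable_indicator borel_measurable_continuous_onI
      continuous_gradient_term u borel_closed)
  moreover have "drift u r = (\<lambda>z. gradient_term u z * indicator {w. dist (fst w) (snd w) \<le> r} z)"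
    by (simp add: fun_eq_iff drift_def gradient_term_def)
  ultimately have "drift u r \<in> borel_measurable borel"
    by simp
  then show ?thesis
    unfolding compensated_def by (intro borel_measurable_times borel_measurable_diff fs u v \<psi>) auto
qed

lemma Gam_closure:
  assumes "compact (closure (\<Omega> l))" "closure (\<Omega> l) \<subseteq> U" "\<rho> l > 0"
  shows "compact (closure (Gam \<Omega> \<rho> l))" "closure (Gam \<Omega> \<rho> l) \<subseteq> offdiag U"
proof -
  let ?S = "(closure (\<Omega> l) \<times> closure (\<Omega> l)) \<inter> {z. \<rho> l \<le> dist (fst z) (snd z)}"
  have "closed {z :: (real^'n) \<times> (real^'n). \<rho> l \<le> dist (fst z) (snd z)}"
    by (intro closed_Collect_le continuous_intros)
  then have S: "compact ?S"
    using assms by (intro compact_Int_closed compact_Times)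
  have sub: "closure (Gam \<Omega> \<rho> l) \<subseteq> ?S"
    using closure_subset[of "\<Omega> l"] by (intro closure_minimal compact_imp_closed[OF S]) (auto simp: Gam_def)
  have "?S \<subseteq> offdiag U"
    using assms by (auto simp: offdiag_def)
  with sub show "closure (Gam \<Omega> \<rho> l) \<subseteq> offdiag U"
    by blast
  show "compact (closure (Gam \<Omega> \<rho> l))"
    by (rule compact_if_closed_subset[OF S closed_closure sub])
qed

lemma Gam_borel:
  fixes \<Omega> :: "nat \<Rightarrow> (real^'n) set"
  assumes "open (\<Omega> l)"
  shows "Gam \<Omega> \<rho> l \<in> sets borel"
proof -
  have eq: "Gam \<Omega> \<rho> l = (\<Omega> l \<times> \<Omega> l) \<inter> {z. \<rho> l \<le> dist (fst z) (snd z)}"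
    by (auto simp: Gam_def)
  have op: "open (\<Omega> l \<times> \<Omega> l)"
    using assms by (intro open_Times)
  have cl: "closed {z :: (real^'n) \<times> (real^'n). \<rho> l \<le> dist (fst z) (snd z)}"
    by (intro closed_Collect_le continuous_intros)
  show ?thesis
    unfolding eq by (rule sets.Int[OF borel_open[OF op] borel_closed[OF cl]])
qed

text \<open>The two pieces need different sets of continuity. The drift is continuous only after
  restriction to distance at most r, so the frontier of that set must also be J-null; this is where
  the null condition on distance exactly r is used.\<close>

lemma jump_limit_compensated:
  assumes u: "u \<in> C0inf U" and v: "v \<in> C0inf U" and \<psi>: "\<psi> \<in> C0inf U"
    and \<Omega>: "open (\<Omega> l)" "compact (closure (\<Omega> l))" "closure (\<Omega> l) \<subseteq> U" "\<rho> l > 0"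
    and null: "emeasure J (frontier (Gam \<Omega> \<rho> l)) = 0" "emeasure J {z. dist (fst z) (snd z) = r} = 0"
  shows "jump_limit (\<lambda>z. (u (snd z) - u (fst z)) * \<psi> (fst z) * v (snd z) * indicator (Gam \<Omega> \<rho> l) z)"
    and "jump_limit (\<lambda>z. indicator (Gam \<Omega> \<rho> l) z * (drift u r z * v (snd z)))"
proof -
  have fs: "continuous_on UNIV (\<lambda>z. f (fst z))" "continuous_on UNIV (\<lambda>z. f (snd z))" if "f \<in> C0inf U" for f
    by (intro continuous_on_compose2[OF C0infD(4)[OF that, of UNIV]] continuous_intros; simp)+
  note G = Gam_closure[of \<Omega> l \<rho>, OF \<Omega>(2,3,4)] Gam_borel[of \<Omega> l \<rho>, OF \<Omega>(1)]
  show "jump_limit (\<lambda>z. (u (snd z) - u (fst z)) * \<psi> (fst z) * v (snd z) * indicator (Gam \<Omega> \<rho> l) z)"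
    by (intro jump_limit_indicator G null continuous_on_mult continuous_on_diff fs u v \<psi>)
  let ?D = "{z :: (real^'n) \<times> (real^'n). dist (fst z) (snd z) \<le> r}"
  let ?B = "Gam \<Omega> \<rho> l \<inter> ?D"
  have D: "closed ?D"
    by (intro closed_Collect_le continuous_intros)
  have "open {z :: (real^'n) \<times> (real^'n). dist (fst z) (snd z) < r}"
    by (intro open_Collect_less continuous_intros)
  then have "{z :: (real^'n) \<times> (real^'n). dist (fst z) (snd z) < r} \<subseteq> interior ?D"
    by (intro interior_maximal) auto
  then have "?D - interior ?D \<subseteq> ?D - {z. dist (fst z) (snd z) < r}"
    by blast
  also have "\<dots> \<subseteq> {z. dist (fst z) (snd z) = r}"
    by auto
  finally have "frontier ?D \<subseteq> {z. dist (fst z) (snd z) = r}"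
    using D by (simp add: frontier_def closure_closed)
  moreover have "frontier ?B \<subseteq> frontier (Gam \<Omega> \<rho> l) \<union> frontier ?D"
    by (rule frontier_Int_subset)
  ultimately have sub: "frontier ?B \<subseteq> frontier (Gam \<Omega> \<rho> l) \<union> {z. dist (fst z) (snd z) = r}"
    by blast
  have "closed {z :: (real^'n) \<times> (real^'n). dist (fst z) (snd z) = r}"
    by (intro closed_Collect_eq continuous_intros)
  then have "frontier (Gam \<Omega> \<rho> l) \<union> {z. dist (fst z) (snd z) = r} \<in> null_sets J"
    using null by (intro null_sets.Un null_setsI) (auto simp: sets_J borel_closed)
  then have nullB: "emeasure J (frontier ?B) = 0"
    using sub null_sets_subset[of _ J "frontier ?B"] by (auto simp: sets_J borel_closed)
  have cl: "closure ?B \<subseteq> closure (Gam \<Omega> \<rho> l)"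
    by (intro closure_mono) auto
  have "jump_limit (\<lambda>z. (gradient_term u z * v (snd z)) * indicator ?B z)"
  proof (rule jump_limit_indicator)
    show "continuous_on UNIV (\<lambda>z. gradient_term u z * v (snd z))"
      by (intro continuous_on_mult continuous_gradient_term fs u v)
    show "?B \<in> sets borel"
      using G(3) borel_closed[OF D] by (rule sets.Int)
    show "compact (closure ?B)"
      by (rule compact_if_closed_subset[OF G(1) closed_closure cl])
    show "closure ?B \<subseteq> offdiag U"
      using cl G(2) by blast
  qed (rule nullB)
  moreover have "(\<lambda>z. (gradient_term u z * v (snd z)) * indicator ?B z) =
      (\<lambda>z. indicator (Gam \<Omega> \<rho> l) z * (drift u r z * v (snd z)))"
    by (auto simp: fun_eq_iff drift_eq indicator_def)
  ultimately show "jump_limit (\<lambda>z. indicator (Gam \<Omega> \<rho> l) z * (drift u r z * v (snd z)))"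
    by simp
qed

end

lemma compact_subset_increasing_union:
  fixes \<Omega> :: "nat \<Rightarrow> 'a::topological_space set"
  assumes "compact S" "S \<subseteq> (\<Union>l. \<Omega> l)" "\<And>l. open (\<Omega> l)" "incseq \<Omega>"
  shows "\<forall>\<^sub>F l in sequentially. S \<subseteq> \<Omega> l"
proof -
  obtain I where I: "I \<subseteq> UNIV" "finite I" "S \<subseteq> (\<Union>l\<in>I. \<Omega> l)"
    using compactE_image[OF assms(1), of UNIV \<Omega>] assms(2,3) by blast
  have "S \<subseteq> \<Omega> l" if "l \<ge> Max (insert 0 I)" for l
  proof
    fix x assume "x \<in> S"
    then obtain i where i: "i \<in> I" "x \<in> \<Omega> i"
      using I(3) by blast
    then have "i \<le> Max (insert 0 I)"
      using I(2) by (intro Max_ge) auto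
    then have "i \<le> l"
      using that by simp
    then show "x \<in> \<Omega> l"
      using assms(4) i(2) by (auto simp: incseq_def)
  qed
  then show ?thesis
    by (auto simp: eventually_sequentially)
qed

lemma Lam_inter_Gam: "z \<in> Lam \<Omega> \<rho> l \<Longrightarrow> z \<notin> Gam \<Omega> \<rho> l"
  by (auto simp: Lam_def Gam_def)

section \<open>Passage to the limit in \<beta>, l and k\<close>

context approximated_form
begin

text \<open>For such l the truncated increment lives on the square of \<open>\<Omega> l\<close>, and
  on \<open>Lam \<Omega> \<rho> l\<close> its factor \<psi>(x) is 1 whenever v(y) is nonzero. Hence
  the integral over \<open>Lam\<close> is the full increment integral minus the part over
  \<open>Gam\<close>, both of which have known limits.\<close>

lemma approximating_limit:
  assumes u: "u \<in> C0inf U" and v: "v \<in> C0inf U" and \<psi>: "\<psi> \<in> C0inf U"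
    and one: "\<And>x. x \<in> tsupp u \<union> tsupp v \<Longrightarrow> \<psi> x = 1"
    and near: "\<And>x y. y \<in> tsupp v \<Longrightarrow> dist x y < \<rho> l \<Longrightarrow> \<psi> x = 1"
    and sub: "tsupp v \<subseteq> \<Omega> l" "tsupp \<psi> \<subseteq> \<Omega> l"
    and \<Omega>: "open (\<Omega> l)" "compact (closure (\<Omega> l))" "closure (\<Omega> l) \<subseteq> U" "\<rho> l > 0"
    and null: "emeasure J (frontier (Gam \<Omega> \<rho> l)) = 0" "emeasure J {z. dist (fst z) (snd z) = r} = 0"
  shows "((\<lambda>\<beta>. \<beta> * (set_lebesgue_integral (\<sigma> \<beta>) (Lam \<Omega> \<rho> l) (\<lambda>z. (u (snd z) - u (fst z)) * v (snd z))
       + set_lebesgue_integral (\<sigma> \<beta>) (Gam \<Omega> \<rho> l) (\<lambda>z. drift u r z * v (snd z))))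
     \<longlongrightarrow> E u v - E \<psi> (\<lambda>x. u x * v x) - 2 * (\<integral>z. compensated \<psi> u v r z * indicator (Gam \<Omega> \<rho> l) z \<partial>J)) at_top"
proof -
  define A where "A z = (u (snd z) - u (fst z)) * \<psi> (fst z) * v (snd z)" for z
  let ?\<Gamma> = "Gam \<Omega> \<rho> l" and ?\<Lambda> = "Lam \<Omega> \<rho> l"
  let ?D = "\<lambda>z. indicator ?\<Gamma> z * (drift u r z * v (snd z))"
  have A\<Gamma>: "jump_limit (\<lambda>z. A z * indicator ?\<Gamma> z)" and D\<Gamma>: "jump_limit ?D"
    unfolding A_def
    by (rule jump_limit_compensated[of u v \<psi> \<Omega> l \<rho> r, OF u v \<psi> \<Omega> null])+
  have intA: "integrable (\<sigma> \<beta>) A" if "\<beta> > 0" for \<beta>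
    unfolding A_def using integrable_\<sigma>_increment(1)[OF u v \<psi> that one] .
  have limA: "((\<lambda>\<beta>. \<beta> * (\<integral>z. A z \<partial>\<sigma> \<beta>)) \<longlongrightarrow> E u v - E \<psi> (\<lambda>x. u x * v x)) at_top"
    unfolding A_def by (rule increment_limit[OF u v \<psi> one])
  \<comment> \<open>If v(y) is nonzero but x lies outside \<open>\<Omega> l\<close>, both sides
    vanish because \<psi>(x) = 0; inside the square, \<open>Lam\<close> and \<open>Gam\<close> are
    complementary.\<close>
  have point: "indicator ?\<Lambda> z *\<^sub>R ((u (snd z) - u (fst z)) * v (snd z)) = A z - A z * indicator ?\<Gamma> z" for z
  proof -
    consider "v (snd z) = 0" | "snd z \<in> tsupp v" "fst z \<notin> \<Omega> l" | "snd z \<in> tsupp v" "fst z \<in> \<Omega> l"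
      using zero_outside_tsupp[of "snd z" v] by blast
    then show ?thesis
    proof cases
      case 1
      then show ?thesis by (simp add: A_def)
    next
      case 2
      then have "\<psi> (fst z) = 0"
        using sub(2) zero_outside_tsupp[of "fst z" \<psi>] by blast
      moreover have "z \<notin> ?\<Lambda>"
        using 2 by (auto simp: Lam_def)
      ultimately show ?thesis
        by (simp add: A_def)
    next
      case 3
      then have in\<Omega>: "snd z \<in> \<Omega> l"
        using sub(1) by blast
      show ?thesis
      proof (cases "dist (fst z) (snd z) < \<rho> l")
        case True
        then have "z \<in> ?\<Lambda>" "\<psi> (fst z) = 1"
          using 3 in\<Omega> near by (auto simp: Lam_def case_prod_unfold)
        then show ?thesis
          using Lam_inter_Gam[of z \<Omega> \<rho> l] by (simp add: A_def)
      next
        case False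
        then have "z \<in> ?\<Gamma>"
          using 3 in\<Omega> by (auto simp: Gam_def case_prod_unfold)
        then show ?thesis
          using Lam_inter_Gam[of z \<Omega> \<rho> l] by (auto simp: indicator_def)
      qed
    qed
  qed
  have lim: "((\<lambda>\<beta>. \<beta> * (\<integral>z. A z \<partial>\<sigma> \<beta>) - \<beta> * (\<integral>z. A z * indicator ?\<Gamma> z \<partial>\<sigma> \<beta>) + \<beta> * (\<integral>z. ?D z \<partial>\<sigma> \<beta>))
      \<longlongrightarrow> E u v - E \<psi> (\<lambda>x. u x * v x) - 2 * (\<integral>z. A z * indicator ?\<Gamma> z \<partial>J) + 2 * (\<integral>z. ?D z \<partial>J)) at_top"
    by (intro tendsto_add tendsto_diff limA jump_limitD(4) A\<Gamma> D\<Gamma>)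
  have ev: "\<forall>\<^sub>F \<beta> in at_top. \<beta> * (\<integral>z. A z \<partial>\<sigma> \<beta>) - \<beta> * (\<integral>z. A z * indicator ?\<Gamma> z \<partial>\<sigma> \<beta>) + \<beta> * (\<integral>z. ?D z \<partial>\<sigma> \<beta>)
      = \<beta> * (set_lebesgue_integral (\<sigma> \<beta>) ?\<Lambda> (\<lambda>z. (u (snd z) - u (fst z)) * v (snd z))
       + set_lebesgue_integral (\<sigma> \<beta>) ?\<Gamma> (\<lambda>z. drift u r z * v (snd z)))"
    using eventually_gt_at_top[of 0]
  proof eventually_elim
    case (elim \<beta>)
    have "set_lebesgue_integral (\<sigma> \<beta>) ?\<Lambda> (\<lambda>z. (u (snd z) - u (fst z)) * v (snd z))
        = (\<integral>z. A z \<partial>\<sigma> \<beta>) - (\<integral>z. A z * indicator ?\<Gamma> z \<partial>\<sigma> \<beta>)"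
      unfolding set_lebesgue_integral_def point
      by (rule Bochner_Integration.integral_diff[OF intA[OF elim] jump_limitD(2)[OF A\<Gamma> elim]])
    moreover have "set_lebesgue_integral (\<sigma> \<beta>) ?\<Gamma> (\<lambda>z. drift u r z * v (snd z)) = (\<integral>z. ?D z \<partial>\<sigma> \<beta>)"
      by (simp add: set_lebesgue_integral_def)
    ultimately show ?case
      by (simp only: distrib_left right_diff_distrib)
  qed
  have comp: "(\<integral>z. compensated \<psi> u v r z * indicator ?\<Gamma> z \<partial>J) = (\<integral>z. A z * indicator ?\<Gamma> z \<partial>J) - (\<integral>z. ?D z \<partial>J)"
  proof -
    have eq: "compensated \<psi> u v r z * indicator ?\<Gamma> z = A z * indicator ?\<Gamma> z - ?D z" for z
      by (simp add: compensated_def A_def algebra_simps)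
    show ?thesis
      unfolding eq by (rule Bochner_Integration.integral_diff[OF jump_limitD(3)[OF A\<Gamma>] jump_limitD(3)[OF D\<Gamma>]])
  qed
  have "E u v - E \<psi> (\<lambda>x. u x * v x) - 2 * (\<integral>z. compensated \<psi> u v r z * indicator ?\<Gamma> z \<partial>J)
      = E u v - E \<psi> (\<lambda>x. u x * v x) - 2 * (\<integral>z. A z * indicator ?\<Gamma> z \<partial>J) + 2 * (\<integral>z. ?D z \<partial>J)"
    unfolding comp by simp
  then show ?thesis
    using Lim_transform_eventually[OF lim ev] by presburger
qed

text \<open>The limit in \<beta> is \<open>approximating_limit\<close>, valid once l is large. The
  limits in l and k are dominated convergence with one common majorant. All three are shown to
  exist, which is what identifies the limit operators inside \<open>Ecd\<close>.\<close>

lemma decomposition: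
  assumes \<delta>: "\<delta> > 0" and adm: "admissible U J \<delta> \<Omega> \<rho> \<delta>s"
    and u: "u \<in> C0inf (Udelta U \<delta>)" and v: "v \<in> C0inf (Udelta U \<delta>)" and \<psi>: "\<psi> \<in> C0inf U"
    and W: "open W" "tsupp u \<union> tsupp v \<subseteq> W" "\<And>x. x \<in> W \<Longrightarrow> \<psi> x = 1"
  shows "integrable J (compensated \<psi> u v \<delta>)"
    and "E u v = Ecd \<sigma> \<Omega> \<rho> \<delta>s u v
      + 2 * (\<integral>z. compensated \<psi> u v \<delta> z * indicator (offdiag U) z \<partial>J) + E \<psi> (\<lambda>x. u x * v x)"
proof -
  have adm': "\<And>l. open (\<Omega> l)" "\<And>l. compact (closure (\<Omega> l))" "\<And>l. closure (\<Omega> l) \<subseteq> U"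
    "incseq \<Omega>" "(\<Union>l. \<Omega> l) = U" "\<And>l. \<rho> l > 0" "\<rho> \<longlonglongrightarrow> 0"
    "\<And>l. emeasure J (frontier (Gam \<Omega> \<rho> l)) = 0" "\<And>k. \<delta> \<le> \<delta>s k" "\<delta>s \<longlonglongrightarrow> \<delta>"
    "\<And>k. emeasure J {z. dist (fst z) (snd z) = \<delta>s k} = 0"
    using adm unfolding admissible_def by blast+
  have "Udelta U \<delta> \<subseteq> U"
    by (auto simp: Udelta_def)
  then have uU: "u \<in> C0inf U" and vU: "v \<in> C0inf U"
    using u v C0inf_mono by blast+
  have one: "\<psi> x = 1" if "x \<in> tsupp u \<union> tsupp v" for x
    using that W by blast
  have vW: "tsupp v \<subseteq> W"
    using W(2) by blast
  obtain \<delta>' where \<delta>': "\<delta>' > \<delta>" "\<And>x y. y \<in> tsupp v \<Longrightarrow> dist x y \<le> \<delta>' \<Longrightarrow> x \<in> U"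
    using Udelta_compact_margin[OF C0infD(2,3)[OF v]] by blast
  obtain \<theta> C where \<theta>: "\<theta> \<in> C0inf U" "\<And>x. 0 \<le> \<theta> x" "C \<ge> 0"
    and bound: "\<And>r z. \<delta> \<le> r \<Longrightarrow> r \<le> \<delta>' \<Longrightarrow> \<bar>compensated \<psi> u v r z\<bar> \<le> C * sq_weight \<theta> z"
  proof (rule compensated_bound[OF \<delta> uU vU \<psi> W(1) vW _ \<delta>'(1)])
    show "\<psi> x = 1" if "x \<in> W" for x
      using that by (rule W(3))
    show "x \<in> U" if "y \<in> tsupp v" "dist x y \<le> \<delta>'" for x y
      using that by (rule \<delta>'(2))
  qed (use that in blast)
  have dom: "integrable J (\<lambda>z. C * sq_weight \<theta> z)"
    using integrable_sq_weight[OF \<theta>(1,2)] by simp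
  note meas = measurable_compensated[OF uU vU \<psi>]
  show "integrable J (compensated \<psi> u v \<delta>)"
  proof (rule Bochner_Integration.integrable_bound[OF dom measurable_J[OF meas]])
    have "norm (compensated \<psi> u v \<delta> z) \<le> norm (C * sq_weight \<theta> z)" for z
      using bound[of \<delta> z] \<delta>' by simp
    then show "AE z in J. norm (compensated \<psi> u v \<delta> z) \<le> norm (C * sq_weight \<theta> z)"
      by simp
  qed
  have ind: "\<bar>a * indicator B z\<bar> \<le> b" if "\<bar>a\<bar> \<le> b" for a b :: real and B and z :: "(real^'n) \<times> (real^'n)"
    using that by (auto simp: indicator_def)
  have mO: "offdiag U \<in> sets borel"
    by (intro borel_open open_offdiag open_U)
  define L where "L = E u v - E \<psi> (\<lambda>x. u x * v x)"
  define Y where "Y r = L - 2 * (\<integral>z. compensated \<psi> u v r z * indicator (offdiag U) z \<partial>J)" for r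
  let ?X = "\<lambda>k l. Lim at_top (\<lambda>\<beta>. \<beta> *
        (set_lebesgue_integral (\<sigma> \<beta>) (Lam \<Omega> \<rho> l) (\<lambda>z. (u (snd z) - u (fst z)) * v (snd z))
       + set_lebesgue_integral (\<sigma> \<beta>) (Gam \<Omega> \<rho> l) (\<lambda>z. drift u (\<delta>s k) z * v (snd z))))"
  obtain \<epsilon> where \<epsilon>: "\<epsilon> > 0" "(\<Union>y\<in>tsupp v. cball y \<epsilon>) \<subseteq> W"
    using compact_subset_open_imp_cball_epsilon_subset[OF C0infD(2)[OF v] W(1) vW] by blast
  have near: "\<psi> x = 1" if "y \<in> tsupp v" "dist x y < \<epsilon>" for x y
  proof -
    have "x \<in> cball y \<epsilon>"
      using that(2) by (simp add: dist_commute)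
    then show ?thesis
      using that(1) \<epsilon>(2) W(3) by blast
  qed
  have "compact (tsupp v \<union> tsupp \<psi>)" "tsupp v \<union> tsupp \<psi> \<subseteq> (\<Union>l. \<Omega> l)"
    using C0infD(2)[OF v] C0infD(2)[OF \<psi>] C0infD(3)[OF vU] C0infD(3)[OF \<psi>] adm'(5) by auto
  then have evS: "\<forall>\<^sub>F l in sequentially. tsupp v \<union> tsupp \<psi> \<subseteq> \<Omega> l"
    using adm'(1,4) by (rule compact_subset_increasing_union)
  have ev\<rho>: "\<forall>\<^sub>F l in sequentially. \<rho> l < \<epsilon>"
    using adm'(7) \<epsilon>(1) by (rule order_tendstoD(2))
  \<comment> \<open>For small l nothing is known about the inner \<open>Lim\<close>; the equality
    holds eventually, which suffices for the limit in l.\<close>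
  have X: "\<forall>\<^sub>F l in sequentially. L - 2 * (\<integral>z. compensated \<psi> u v (\<delta>s k) z * indicator (Gam \<Omega> \<rho> l) z \<partial>J) = ?X k l" for k
    using evS ev\<rho>
  proof eventually_elim
    case (elim l)
    have "((\<lambda>\<beta>. \<beta> * (set_lebesgue_integral (\<sigma> \<beta>) (Lam \<Omega> \<rho> l) (\<lambda>z. (u (snd z) - u (fst z)) * v (snd z))
       + set_lebesgue_integral (\<sigma> \<beta>) (Gam \<Omega> \<rho> l) (\<lambda>z. drift u (\<delta>s k) z * v (snd z))))
      \<longlongrightarrow> L - 2 * (\<integral>z. compensated \<psi> u v (\<delta>s k) z * indicator (Gam \<Omega> \<rho> l) z \<partial>J)) at_top"
      unfolding L_def
    proof (rule approximating_limit[OF uU vU \<psi> one])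
      show "\<psi> x = 1" if "y \<in> tsupp v" "dist x y < \<rho> l" for x y
        using near[OF that(1)] that(2) elim(2) by simp
    qed (use elim adm' in auto)
    then show ?case
      by (intro tendsto_Lim[symmetric]) auto
  qed
  have limX: "?X k \<longlonglongrightarrow> Y (\<delta>s k)" if k: "\<delta>s k \<le> \<delta>'" for k
  proof (rule Lim_transform_eventually[OF _ X])
    have "(\<lambda>l. \<integral>z. compensated \<psi> u v (\<delta>s k) z * indicator (Gam \<Omega> \<rho> l) z \<partial>J)
        \<longlonglongrightarrow> (\<integral>z. compensated \<psi> u v (\<delta>s k) z * indicator (offdiag U) z \<partial>J)"
    proof (rule integral_dominated_convergence[OF _ _ dom])
      show "(\<lambda>z. compensated \<psi> u v (\<delta>s k) z * indicator (offdiag U) z) \<in> borel_measurable J"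
        by (intro measurable_J borel_measurable_times meas borel_measurable_indicator mO)
      show "(\<lambda>z. compensated \<psi> u v (\<delta>s k) z * indicator (Gam \<Omega> \<rho> l) z) \<in> borel_measurable J" for l
        by (intro measurable_J borel_measurable_times meas borel_measurable_indicator Gam_borel adm')
      show "AE z in J. norm (compensated \<psi> u v (\<delta>s k) z * indicator (Gam \<Omega> \<rho> l) z) \<le> C * sq_weight \<theta> z" for l
        by (intro always_eventually allI) (simp only: real_norm_def, rule ind[OF bound[OF adm'(9) k]])
      have "(\<lambda>l. indicator (Gam \<Omega> \<rho> l) z :: real) \<longlonglongrightarrow> indicator (offdiag U) z" for z
      proof (cases "z \<in> offdiag U")
        case True
        then have z: "fst z \<in> U" "snd z \<in> U" "dist (fst z) (snd z) > 0"
          by (auto simp: offdiag_def)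
        have "\<forall>\<^sub>F l in sequentially. {fst z, snd z} \<subseteq> \<Omega> l"
          using z adm'(1,4,5) by (intro compact_subset_increasing_union) auto
        moreover have "\<forall>\<^sub>F l in sequentially. \<rho> l < dist (fst z) (snd z)"
          using adm'(7) z(3) by (rule order_tendstoD(2))
        ultimately have "\<forall>\<^sub>F l in sequentially. indicator (offdiag U) z = (indicator (Gam \<Omega> \<rho> l) z :: real)"
        proof eventually_elim
          case (elim l)
          then have "z \<in> Gam \<Omega> \<rho> l"
            by (auto simp: Gam_def case_prod_unfold)
          then show ?case
            using True by simp
        qed
        then show ?thesis
          by (rule Lim_transform_eventually[OF tendsto_const])
      next
        case False
        have "z \<notin> Gam \<Omega> \<rho> l" for l
        proof
          assume z: "z \<in> Gam \<Omega> \<rho> l"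
          then have "fst z \<in> U" "snd z \<in> U"
            using adm'(3)[of l] closure_subset[of "\<Omega> l"] by (auto simp: Gam_def)
          moreover have "fst z \<noteq> snd z"
            using z adm'(6)[of l] by (auto simp: Gam_def)
          ultimately show False
            using False by (auto simp: offdiag_def case_prod_unfold)
        qed
        then show ?thesis
          using False by simp
      qed
      then show "AE z in J. (\<lambda>l. compensated \<psi> u v (\<delta>s k) z * indicator (Gam \<Omega> \<rho> l) z)
          \<longlonglongrightarrow> compensated \<psi> u v (\<delta>s k) z * indicator (offdiag U) z"
        by (intro always_eventually allI tendsto_mult tendsto_const)
    qed
    then show "(\<lambda>l. L - 2 * (\<integral>z. compensated \<psi> u v (\<delta>s k) z * indicator (Gam \<Omega> \<rho> l) z \<partial>J)) \<longlonglongrightarrow> Y (\<delta>s k)"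
      unfolding Y_def by (intro tendsto_diff tendsto_mult tendsto_const)
  qed
  have ev\<delta>: "\<forall>\<^sub>F k in sequentially. \<delta>s k < \<delta>'"
    using adm'(10) \<delta>'(1) by (rule order_tendstoD(2))
  then obtain N where N: "\<And>k. k \<ge> N \<Longrightarrow> \<delta>s k < \<delta>'"
    by (auto simp: eventually_sequentially)
  \<comment> \<open>The index is shifted by N because the majorant covers only radii up to
    \<delta>'.\<close>
  have limY: "(\<lambda>k. Y (\<delta>s k)) \<longlonglongrightarrow> Y \<delta>"
  proof (rule LIMSEQ_offset[of _ N])
    have "(\<lambda>k. \<integral>z. compensated \<psi> u v (\<delta>s (k + N)) z * indicator (offdiag U) z \<partial>J)
        \<longlonglongrightarrow> (\<integral>z. compensated \<psi> u v \<delta> z * indicator (offdiag U) z \<partial>J)"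
    proof (rule integral_dominated_convergence[OF _ _ dom])
      show "(\<lambda>z. compensated \<psi> u v \<delta> z * indicator (offdiag U) z) \<in> borel_measurable J"
        by (intro measurable_J borel_measurable_times meas borel_measurable_indicator mO)
      show "(\<lambda>z. compensated \<psi> u v (\<delta>s (k + N)) z * indicator (offdiag U) z) \<in> borel_measurable J" for k
        by (intro measurable_J borel_measurable_times meas borel_measurable_indicator mO)
      show "AE z in J. norm (compensated \<psi> u v (\<delta>s (k + N)) z * indicator (offdiag U) z) \<le> C * sq_weight \<theta> z" for k
        using N[of "k + N"]
        by (intro always_eventually allI) (simp only: real_norm_def, rule ind[OF bound[OF adm'(9)]], simp)
      have "(\<lambda>k. compensated \<psi> u v (\<delta>s (k + N)) z * indicator (offdiag U) z)
          \<longlonglongrightarrow> compensated \<psi> u v \<delta> z * indicator (offdiag U) z" for z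
      proof -
        \<comment> \<open>Approach from above matters here: a pair at distance exactly \<delta> is
          included for every k, and one at larger distance is eventually excluded. So the closed
          condition at \<delta> is recovered even if J charges distance \<delta>.\<close>
        have "\<forall>\<^sub>F k in sequentially. drift u \<delta> z = drift u (\<delta>s k) z"
        proof (cases "dist (fst z) (snd z) \<le> \<delta>")
          case True
          then have "drift u \<delta> z = drift u (\<delta>s k) z" for k
            using adm'(9)[of k] by (simp add: drift_eq)
          then show ?thesis by simp
        next
          case False
          then have "\<forall>\<^sub>F k in sequentially. \<delta>s k < dist (fst z) (snd z)"
            using adm'(10) by (intro order_tendstoD(2)) auto
          then show ?thesis
            by eventually_elim (use False in \<open>simp add: drift_eq\<close>)
        qed
        then have "\<forall>\<^sub>F k in sequentially. compensated \<psi> u v \<delta> z * indicator (offdiag U) z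
            = compensated \<psi> u v (\<delta>s k) z * indicator (offdiag U) z"
          by eventually_elim (simp add: compensated_def)
        then have "(\<lambda>k. compensated \<psi> u v (\<delta>s k) z * indicator (offdiag U) z)
          \<longlonglongrightarrow> compensated \<psi> u v \<delta> z * indicator (offdiag U) z"
          by (rule Lim_transform_eventually[OF tendsto_const])
        then show ?thesis
          by (rule LIMSEQ_ignore_initial_segment)
      qed
      then show "AE z in J. (\<lambda>k. compensated \<psi> u v (\<delta>s (k + N)) z * indicator (offdiag U) z)
          \<longlonglongrightarrow> compensated \<psi> u v \<delta> z * indicator (offdiag U) z"
        by simp
    qed
    then show "(\<lambda>k. Y (\<delta>s (k + N))) \<longlonglongrightarrow> Y \<delta>"
      unfolding Y_def by (intro tendsto_diff tendsto_mult tendsto_const)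
  qed
  \<comment> \<open>Only radii below \<delta>' have an established inner limit; the finitely many
    others do not affect the limit in k.\<close>
  have "\<forall>\<^sub>F k in sequentially. Y (\<delta>s k) = lim (?X k)"
    using ev\<delta> by eventually_elim (rule limI[symmetric], rule limX, simp)
  with limY have "(\<lambda>k. lim (?X k)) \<longlonglongrightarrow> Y \<delta>"
    by (rule Lim_transform_eventually)
  then have "Ecd \<sigma> \<Omega> \<rho> \<delta>s u v = Y \<delta>"
    unfolding Ecd_def by (rule limI)
  then show "E u v = Ecd \<sigma> \<Omega> \<rho> \<delta>s u v
      + 2 * (\<integral>z. compensated \<psi> u v \<delta> z * indicator (offdiag U) z \<partial>J) + E \<psi> (\<lambda>x. u x * v x)"
    by (simp add: Y_def L_def)
qed

text \<open>Linearity of E is not among the hypotheses of \<open>approximated_form\<close>; it is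
  inherited from the approximating expressions by uniqueness of limits.\<close>

lemma E_diff_left:
  assumes "f \<in> C0inf U" "g \<in> C0inf U" "h \<in> C0inf U"
  shows "E (\<lambda>x. f x - g x) h = E f h - E g h"
proof (rule tendsto_unique[OF trivial_limit_at_top_linorder approx])
  have "((\<lambda>\<beta>. \<beta> * (ip m f h - (\<integral>z. f (fst z) * h (snd z) \<partial>\<sigma> \<beta>))
      - \<beta> * (ip m g h - (\<integral>z. g (fst z) * h (snd z) \<partial>\<sigma> \<beta>))) \<longlongrightarrow> E f h - E g h) at_top"
    by (intro tendsto_diff approx assms)
  then show "((\<lambda>\<beta>. \<beta> * (ip m (\<lambda>x. f x - g x) h - (\<integral>z. (f (fst z) - g (fst z)) * h (snd z) \<partial>\<sigma> \<beta>)))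
      \<longlongrightarrow> E f h - E g h) at_top"
  proof (rule Lim_transform_eventually)
    show "\<forall>\<^sub>F \<beta> in at_top. \<beta> * (ip m f h - (\<integral>z. f (fst z) * h (snd z) \<partial>\<sigma> \<beta>))
      - \<beta> * (ip m g h - (\<integral>z. g (fst z) * h (snd z) \<partial>\<sigma> \<beta>))
      = \<beta> * (ip m (\<lambda>x. f x - g x) h - (\<integral>z. (f (fst z) - g (fst z)) * h (snd z) \<partial>\<sigma> \<beta>))"
      using eventually_gt_at_top[of 0]
    proof eventually_elim
      case (elim \<beta>)
      have ip: "ip m (\<lambda>x. f x - g x) h = ip m f h - ip m g h"
        using assms by (intro ip_diff_left L2_C0inf)
      have int: "(\<integral>z. (f (fst z) - g (fst z)) * h (snd z) \<partial>\<sigma> \<beta>)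
          = (\<integral>z. f (fst z) * h (snd z) \<partial>\<sigma> \<beta>) - (\<integral>z. g (fst z) * h (snd z) \<partial>\<sigma> \<beta>)"
        unfolding left_diff_distrib
        by (rule Bochner_Integration.integral_diff) (intro integrable_\<sigma>_tensor elim assms)+
      show ?case
        unfolding ip int by (simp add: algebra_simps)
    qed
  qed
qed (use assms in \<open>auto intro: C0inf_diff\<close>)

text \<open>The jumps out of a neighbourhood of the support of \<theta> have finite total mass, because the
  mass of those ending inside large compact sets is bounded by E \<psi> \<theta> when E \<kappa> \<theta> is nonnegative
  for all cutoff functions \<kappa>.\<close>

lemma integrable_escape:
  assumes pos: "\<And>\<kappa>. \<kappa> \<in> C0inf U \<Longrightarrow> (\<And>x. 0 \<le> \<kappa> x \<and> \<kappa> x \<le> 1) \<Longrightarrow> (\<And>x. x \<in> tsupp \<theta> \<Longrightarrow> \<kappa> x = 1) \<Longrightarrow> 0 \<le> E \<kappa> \<theta>"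
    and \<theta>: "\<theta> \<in> C0inf U" "\<And>x. 0 \<le> \<theta> x" and \<psi>: "\<psi> \<in> C0inf U" "\<And>x. \<psi> x \<le> 1"
    and V: "open V" "tsupp \<theta> \<subseteq> V" "\<And>x. x \<in> V \<Longrightarrow> \<psi> x = 1"
  shows "integrable J (\<lambda>z. indicator U (fst z) * (1 - \<psi> (fst z)) * \<theta> (snd z))"
proof -
  obtain C :: "nat \<Rightarrow> (real^'n) set" where C: "\<And>n. compact (C n)" "\<And>n. C n \<subseteq> U"
    "\<And>K. compact K \<Longrightarrow> K \<subseteq> U \<Longrightarrow> \<exists>N. \<forall>n\<ge>N. K \<subseteq> C n"
    by (rule open_Union_compact_subsets[OF open_U]) blast
  have "\<exists>\<kappa> S. \<kappa> \<in> C0inf U \<and> (\<forall>x. 0 \<le> \<kappa> x \<and> \<kappa> x \<le> 1) \<and> open S \<and> C n \<union> tsupp \<theta> \<union> tsupp \<psi> \<subseteq> S \<and> (\<forall>x\<in>S. \<kappa> x = 1)" for n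
  proof -
    have "compact (C n \<union> tsupp \<theta> \<union> tsupp \<psi>)" "C n \<union> tsupp \<theta> \<union> tsupp \<psi> \<subseteq> U"
      using C(1,2)[of n] C0infD(2,3)[OF \<theta>(1)] C0infD(2,3)[OF \<psi>(1)] by auto
    then show ?thesis
    proof (rule cutoff_exists[OF _ open_U])
      fix k S
      assume k: "k \<in> C0inf U" "\<And>x. 0 \<le> k x" "\<And>x. k x \<le> 1" "open S" "C n \<union> tsupp \<theta> \<union> tsupp \<psi> \<subseteq> S"
        "\<And>x. x \<in> S \<Longrightarrow> k x = 1"
      show ?thesis
        by (rule exI[of _ k], rule exI[of _ S]) (intro conjI allI ballI k)
    qed
  qed
  then obtain \<kappa> S where \<kappa>: "\<And>n. \<kappa> n \<in> C0inf U" "\<And>n x. 0 \<le> \<kappa> n x \<and> \<kappa> n x \<le> 1" "\<And>n. open (S n)"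
    "\<And>n. C n \<union> tsupp \<theta> \<union> tsupp \<psi> \<subseteq> S n" "\<And>n x. x \<in> S n \<Longrightarrow> \<kappa> n x = 1"
    by metis
  have ge: "\<psi> x \<le> \<kappa> n x" for x n
  proof (cases "x \<in> tsupp \<psi>")
    case True
    then have "\<kappa> n x = 1"
      using \<kappa>(4,5) by blast
    then show ?thesis
      using \<psi>(2) by simp
  next
    case False
    then show ?thesis
      using zero_outside_tsupp[of x \<psi>] \<kappa>(2)[of n x] by simp
  qed
  have diff: "(\<lambda>x. \<kappa> n x - \<psi> x) \<in> C0inf U" for n
    by (intro C0inf_diff \<kappa> \<psi>)
  \<comment> \<open>Both \<kappa> n and \<psi> are 1 on the open set S n \<inter> V, which contains
    the support of \<theta>. Hence the difference is a function to which \<open>jump\<close>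
    applies.\<close>
  have disj: "tsupp (\<lambda>x. \<kappa> n x - \<psi> x) \<inter> tsupp \<theta> = {}" for n
  proof -
    have "tsupp (\<lambda>x. \<kappa> n x - \<psi> x) \<subseteq> - (S n \<inter> V)"
      using \<kappa>(3,5) V(1,3) by (intro tsupp_minimal) (auto intro: open_Int)
    then show ?thesis
      using \<kappa>(4) V(2) by blast
  qed
  show ?thesis
  proof (rule integrable_of_bounded_limit[where F="\<lambda>n z. (\<kappa> n (fst z) - \<psi> (fst z)) * \<theta> (snd z)" and C="E \<psi> \<theta> / 2"])
    fix n
    have "jump_limit (\<lambda>z. (\<kappa> n (fst z) - \<psi> (fst z)) * \<theta> (snd z))"
      using tensor_span_properties[OF tensor_span.tensor[OF diff[of n] \<theta>(1) disj]] by blast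
    then show "integrable J (\<lambda>z. (\<kappa> n (fst z) - \<psi> (fst z)) * \<theta> (snd z))"
      by (rule jump_limitD)
    show "0 \<le> (\<kappa> n (fst z) - \<psi> (fst z)) * \<theta> (snd z)" for z
      using ge \<theta>(2) by simp
    have "0 \<le> E (\<kappa> n) \<theta>"
      using \<kappa>(1,2) by (rule pos) (use \<kappa>(4,5) in blast)
    then show "(\<integral>z. (\<kappa> n (fst z) - \<psi> (fst z)) * \<theta> (snd z) \<partial>J) \<le> E \<psi> \<theta> / 2"
      using jump[OF diff[of n] \<theta>(1) disj] E_diff_left[OF \<kappa>(1)[of n] \<psi>(1) \<theta>(1)] by simp
  next
    have "(\<lambda>z. (indicator U (fst z) * (1 - \<psi> (fst z)) * \<theta> (snd z) :: real)) \<in> borel_measurable borel"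
    proof (intro borel_measurable_times borel_measurable_diff)
      have eq: "(\<lambda>z :: (real^'n) \<times> (real^'n). indicator U (fst z) :: real) = indicator (U \<times> UNIV)"
        by (auto simp: fun_eq_iff indicator_def)
      show "(\<lambda>z :: (real^'n) \<times> (real^'n). indicator U (fst z) :: real) \<in> borel_measurable borel"
        unfolding eq by (intro borel_measurable_indicator borel_open open_Times open_U open_UNIV)
    qed (auto intro!: borel_measurable_continuous_onI continuous_on_compose2[OF C0infD(4)[OF \<psi>(1), of UNIV]]
        continuous_on_compose2[OF C0infD(4)[OF \<theta>(1), of UNIV]] continuous_intros)
    then show "(\<lambda>z. indicator U (fst z) * (1 - \<psi> (fst z)) * \<theta> (snd z)) \<in> borel_measurable J"
      by (rule measurable_J)
    have "(\<lambda>n. \<kappa> n x) \<longlonglongrightarrow> indicator U x" for x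
    proof (cases "x \<in> U")
      case True
      then obtain N where "\<forall>n\<ge>N. {x} \<subseteq> C n"
        using C(3)[of "{x}"] by auto
      then have "\<forall>\<^sub>F n in sequentially. indicator U x = \<kappa> n x"
        using \<kappa>(4,5) True unfolding eventually_sequentially by (intro exI[of _ N]) force
      then show ?thesis
        by (rule Lim_transform_eventually[OF tendsto_const])
    next
      case False
      then have "\<kappa> n x = 0" for n
        using C0infD(5)[OF \<kappa>(1)] by blast
      then show ?thesis
        using False by simp
    qed
    then have "(\<lambda>n. (\<kappa> n (fst z) - \<psi> (fst z)) * \<theta> (snd z)) \<longlonglongrightarrow> (indicator U (fst z) - \<psi> (fst z)) * \<theta> (snd z)" for z
      by (intro tendsto_mult tendsto_diff tendsto_const)
    moreover have "indicator U x - \<psi> x = indicator U x * (1 - \<psi> x)" for x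
      using C0infD(5)[OF \<psi>(1), of x] by (auto simp: indicator_def)
    ultimately show "AE z in J. (\<lambda>n. (\<kappa> n (fst z) - \<psi> (fst z)) * \<theta> (snd z))
        \<longlonglongrightarrow> indicator U (fst z) * (1 - \<psi> (fst z)) * \<theta> (snd z)"
      by simp
  qed
qed

end

section \<open>Exchanging the coordinates\<close>

abbreviation flip :: "'a \<times> 'a \<Rightarrow> 'a \<times> 'a" where
  "flip \<equiv> \<lambda>z. (snd z, fst z)"

lemma measurable_flip:
  fixes J :: "((real^'n::finite) \<times> (real^'n)) measure"
  assumes "sets J = sets borel"
  shows "flip \<in> measurable J borel"
proof -
  have "flip \<in> borel_measurable (borel :: ((real^'n) \<times> (real^'n)) measure)"
    by (intro borel_measurable_continuous_onI continuous_intros)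
  then show ?thesis
    using assms by (simp cong: measurable_cong_sets)
qed

lemma emeasure_Jhat:
  fixes J :: "((real^'n::finite) \<times> (real^'n)) measure"
  assumes "sets J = sets borel" "A \<in> sets borel"
  shows "emeasure (Jhat J) A = emeasure J (flip -` A)"
proof -
  have "space J = UNIV"
    using sets_eq_imp_space_eq[OF assms(1)] by simp
  then show ?thesis
    unfolding Jhat_def using emeasure_distr[OF measurable_flip[OF assms(1)] assms(2)] by simp
qed

lemma integral_Jhat:
  fixes J :: "((real^'n::finite) \<times> (real^'n)) measure" and f :: "_ \<Rightarrow> real"
  assumes "sets J = sets borel" "f \<in> borel_measurable borel"
  shows "(\<integral>z. f z \<partial>Jhat J) = (\<integral>z. f (flip z) \<partial>J)"
  unfolding Jhat_def by (rule integral_distr[OF measurable_flip[OF assms(1)] assms(2)])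

text \<open>The exchange is a continuous involution, so preserving a set and its complement it
  preserves the two closures whose intersection is the frontier.\<close>

lemma flip_vimage_frontier:
  fixes S :: "((real^'n::finite) \<times> (real^'n)) set"
  assumes "flip -` S = S"
  shows "flip -` frontier S = frontier S"
proof -
  have flip_closure: "flip z \<in> closure T" if "z \<in> closure T" "flip -` T = T" for z and T :: "((real^'n) \<times> (real^'n)) set"
  proof -
    have "flip ` closure T \<subseteq> closure (flip ` T)"
      by (intro image_closure_subset continuous_intros closed_closure) (rule closure_subset)
    moreover have "flip ` T \<subseteq> T"
      using that(2) by auto
    ultimately show ?thesis
      using that(1) closure_mono[of "flip ` T" T] by blast
  qed
  have compl: "flip -` (- S) = - S"
    using assms by auto
  have sub: "flip z \<in> frontier S" if "z \<in> frontier S" for z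
    using that flip_closure[OF _ assms] flip_closure[OF _ compl] unfolding frontier_closures by blast
  show ?thesis
  proof (intro set_eqI iffI)
    fix z assume "z \<in> flip -` frontier S"
    then show "z \<in> frontier S"
      using sub[of "flip z"] by simp
  qed (use sub in simp)
qed

lemma radon_on_Jhat:
  fixes J :: "((real^'n::finite) \<times> (real^'n)) measure"
  assumes J: "radon_on J (offdiag U)" and U: "open U"
  shows "radon_on (Jhat J) (offdiag U)"
proof -
  have sets: "sets J = sets borel"
    using J by (simp add: radon_on_def)
  have "flip -` (- offdiag U) = - offdiag U"
    by (auto simp: offdiag_def)
  moreover have "- offdiag U \<in> sets borel"
    using borel_open[OF open_offdiag[OF U]] by (rule borel_comp)
  ultimately have "emeasure (Jhat J) (- offdiag U) = 0"
    using emeasure_Jhat[OF sets] J by (simp add: radon_on_def)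
  moreover have "emeasure (Jhat J) C < \<infinity>" if C: "compact C" "C \<subseteq> offdiag U" for C
  proof -
    have eq: "flip -` C = flip ` C"
      by force
    have "compact (flip ` C)"
      by (intro compact_continuous_image continuous_intros C)
    moreover have "flip ` C \<subseteq> offdiag U"
      using C(2) by (auto simp: offdiag_def)
    ultimately show ?thesis
      using emeasure_Jhat[OF sets, of C] C J by (simp add: radon_on_def eq borel_compact)
  qed
  ultimately show ?thesis
    by (simp add: radon_on_def Jhat_def)
qed

text \<open>The sets \<open>Gam \<Omega> \<rho> l\<close> and the sets of pairs at distance
  \<open>\<delta>s k\<close> are symmetric, so their null conditions are the same for J and
  \<open>Jhat J\<close>. The same sequences therefore serve for the dual form.\<close>

lemma admissible_Jhat:
  assumes adm: "admissible U J \<delta> \<Omega> \<rho> \<delta>s" and sets: "sets J = sets borel"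
  shows "admissible U (Jhat J) \<delta> \<Omega> \<rho> \<delta>s"
proof -
  have "emeasure (Jhat J) (frontier (Gam \<Omega> \<rho> l)) = emeasure J (frontier (Gam \<Omega> \<rho> l))" for l
  proof -
    have "flip -` Gam \<Omega> \<rho> l = Gam \<Omega> \<rho> l"
      by (auto simp: Gam_def dist_commute)
    from flip_vimage_frontier[OF this] show ?thesis
      using emeasure_Jhat[OF sets, of "frontier (Gam \<Omega> \<rho> l)"] by (simp add: borel_closed)
  qed
  moreover have "emeasure (Jhat J) {z. dist (fst z) (snd z) = \<delta>s k} = emeasure J {z. dist (fst z) (snd z) = \<delta>s k}" for k
  proof -
    have "closed {z :: (real^'a) \<times> (real^'a). dist (fst z) (snd z) = \<delta>s k}"
      by (intro closed_Collect_eq continuous_intros)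
    moreover have "flip -` {z :: (real^'a) \<times> (real^'a). dist (fst z) (snd z) = \<delta>s k} = {z. dist (fst z) (snd z) = \<delta>s k}"
      by (auto simp: dist_commute)
    ultimately show ?thesis
      using emeasure_Jhat[OF sets, of "{z. dist (fst z) (snd z) = \<delta>s k}"] by (simp add: borel_closed)
  qed
  ultimately show ?thesis
    using adm by (simp add: admissible_def)
qed

text \<open>Here u is the constant 0 near the support of v. As u v = 0, the killing term and the
  part with u(y) vanish, leaving -2 u(x) v(y).\<close>

lemma jump_killing_disjoint:
  assumes jk: "jump_killing U E J K" and u: "u \<in> C0inf U" and v: "v \<in> C0inf U"
    and disj: "tsupp u \<inter> tsupp v = {}"
  shows "E u v = - 2 * (\<integral>z. u (fst z) * v (snd z) \<partial>J)"
proof -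
  have uv: "u x * v x = 0" for x
    using disj zero_outside_tsupp[of x u] zero_outside_tsupp[of x v] by (cases "x \<in> tsupp u") auto
  have point: "indicator (offdiag U) z *\<^sub>R (2 * (u (snd z) - u (fst z)) * v (snd z)) = - 2 * (u (fst z) * v (snd z))" for z
  proof (cases "z \<in> offdiag U")
    case True
    then show ?thesis
      using uv[of "snd z"] by (simp add: algebra_simps)
  next
    case False
    then have "fst z \<notin> U \<or> snd z \<notin> U \<or> fst z = snd z"
      by (auto simp: offdiag_def case_prod_unfold)
    then have "u (fst z) * v (snd z) = 0"
      using C0infD(5)[OF u, of "fst z"] C0infD(5)[OF v, of "snd z"] uv[of "fst z"] by auto
    then show ?thesis
      using False by simp
  qed
  have "open (- tsupp u)" "tsupp v \<subseteq> - tsupp u" "\<forall>x\<in>- tsupp u. u x = 0"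
    using disj closed_tsupp[of u] by (auto simp: zero_outside_tsupp)
  then have "\<exists>W c. open W \<and> tsupp v \<subseteq> W \<and> (\<forall>x\<in>W. u x = c)"
    by blast
  then have "E u v = set_lebesgue_integral J (offdiag U) (\<lambda>z. 2 * (u (snd z) - u (fst z)) * v (snd z))
      + (\<integral>x. u x * v x \<partial>K)"
    using jk u v unfolding jump_killing_def by blast
  then show ?thesis
    unfolding set_lebesgue_integral_def point uv by simp
qed

section \<open>Positivity and the two instances of the abstract setting\<close>

lemma resolvent_ip_nonneg:
  assumes rc: "case1 m U E G Gh \<or> case2 m U E G Gh" and \<beta>: "\<beta> > 0"
    and f: "L2 m f" "\<And>x. 0 \<le> f x \<and> f x \<le> c" and g: "L2 m g" "\<And>x. 0 \<le> g x"
  shows "0 \<le> ip m (G \<beta> f) g"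
proof -
  note rf = resolvent_facts[OF rc]
  \<comment> \<open>Dividing by a positive upper bound brings f into the unit interval, where the
    sub-Markov property applies; the maximum with 1 excludes division by 0. The factor is pulled out
    again through the adjoint.\<close>
  define d where "d = max c 1"
  have d: "d > 0" "\<And>x. f x \<le> d"
    using f(2) by (auto simp: d_def le_max_iff_disj)
  define h where "h = (\<lambda>x. (1 / d) * f x)"
  have h: "L2 m h"
    unfolding h_def by (rule L2_scale[OF f(1)])
  have "0 \<le> h x \<and> h x \<le> 1" for x
    using f(2)[of x] d(1) d(2)[of x] by (simp add: h_def)
  then have "AE x in m. 0 \<le> \<beta> * G \<beta> h x \<and> \<beta> * G \<beta> h x \<le> 1"
    using rf(4)[OF \<beta> h] by simp
  then have "AE x in m. 0 \<le> G \<beta> h x * g x"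
    by (rule AE_mp) (use \<beta> g(2) in \<open>auto simp: zero_le_mult_iff\<close>)
  then have "0 \<le> ip m (G \<beta> h) g"
    unfolding ip_def by (rule integral_nonneg_AE)
  also have "ip m (G \<beta> h) g = (1 / d) * ip m (G \<beta> f) g"
    using rf(3)[OF \<beta> h g(1)] rf(3)[OF \<beta> f(1) g(1)] by (simp only: h_def ip_scale_left)
  finally show ?thesis
    using d(1) by (simp add: zero_le_divide_iff)
qed

text \<open>On the support of \<theta> the function \<kappa> is 1, hence at least \<beta> G \<kappa>
  by the sub-Markov property. So every approximating expression for E \<kappa> \<theta> is
  nonnegative.\<close>

lemma resolvent_form_nonneg:
  assumes rc: "case1 m U E G Gh \<or> case2 m U E G Gh"
    and \<kappa>: "\<kappa> \<in> C0inf U" "\<And>x. 0 \<le> \<kappa> x \<and> \<kappa> x \<le> 1"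
    and \<theta>: "\<theta> \<in> C0inf U" "\<And>x. 0 \<le> \<theta> x" "\<And>x. x \<in> tsupp \<theta> \<Longrightarrow> \<kappa> x = 1"
  shows "0 \<le> E \<kappa> \<theta>"
proof (rule tendsto_lowerbound[OF resolvent_facts(5)[OF rc \<kappa>(1) \<theta>(1)]])
  note rf = resolvent_facts[OF rc]
  show "\<forall>\<^sub>F \<beta> in at_top. 0 \<le> \<beta> * (ip m \<kappa> \<theta> - \<beta> * ip m (G \<beta> \<kappa>) \<theta>)"
    using eventually_gt_at_top[of 0]
  proof eventually_elim
    case (elim \<beta>)
    have L: "L2 m \<kappa>" "L2 m \<theta>" "L2 m (\<lambda>x. \<beta> * G \<beta> \<kappa> x)"
      by (intro L2_scale rf(6) rf(1)[OF elim] \<kappa>(1) \<theta>(1))+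
    have "AE x in m. 0 \<le> \<beta> * G \<beta> \<kappa> x \<and> \<beta> * G \<beta> \<kappa> x \<le> 1"
      using rf(4)[OF elim L(1)] \<kappa>(2) by simp
    then have "AE x in m. 0 \<le> (\<kappa> x - \<beta> * G \<beta> \<kappa> x) * \<theta> x"
    proof (rule AE_mp, intro AE_I2 impI)
      fix x assume "0 \<le> \<beta> * G \<beta> \<kappa> x \<and> \<beta> * G \<beta> \<kappa> x \<le> 1"
      then show "0 \<le> (\<kappa> x - \<beta> * G \<beta> \<kappa> x) * \<theta> x"
        using \<theta>(2,3)[of x] zero_outside_tsupp[of x \<theta>] by (cases "x \<in> tsupp \<theta>") auto
    qed
    then have "0 \<le> ip m (\<lambda>x. \<kappa> x - \<beta> * G \<beta> \<kappa> x) \<theta>"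
      unfolding ip_def by (rule integral_nonneg_AE)
    also have "\<dots> = ip m \<kappa> \<theta> - \<beta> * ip m (G \<beta> \<kappa>) \<theta>"
      unfolding ip_diff_left[OF L(1,3,2)] ip_scale_left ..
    finally show ?case
      using elim by simp
  qed
qed simp

lemma approximated_form_resolvent:
  assumes "open U" "radon_on m U" and rc: "case1 m U E G Gh \<or> case2 m U E G Gh"
    and ker: "kernel_measures m U G \<sigma>" and jk: "jump_killing U E J K"
  shows "approximated_form U m E \<sigma> J"
proof
  note rf = resolvent_facts[OF rc]
  have sets_m: "sets m = sets borel"
    using assms(2) by (simp add: radon_on_def)
  show "radon_on (\<sigma> \<beta>) (U \<times> U)" if "\<beta> > 0" for \<beta>
    using ker that by (simp add: kernel_measures_def)
  show "radon_on J (offdiag U)"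
    using jk by (simp add: jump_killing_def)
  fix u v assume u: "u \<in> C0inf U" and v: "v \<in> C0inf U"
  show "((\<lambda>\<beta>. \<beta> * (ip m u v - (\<integral>z. u (fst z) * v (snd z) \<partial>\<sigma> \<beta>))) \<longlongrightarrow> E u v) at_top"
  proof (rule Lim_transform_eventually[OF rf(5)[OF u v]])
    show "\<forall>\<^sub>F \<beta> in at_top. \<beta> * (ip m u v - \<beta> * ip m (G \<beta> u) v) = \<beta> * (ip m u v - (\<integral>z. u (fst z) * v (snd z) \<partial>\<sigma> \<beta>))"
      using eventually_gt_at_top[of 0]
    proof eventually_elim
      case (elim \<beta>)
      have "has_bochner_integral (\<sigma> \<beta>) (\<lambda>z. u (fst z) * v (snd z)) (\<beta> * ip m (G \<beta> u) v)"
      proof (rule C0inf_kernel_integral[where H=Gh, OF sets_m ker elim])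
        show "0 \<le> ip m (G \<beta> f) g" if "L2 m f" "L2 m g" "\<And>x. 0 \<le> f x \<and> f x \<le> c" "\<And>x. 0 \<le> g x \<and> g x \<le> c" for f g c
          using resolvent_ip_nonneg[OF rc elim that(1,3,2)] that(4) by blast
      qed (use rf elim u v in auto)
      then show ?case
        by (simp add: has_bochner_integral_integral_eq)
    qed
  qed
  show "E u v = - 2 * (\<integral>z. u (fst z) * v (snd z) \<partial>J)" if "tsupp u \<inter> tsupp v = {}"
    using jump_killing_disjoint[OF jk u v that] .
qed (use assms resolvent_facts(6)[OF rc] in auto)

text \<open>Adjointness turns the pairing of \<open>Gh \<beta> u\<close> with v into that of
  \<open>G \<beta> v\<close> with u. Thus the approximation of E v u by G also serves the dual form,
  and positivity of the co-resolvent follows from that of G with the arguments exchanged.\<close>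

lemma approximated_form_coresolvent:
  assumes "open U" "radon_on m U" and rc: "case1 m U E G Gh \<or> case2 m U E G Gh"
    and ker: "kernel_measures m U Gh \<sigma>" and jk: "jump_killing U E J K"
  shows "approximated_form U m (\<lambda>u v. E v u) \<sigma> (Jhat J)"
proof
  note rf = resolvent_facts[OF rc]
  have sets_m: "sets m = sets borel"
    using assms(2) by (simp add: radon_on_def)
  have J: "radon_on J (offdiag U)"
    using jk by (simp add: jump_killing_def)
  show "radon_on (\<sigma> \<beta>) (U \<times> U)" if "\<beta> > 0" for \<beta>
    using ker that by (simp add: kernel_measures_def)
  show "radon_on (Jhat J) (offdiag U)"
    using J assms(1) by (rule radon_on_Jhat)
  have adj: "ip m (Gh \<beta> f) g = ip m f (G \<beta> g)" if "\<beta> > 0" "L2 m f" "L2 m g" for \<beta> f g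
    using rf(3)[OF that(1,3,2)] ip_commute[of m "Gh \<beta> f" g] ip_commute[of m f "G \<beta> g"] by simp
  fix u v assume u: "u \<in> C0inf U" and v: "v \<in> C0inf U"
  show "((\<lambda>\<beta>. \<beta> * (ip m u v - (\<integral>z. u (fst z) * v (snd z) \<partial>\<sigma> \<beta>))) \<longlongrightarrow> E v u) at_top"
  proof (rule Lim_transform_eventually[OF rf(5)[OF v u]])
    show "\<forall>\<^sub>F \<beta> in at_top. \<beta> * (ip m v u - \<beta> * ip m (G \<beta> v) u) = \<beta> * (ip m u v - (\<integral>z. u (fst z) * v (snd z) \<partial>\<sigma> \<beta>))"
      using eventually_gt_at_top[of 0]
    proof eventually_elim
      case (elim \<beta>)
      have "has_bochner_integral (\<sigma> \<beta>) (\<lambda>z. u (fst z) * v (snd z)) (\<beta> * ip m (Gh \<beta> u) v)"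
      proof (rule C0inf_kernel_integral[where H=G, OF sets_m ker elim])
        show "0 \<le> ip m (Gh \<beta> f) g" if "L2 m f" "L2 m g" "\<And>x. 0 \<le> f x \<and> f x \<le> c" "\<And>x. 0 \<le> g x \<and> g x \<le> c" for f g c
          using resolvent_ip_nonneg[OF rc elim that(2,4,1)] that(3) adj[OF elim that(1,2)] ip_commute[of m f "G \<beta> g"] by auto
      qed (use rf adj elim u v in auto)
      moreover have "ip m (Gh \<beta> u) v = ip m (G \<beta> v) u"
        using adj[OF elim] rf(6) u v ip_commute[of m u "G \<beta> v"] by simp
      ultimately show ?case
        using ip_commute[of m u v] by (simp add: has_bochner_integral_integral_eq)
    qed
  qed
  show "E v u = - 2 * (\<integral>z. u (fst z) * v (snd z) \<partial>Jhat J)" if "tsupp u \<inter> tsupp v = {}"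
  proof -
    have "(\<lambda>z. u (fst z) * v (snd z)) \<in> borel_measurable borel"
      by (intro borel_measurable_continuous_onI continuous_on_mult continuous_on_compose2[OF C0infD(4)[OF u, of UNIV]]
        continuous_on_compose2[OF C0infD(4)[OF v, of UNIV]] continuous_intros) auto
    then have "(\<integral>z. u (fst z) * v (snd z) \<partial>Jhat J) = (\<integral>z. v (fst z) * u (snd z) \<partial>J)"
      using integral_Jhat[of J "\<lambda>z. u (fst z) * v (snd z)"] J by (simp add: radon_on_def mult.commute)
    then show ?thesis
      using jump_killing_disjoint[OF jk v u] that by (simp add: Int_commute)
  qed
qed (use assms resolvent_facts(6)[OF rc] in auto)

theorem theorem2p3:
  fixes U :: "(real^'n::finite) set"
    and m :: "(real^'n) measure"
    and E :: "'n fn \<Rightarrow> 'n fn \<Rightarrow> real"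
    and G Gh :: "real \<Rightarrow> 'n fn \<Rightarrow> 'n fn"
    and \<sigma> \<sigma>h :: "real \<Rightarrow> ((real^'n) \<times> (real^'n)) measure"
    and J :: "((real^'n) \<times> (real^'n)) measure"
    and K :: "(real^'n) measure"
    and \<delta> :: real
    and \<Omega> :: "nat \<Rightarrow> (real^'n) set" and \<rho> \<delta>s :: "nat \<Rightarrow> real"
    and u v :: "'n fn"
  assumes "open U"
    and "radon_on m U" and "full_support m U"
    and "case1 m U E G Gh \<or> case2 m U E G Gh"
    and "kernel_measures m U G \<sigma>" and "kernel_measures m U Gh \<sigma>h"
    and "jump_killing U E J K"
    and "\<delta> > 0" and "Udelta U \<delta> \<noteq> {}"
    and "admissible U J \<delta> \<Omega> \<rho> \<delta>s"
    and "u \<in> C0inf (Udelta U \<delta>)" and "v \<in> C0inf (Udelta U \<delta>)"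
  shows "(E u v = Ecd \<sigma> \<Omega> \<rho> \<delta>s u v
            + set_lebesgue_integral J (offdiag U)
                (\<lambda>z. 2 * (u (snd z) - u (fst z) - drift u \<delta> z) * v (snd z))
            + (\<integral>x. u x * v x \<partial>K))
    \<and> (\<forall>\<psi>. \<psi> \<in> C0inf U \<longrightarrow>
           (\<exists>W. open W \<and> tsupp u \<union> tsupp v \<subseteq> W \<and> (\<forall>x\<in>W. \<psi> x = 1)) \<longrightarrow>
        (E u v = Ecd \<sigma> \<Omega> \<rho> \<delta>s u v
            + set_lebesgue_integral J (offdiag U)
                (\<lambda>z. 2 * ((u (snd z) - u (fst z)) * \<psi> (fst z) - drift u \<delta> z) * v (snd z))
            + E \<psi> (\<lambda>x. u x * v x)
       \<and> E v u = Ecd \<sigma>h \<Omega> \<rho> \<delta>s u v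
            + set_lebesgue_integral (Jhat J) (offdiag U)
                (\<lambda>z. 2 * ((u (snd z) - u (fst z)) * \<psi> (fst z) - drift u \<delta> z) * v (snd z))
            + E (\<lambda>x. u x * v x) \<psi>))"
proof -
  note rc = \<open>case1 m U E G Gh \<or> case2 m U E G Gh\<close> and jk = \<open>jump_killing U E J K\<close>
    and adm = \<open>admissible U J \<delta> \<Omega> \<rho> \<delta>s\<close> and \<delta> = \<open>\<delta> > 0\<close>
    and u = \<open>u \<in> C0inf (Udelta U \<delta>)\<close> and v = \<open>v \<in> C0inf (Udelta U \<delta>)\<close>
  interpret P: approximated_form U m E \<sigma> J
    by (rule approximated_form_resolvent[OF assms(1,2,4,5,7)])
  interpret H: approximated_form U m "\<lambda>u v. E v u" \<sigma>h "Jhat J"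
    by (rule approximated_form_coresolvent[OF assms(1,2,4,6,7)])
  have "Udelta U \<delta> \<subseteq> U"
    by (auto simp: Udelta_def)
  then have uU: "u \<in> C0inf U" and vU: "v \<in> C0inf U"
    using u v C0inf_mono by blast+
  have uvU: "(\<lambda>x. u x * v x) \<in> C0inf U"
    using uU vU by (intro C0inf_mult_right C0infD(1))
  \<comment> \<open>\<open>compensated\<close> does not depend on the form or the measures, so the
    one rewriting serves both interpretations.\<close>
  have comp: "indicator (offdiag U) z *\<^sub>R (2 * ((u (snd z) - u (fst z)) * \<psi> (fst z) - drift u \<delta> z) * v (snd z))
      = 2 * (P.compensated \<psi> u v \<delta> z * indicator (offdiag U) z)" for \<psi> z
    by (simp add: P.compensated_def)
  have ii: "E u v = Ecd \<sigma> \<Omega> \<rho> \<delta>s u v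
            + set_lebesgue_integral J (offdiag U)
                (\<lambda>z. 2 * ((u (snd z) - u (fst z)) * \<psi> (fst z) - drift u \<delta> z) * v (snd z))
            + E \<psi> (\<lambda>x. u x * v x)
       \<and> E v u = Ecd \<sigma>h \<Omega> \<rho> \<delta>s u v
            + set_lebesgue_integral (Jhat J) (offdiag U)
                (\<lambda>z. 2 * ((u (snd z) - u (fst z)) * \<psi> (fst z) - drift u \<delta> z) * v (snd z))
            + E (\<lambda>x. u x * v x) \<psi>"
    if \<psi>: "\<psi> \<in> C0inf U" and W: "open W" "tsupp u \<union> tsupp v \<subseteq> W" "\<forall>x\<in>W. \<psi> x = 1" for \<psi> W
    unfolding set_lebesgue_integral_def comp
    using P.decomposition(2)[OF \<delta> adm u v \<psi> W(1,2)] H.decomposition(2)[OF \<delta> admissible_Jhat[OF adm P.sets_J] u v \<psi> W(1,2)] W(3)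
    by simp
  have i: "E u v = Ecd \<sigma> \<Omega> \<rho> \<delta>s u v
            + set_lebesgue_integral J (offdiag U)
                (\<lambda>z. 2 * (u (snd z) - u (fst z) - drift u \<delta> z) * v (snd z))
            + (\<integral>x. u x * v x \<partial>K)"
  proof -
    have S: "compact (tsupp u \<union> tsupp v)" "tsupp u \<union> tsupp v \<subseteq> U"
      using C0infD(2,3)[OF uU] C0infD(2,3)[OF vU] by auto
    \<comment> \<open>The product u v may change sign, whereas \<open>integrable_escape\<close>
      needs a nonnegative function. So \<theta> dominates u v up to a constant, and \<psi> below is
      taken to be 1 near the support of \<theta>.\<close>
    obtain \<theta> V0 where \<theta>: "\<theta> \<in> C0inf U" "\<And>x. 0 \<le> \<theta> x" "tsupp u \<union> tsupp v \<subseteq> V0" "\<And>x. x \<in> V0 \<Longrightarrow> \<theta> x = 1"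
      using cutoff_exists[OF S(1) assms(1) S(2)] by metis
    have S': "compact (tsupp u \<union> tsupp v \<union> tsupp \<theta>)" "tsupp u \<union> tsupp v \<union> tsupp \<theta> \<subseteq> U"
      using S C0infD(2,3)[OF \<theta>(1)] by auto
    obtain \<psi> V where \<psi>: "\<psi> \<in> C0inf U" "\<And>x. 0 \<le> \<psi> x" "\<And>x. \<psi> x \<le> 1"
      and V: "open V" "tsupp u \<union> tsupp v \<union> tsupp \<theta> \<subseteq> V" "\<And>x. x \<in> V \<Longrightarrow> \<psi> x = 1"
      using cutoff_exists[OF S'(1) assms(1) S'(2)] by metis
    have escape: "integrable J (\<lambda>z. indicator U (fst z) * (1 - \<psi> (fst z)) * \<theta> (snd z))"
    proof (rule P.integrable_escape[OF _ \<theta>(1,2) \<psi>(1,3) V(1)])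
      show "0 \<le> E \<kappa> \<theta>" if "\<kappa> \<in> C0inf U" "\<And>x. 0 \<le> \<kappa> x \<and> \<kappa> x \<le> 1" "\<And>x. x \<in> tsupp \<theta> \<Longrightarrow> \<kappa> x = 1" for \<kappa>
        using that(1,2) \<theta>(1,2) that(3) by (rule resolvent_form_nonneg[OF rc])
    qed (use V in auto)
    \<comment> \<open>The contribution of jumps from where \<psi> is not 1; it is the difference
      between the integrands of (i) and (ii), up to the factor 2.\<close>
    define R where "R z = (1 - \<psi> (fst z)) * (u (snd z) * v (snd z)) * indicator (offdiag U) z" for z
    obtain B where B: "B > 0" "\<And>x. \<bar>u x * v x\<bar> \<le> B"
      using C0inf_bounded[OF uvU] by blast
    have mO: "offdiag U \<in> sets borel"
      by (intro borel_open open_offdiag assms(1))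
    have intR: "integrable J R"
    proof (rule Bochner_Integration.integrable_bound)
      show "integrable J (\<lambda>z. B * (indicator U (fst z) * (1 - \<psi> (fst z)) * \<theta> (snd z)))"
        by (rule integrable_mult_right[OF escape])
      show "R \<in> borel_measurable J"
        unfolding R_def
        by (intro P.measurable_J borel_measurable_times borel_measurable_diff borel_measurable_indicator mO
            borel_measurable_continuous_onI continuous_on_compose2[OF C0infD(4)[OF \<psi>(1), of UNIV]]
            continuous_on_compose2[OF C0infD(4)[OF uU, of UNIV]] continuous_on_compose2[OF C0infD(4)[OF vU, of UNIV]]
            continuous_intros) auto
      have "\<bar>R z\<bar> \<le> B * (indicator U (fst z) * (1 - \<psi> (fst z)) * \<theta> (snd z))" for z
      proof (cases "z \<in> offdiag U \<and> u (snd z) \<noteq> 0")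
        case True
        then have x: "fst z \<in> U" and y: "snd z \<in> tsupp u"
          using zero_outside_tsupp[of "snd z" u] by (auto simp: offdiag_def)
        then have "\<theta> (snd z) = 1"
          using \<theta>(3,4) by blast
        moreover have "\<bar>R z\<bar> = (1 - \<psi> (fst z)) * \<bar>u (snd z) * v (snd z)\<bar>"
          using True \<psi>(3)[of "fst z"] by (simp add: R_def abs_mult)
        moreover have "\<dots> \<le> (1 - \<psi> (fst z)) * B"
          using \<psi>(3)[of "fst z"] B(2)[of "snd z"] by (intro mult_left_mono) auto
        ultimately show ?thesis
          using x by (simp add: mult.commute)
      next
        case False
        then have "R z = 0"
          by (auto simp: R_def)
        then show ?thesis
          using B(1) \<psi>(3)[of "fst z"] \<theta>(2)[of "snd z"] by simp
      qed
      then show "AE z in J. norm (R z) \<le> norm (B * (indicator U (fst z) * (1 - \<psi> (fst z)) * \<theta> (snd z)))"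
        by (intro always_eventually allI) (auto intro: order_trans[OF _ abs_ge_self])
    qed
    have \<psi>uv: "\<psi> x * (u x * v x) = u x * v x" for x
      using V zero_outside_tsupp[of x u] by (cases "x \<in> tsupp u") auto
    \<comment> \<open>Near the support of u v the function \<psi> is the constant 1, so E \<psi> (u
      v) has a representation by J and K, and its increments there are 1 - \<psi>(x).\<close>
    have killing: "E \<psi> (\<lambda>x. u x * v x) = 2 * (\<integral>z. R z \<partial>J) + (\<integral>x. u x * v x \<partial>K)"
    proof -
      have "tsupp (\<lambda>x. u x * v x) \<subseteq> tsupp u"
        by (rule tsupp_minimal[OF closed_tsupp]) (simp add: zero_outside_tsupp)
      then have "tsupp (\<lambda>x. u x * v x) \<subseteq> V"
        using V(2) by blast
      then have "\<exists>W c. open W \<and> tsupp (\<lambda>x. u x * v x) \<subseteq> W \<and> (\<forall>x\<in>W. \<psi> x = c)"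
        using V(1,3) by blast
      then have "E \<psi> (\<lambda>x. u x * v x) = set_lebesgue_integral J (offdiag U)
          (\<lambda>z. 2 * (\<psi> (snd z) - \<psi> (fst z)) * (u (snd z) * v (snd z))) + (\<integral>x. \<psi> x * (u x * v x) \<partial>K)"
        using jk \<psi>(1) uvU unfolding jump_killing_def by blast
      moreover have "indicator (offdiag U) z *\<^sub>R (2 * (\<psi> (snd z) - \<psi> (fst z)) * (u (snd z) * v (snd z))) = 2 * R z" for z
        using \<psi>uv[of "snd z"] by (auto simp add: R_def algebra_simps)
      ultimately show ?thesis
        unfolding set_lebesgue_integral_def \<psi>uv by simp
    qed
    \<comment> \<open>Since \<psi> u = u, the full increment is the truncated one plus (1 -
      \<psi>(x)) u(y).\<close>
    have "indicator (offdiag U) z *\<^sub>R (2 * (u (snd z) - u (fst z) - drift u \<delta> z) * v (snd z))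
        = 2 * (P.compensated \<psi> u v \<delta> z * indicator (offdiag U) z) + 2 * R z" for z
    proof -
      have "\<psi> (fst z) * u (fst z) = u (fst z)"
        using V zero_outside_tsupp[of "fst z" u] by (cases "fst z \<in> tsupp u") auto
      then have "(u (snd z) - u (fst z)) * \<psi> (fst z) = u (snd z) * \<psi> (fst z) - u (fst z)"
        by (simp add: algebra_simps)
      then show ?thesis
        by (simp only: P.compensated_def R_def) (simp add: algebra_simps)
    qed
    note split = this
    have W: "tsupp u \<union> tsupp v \<subseteq> V" "\<forall>x\<in>V. \<psi> x = 1"
      using V by auto
    \<comment> \<open>Splitting the jump integral needs both parts integrable: the compensated one
      by the quadratic majorant, R by the finite escape mass.\<close>
    have intC: "integrable J (\<lambda>z. P.compensated \<psi> u v \<delta> z * indicator (offdiag U) z)"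
      using mO P.sets_J by (intro integrable_real_mult_indicator P.decomposition(1)[OF \<delta> adm u v \<psi>(1) V(1) W(1)]) (use W in auto)
    have "set_lebesgue_integral J (offdiag U) (\<lambda>z. 2 * (u (snd z) - u (fst z) - drift u \<delta> z) * v (snd z))
        = 2 * (\<integral>z. P.compensated \<psi> u v \<delta> z * indicator (offdiag U) z \<partial>J) + 2 * (\<integral>z. R z \<partial>J)"
      unfolding set_lebesgue_integral_def split using intC intR by simp
    moreover have "E u v = Ecd \<sigma> \<Omega> \<rho> \<delta>s u v
        + 2 * (\<integral>z. P.compensated \<psi> u v \<delta> z * indicator (offdiag U) z \<partial>J) + E \<psi> (\<lambda>x. u x * v x)"
      using P.decomposition(2)[OF \<delta> adm u v \<psi>(1) V(1) W(1)] W(2) by blast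
    ultimately show ?thesis
      using killing by simp
  qed
  show ?thesis
    using i ii by blast
qed

end
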